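(* The boundary of $\mathbf{R}_d$ in $\mathbb{P}(\mathrm{Hom}(\Lambda^2V,S_d))$ consists of varieties isomorphic to $\mathbf{R}_{d'}\times\mathbb{P}(S_{d-d'})$, for every integer $d'$ with $0\le d'<d$, and of $\overline{\mathbf{R}_{d,0}}\cup\overline{\mathbf{R}'_{d,0}}$.
   Context: Work over $\mathbb{C}$, $d\ge3$. $S_n$ is the irreducible representation of $SL_2$ of dimension $n+1$ ($S_n=H^0(\mathbb{P}^1,\mathcal{O}(n))$). $V$ is a $4$-dimensional space with $\mathbb{P}^3=\mathbb{P}(V)$; $q$ is the quadratic form on $\Lambda^2V$ given by the wedge product; $\mathbb{G}\subset\mathbb{P}(\Lambda^2V)$ is the quadric it defines (the Grassmannian of lines of $\mathbb{P}^3$), with tautological sequence $0\to K\to V\otimes\mathcal{O}_{\mathbb{G}}\to Q\to0$. For any $e\ge0$, $\mathbf{R}_e\subset\mathrm{Mor}_e(\mathbb{P}^1,\mathbb{G})$ is the set of degree $e$ morphisms $f$ with $f(\mathbb{P}^1)$ not contained in a plane totally isotropic for $q$. $\mathbf{R}_{d,0}$ (resp. $\mathbf{R}'_{d,0}$) is the set of $f\in\mathrm{Mor}_d(\mathbb{P}^1,\mathbb{G})$ with $f^*Q\simeq\mathcal{O}\oplus\mathcal{O}(d)$ (resp. $f^*K^\vee\simeq\mathcal{O}\oplus\mathcal{O}(d)$). $\mathrm{Mor}_d(\mathbb{P}^1,\mathbb{G})$ is embedded in $\mathbb{P}(\mathrm{Hom}(\Lambda^2V,S_d))$ by sending $f$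 to the map on sections of the surjection $\Lambda^2V\otimes\mathcal{O}_{\mathbb{P}^1}\to\mathcal{O}_{\mathbb{P}^1}(d)$ defining $\mathbb{P}^1\to\mathbb{G}\subset\mathbb{P}(\Lambda^2V)$. Closures are taken in this projective space, and the boundary of $\mathbf{R}_d$ is $\overline{\mathbf{R}_d}\setminus\mathbf{R}_d$. The inclusion of $\mathbf{R}_{d'}\times\mathbb{P}(S_{d-d'})$ in $\overline{\mathbf{R}_d}$ sends $(\psi',\xi)$, with $\psi':\Lambda^2V\to S_{d'}$, to the composite of $\psi'$ with multiplication by $\xi$, $S_{d'}\to S_d$. *)

theory Defs
  imports "HOL-Analysis.Analysis" "HOL-Computational_Algebra.Polynomial"
begin

section \<open>Quasi-projective varieties over the complex numbers\<close>

text \<open>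
  Homogeneous coordinates are functions on an index type. A point of projective space is the set
  of all its coordinate vectors. The index type may be infinite, so that it can serve
  all degrees at once; an actual projective space is cut out by a finite set of indices.
\<close>

definition pt :: "('i \<Rightarrow> complex) \<Rightarrow> ('i \<Rightarrow> complex) set" where
  "pt v = {(\<lambda>i. c * v i) | c. c \<noteq> 0}"

definition proj_space :: "'i set \<Rightarrow> ('i \<Rightarrow> complex) set set" where
  "proj_space I = {pt v | v. v \<noteq> (\<lambda>_. 0) \<and> (\<forall>i. i \<notin> I \<longrightarrow> v i = 0)}"

text \<open>The zero polynomial is homogeneous of every degree.\<close>

inductive homog_poly :: "nat \<Rightarrow> (('i \<Rightarrow> complex) \<Rightarrow> complex) \<Rightarrow> bool" where
  const: "homog_poly 0 (\<lambda>_. c)"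
| coord: "homog_poly 1 (\<lambda>v. v i)"
| add: "homog_poly n f \<Longrightarrow> homog_poly n g \<Longrightarrow> homog_poly n (\<lambda>v. f v + g v)"
| mult: "homog_poly m f \<Longrightarrow> homog_poly n g \<Longrightarrow> homog_poly (m + n) (\<lambda>v. f v * g v)"

definition zariski_closed :: "'i set \<Rightarrow> ('i \<Rightarrow> complex) set set \<Rightarrow> bool" where
  "zariski_closed I Z \<longleftrightarrow>
    (\<exists>F. (\<forall>f\<in>F. \<exists>n. homog_poly n f) \<and>
         Z = {p \<in> proj_space I. \<forall>f\<in>F. \<forall>v\<in>p. f v = 0})"

definition zariski_closure :: "'i set \<Rightarrow> ('i \<Rightarrow> complex) set set \<Rightarrow> ('i \<Rightarrow> complex) set set" where
  "zariski_closure I A = \<Inter> {Z. zariski_closed I Z \<and> A \<subseteq> Z}"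

definition quasi_projective :: "('i \<Rightarrow> complex) set set \<Rightarrow> bool" where
  "quasi_projective X \<longleftrightarrow>
    (\<exists>I Z Y. finite I \<and> zariski_closed I Z \<and> zariski_closed I Y \<and> X = Z - Y)"

text \<open>
  A map is regular if, near every point, its homogeneous coordinates are homogeneous polynomials
  of one common degree. The neighbourhood can be taken to be the locus where
  these polynomials do not all vanish.
\<close>

definition regular_map ::
  "('i \<Rightarrow> complex) set set \<Rightarrow> (('i \<Rightarrow> complex) set \<Rightarrow> ('j \<Rightarrow> complex) set) \<Rightarrow> bool" where
  "regular_map X \<phi> \<longleftrightarrow>
    (\<forall>p\<in>X. \<exists>n G. (\<forall>j. homog_poly n (\<lambda>v. G v j)) \<and>
       (\<forall>v\<in>p. G v \<noteq> (\<lambda>_. 0)) \<and>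
       (\<forall>v. pt v \<in> X \<and> G v \<noteq> (\<lambda>_. 0) \<longrightarrow> \<phi> (pt v) = pt (G v)))"

definition variety_iso ::
  "(('i \<Rightarrow> complex) set \<Rightarrow> ('j \<Rightarrow> complex) set) \<Rightarrow>
   ('i \<Rightarrow> complex) set set \<Rightarrow> ('j \<Rightarrow> complex) set set \<Rightarrow> bool" where
  "variety_iso \<phi> X Y \<longleftrightarrow>
    quasi_projective X \<and> quasi_projective Y \<and> bij_betw \<phi> X Y \<and>
    regular_map X \<phi> \<and> regular_map Y (inv_into X \<phi>)"

text \<open>Products of quasi-projective varieties, as varieties, are defined by the Segre embedding.\<close>

definition segre :: "('i \<Rightarrow> complex) \<Rightarrow> ('j \<Rightarrow> complex) \<Rightarrow> ('i \<times> 'j \<Rightarrow> complex) set" where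
  "segre v w = pt (\<lambda>(i, j). v i * w j)"

definition variety_prod ::
  "('i \<Rightarrow> complex) set set \<Rightarrow> ('j \<Rightarrow> complex) set set \<Rightarrow> ('i \<times> 'j \<Rightarrow> complex) set set" where
  "variety_prod X Y = {segre v w | v w. pt v \<in> X \<and> pt w \<in> Y}"


section \<open>Binary forms\<close>

text \<open>
  The space \<open>S\<^sub>n = H\<^sup>0(P\<^sup>1, O(n))\<close> of binary forms of degree \<open>n\<close>: the polynomial \<open>p\<close>
  of degree at most \<open>n\<close> stands for the form \<open>\<Sum>i\<le>n. coeff p i * s ^ i * t ^ (n - i)\<close>.
  Multiplication \<open>S\<^sub>m \<times> S\<^sub>n \<rightarrow> S\<^sub>m\<^sub>+\<^sub>n\<close> is multiplication of polynomials.
\<close>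

definition forms :: "nat \<Rightarrow> complex poly set" where
  "forms n = {p. degree p \<le> n}"

definition form_eval :: "nat \<Rightarrow> complex poly \<Rightarrow> complex \<Rightarrow> complex \<Rightarrow> complex" where
  "form_eval n p s t = (\<Sum>i\<le>n. coeff p i * s ^ i * t ^ (n - i))"

definition proj_forms :: "nat \<Rightarrow> (nat \<Rightarrow> complex) set set" where
  "proj_forms n = {pt (coeff \<xi>) | \<xi>. \<xi> \<in> forms n \<and> \<xi> \<noteq> 0}"

text \<open>
  The space \<open>Hom(W, S\<^sub>n)\<close> for \<open>W = \<complex>\<^sup>k\<close>, a linear map being given by the images of the
  standard basis. Equivalently, these are the morphisms of bundles \<open>W \<otimes> O \<rightarrow> O(n)\<close> on \<open>P\<^sup>1\<close>;
  \<open>hom_eval n \<psi> s t\<close> is the linear form on \<open>W\<close> (in the dual basis) induced on fibres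
  over the point \<open>(s : t)\<close>.
\<close>

definition homs :: "nat \<Rightarrow> (complex poly ^ 'k) set" where
  "homs n = {\<psi>. \<forall>k. \<psi> $ k \<in> forms n}"

definition hom_eval :: "nat \<Rightarrow> complex poly ^ 'k \<Rightarrow> complex \<Rightarrow> complex \<Rightarrow> complex ^ 'k" where
  "hom_eval n \<psi> s t = (\<chi> k. form_eval n (\<psi> $ k) s t)"

definition hom_coords :: "complex poly ^ 'k \<Rightarrow> 'k \<times> nat \<Rightarrow> complex" where
  "hom_coords \<psi> = (\<lambda>(k, i). coeff (\<psi> $ k) i)"

text \<open>\<open>proj_space (hom_index n)\<close> is the projective space \<open>P(Hom(W, S\<^sub>n))\<close> of lines in \<open>Hom(W, S\<^sub>n)\<close>.\<close>

definition hom_index :: "nat \<Rightarrow> ('k \<times> nat) set" where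
  "hom_index n = UNIV \<times> {..n}"

definition pairing :: "complex ^ 'k \<Rightarrow> complex ^ 'k \<Rightarrow> complex" where
  "pairing l v = (\<Sum>k\<in>UNIV. l $ k * v $ k)"


section \<open>The Grassmannian of lines in three-space\<close>

text \<open>
  \<open>V = \<complex>\<^sup>4\<close>, and \<open>\<Lambda>\<^sup>2V = \<complex>\<^sup>6\<close> with basis
  \<open>e\<^sub>1\<and>e\<^sub>2, e\<^sub>1\<and>e\<^sub>3, e\<^sub>1\<and>e\<^sub>4, e\<^sub>2\<and>e\<^sub>3, e\<^sub>2\<and>e\<^sub>4, e\<^sub>3\<and>e\<^sub>4\<close>.
\<close>

definition wedge :: "complex ^ 4 \<Rightarrow> complex ^ 4 \<Rightarrow> complex ^ 6" where
  "wedge v w = vector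
     [v $ 1 * w $ 2 - v $ 2 * w $ 1, v $ 1 * w $ 3 - v $ 3 * w $ 1, v $ 1 * w $ 4 - v $ 4 * w $ 1,
      v $ 2 * w $ 3 - v $ 3 * w $ 2, v $ 2 * w $ 4 - v $ 4 * w $ 2, v $ 3 * w $ 4 - v $ 4 * w $ 3]"

text \<open>
  \<open>\<omega> \<and> \<omega> = 2 q(\<omega>) e\<^sub>1\<and>e\<^sub>2\<and>e\<^sub>3\<and>e\<^sub>4\<close>. A point of \<open>P(\<Lambda>\<^sup>2V)\<close> is a one-dimensional quotient of
  \<open>\<Lambda>\<^sup>2V\<close>, i.e. a line in the dual space, on which \<open>q\<close> acts through the isomorphism
  \<open>\<Lambda>\<^sup>2V \<simeq> (\<Lambda>\<^sup>2V)\<^sup>*\<close> that it defines. The matrix of the polar form of \<open>q\<close> is its own inverse,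
  so the same formula gives \<open>q\<close> on linear forms, in the coordinates of the dual basis.
\<close>

definition q :: "complex ^ 6 \<Rightarrow> complex" where
  "q \<omega> = \<omega> $ 1 * \<omega> $ 6 - \<omega> $ 2 * \<omega> $ 5 + \<omega> $ 3 * \<omega> $ 4"

text \<open>
  The linear form \<open>\<eta>\<close> on \<open>\<Lambda>\<^sup>2V\<close> with \<open>q \<eta> = 0\<close>, \<open>\<eta> \<noteq> 0\<close> is the point \<open>V \<rightarrow> V/K\<close> of the
  Grassmannian for which \<open>\<eta>\<close> is the map \<open>\<Lambda>\<^sup>2V \<rightarrow> \<Lambda>\<^sup>2(V/K) \<simeq> \<complex>\<close>; \<open>taut_K \<eta>\<close> is the fibre \<open>K\<close>
  of the tautological subbundle, and the fibre of \<open>Q\<close> is \<open>V/K\<close>.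
\<close>

definition taut_K :: "complex ^ 6 \<Rightarrow> (complex ^ 4) set" where
  "taut_K \<eta> = {v. \<forall>w. pairing \<eta> (wedge v w) = 0}"

definition annihilator :: "(complex ^ 4) set \<Rightarrow> (complex ^ 4) set" where
  "annihilator U = {l. \<forall>v\<in>U. pairing l v = 0}"


section \<open>Rational curves on the Grassmannian\<close>

text \<open>
  A morphism of degree \<open>e\<close> from \<open>P\<^sup>1\<close> to the quadric is a surjection \<open>\<Lambda>\<^sup>2V \<otimes> O \<rightarrow> O(e)\<close>, up to a
  nonzero scalar, that at every point of \<open>P\<^sup>1\<close> lies on the quadric. The set \<open>Mor e\<close>
  consists of the corresponding maps on sections \<open>\<Lambda>\<^sup>2V \<rightarrow> S\<^sub>e\<close>.
\<close>

definition Mor :: "nat \<Rightarrow> (complex poly ^ 6) set" where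
  "Mor e = {\<psi> \<in> homs e. \<forall>s t. (s, t) \<noteq> (0, 0) \<longrightarrow>
              hom_eval e \<psi> s t \<noteq> 0 \<and> q (hom_eval e \<psi> s t) = 0}"

definition isotropic_plane :: "(complex ^ 6) set \<Rightarrow> bool" where
  "isotropic_plane P \<longleftrightarrow> vec.subspace P \<and> vec.dim P = 3 \<and> (\<forall>\<eta>\<in>P. q \<eta> = 0)"

definition R :: "nat \<Rightarrow> (6 \<times> nat \<Rightarrow> complex) set set" where
  "R e = {pt (hom_coords \<psi>) | \<psi>. \<psi> \<in> Mor e \<and>
            \<not> (\<exists>P. isotropic_plane P \<and>
                   (\<forall>s t. (s, t) \<noteq> (0, 0) \<longrightarrow> hom_eval e \<psi> s t \<in> P))}"

text \<open>
  Let \<open>N s t \<subseteq> W = \<complex>\<^sup>4\<close> be the fibres of a subbundle \<open>N\<close> of \<open>W \<otimes> O\<close> on \<open>P\<^sup>1\<close>. An isomorphism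
  from the bundle \<open>(W \<otimes> O)/N\<close> to \<open>O(a) \<oplus> O(b)\<close> is a morphism \<open>W \<otimes> O \<rightarrow> O(a) \<oplus> O(b)\<close>, i.e. a
  pair of elements of \<open>Hom(W, S\<^sub>a)\<close> and \<open>Hom(W, S\<^sub>b)\<close>, which is surjective with
  kernel \<open>N\<close> on every fibre.
\<close>

definition quotient_iso_split ::
  "(complex \<Rightarrow> complex \<Rightarrow> (complex ^ 4) set) \<Rightarrow> nat \<Rightarrow> nat \<Rightarrow> bool" where
  "quotient_iso_split N a b \<longleftrightarrow>
    (\<exists>\<alpha>\<in>homs a. \<exists>\<beta>\<in>homs b. \<forall>s t. (s, t) \<noteq> (0, 0) \<longrightarrow>
       (let \<phi> = (\<lambda>v. (pairing (hom_eval a \<alpha> s t) v, pairing (hom_eval b \<beta> s t) v))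
        in surj \<phi> \<and> {v. \<phi> v = (0, 0)} = N s t))"

definition R0 :: "nat \<Rightarrow> (6 \<times> nat \<Rightarrow> complex) set set" where
  "R0 d = {pt (hom_coords \<psi>) | \<psi>. \<psi> \<in> Mor d \<and>
             quotient_iso_split (\<lambda>s t. taut_K (hom_eval d \<psi> s t)) 0 d}"

text \<open>The dual of \<open>K\<close> is the quotient of \<open>V\<^sup>* \<otimes> O\<close> by the annihilator of \<open>K\<close>.\<close>

definition R0' :: "nat \<Rightarrow> (6 \<times> nat \<Rightarrow> complex) set set" where
  "R0' d = {pt (hom_coords \<psi>) | \<psi>. \<psi> \<in> Mor d \<and>
              quotient_iso_split (\<lambda>s t. annihilator (taut_K (hom_eval d \<psi> s t))) 0 d}"

text \<open>
  The image of \<open>R\<^sub>e \<times> P(S\<^sub>d\<^sub>-\<^sub>e)\<close> in \<open>P(Hom(\<Lambda>\<^sup>2V, S\<^sub>d))\<close> under multiplication of forms.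
\<close>

definition stratum :: "nat \<Rightarrow> nat \<Rightarrow> (6 \<times> nat \<Rightarrow> complex) set set" where
  "stratum d e = {pt (hom_coords (\<xi> *s \<psi>)) | \<psi> \<xi>.
                    pt (hom_coords \<psi>) \<in> R e \<and> \<xi> \<in> forms (d - e) \<and> \<xi> \<noteq> 0}"

end

theory Submission
  imports Defs "HOL-Computational_Algebra.Fundamental_Theorem_Algebra"
begin

text \<open>
  Write a point of the projective space of \<open>Hom(\<Lambda>\<^sup>2V, S\<^sub>d)\<close> as a tuple \<open>\<phi>\<close> of six binary forms of degree
  \<open>d\<close>. The theorem rests on one fact, \<open>closure_R\<close>: the closure of \<open>R d\<close> is the set of all tuples
  with \<open>q(\<phi>) = 0\<close> identically, base points allowed. Given this, the boundary is read off
  by removing the base points, \<open>\<phi> = \<xi> \<psi>\<close>. If the values of \<open>\<phi>\<close> do not span an isotropic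
  subspace, then \<open>\<psi>\<close> belongs to \<open>R d'\<close> for some \<open>d'\<close>, and \<open>d' < d\<close> off \<open>R d\<close>. If they do span one, this
  subspace belongs to one of two families (\<open>isotropic_classification\<close>): either \<open>\<phi>\<close> or its dual
  tuple has the form \<open>l \<and> \<gamma>\<close> with a constant vector \<open>l\<close>. Without base points these are
  exactly the splitting types defining \<open>R0\<close> and \<open>R0'\<close>, and a general choice of \<open>\<gamma>\<close> has no base points,
  so \<open>\<phi>\<close> is in the closure of \<open>R0\<close> or \<open>R0'\<close>. In the other direction, spanning an
  isotropic subspace is a closed condition, so these two closures do not meet \<open>R d\<close>.

  To see that every isotropic tuple is a limit of elements of \<open>R d\<close>, split it as
  \<open>\<phi> = \<beta> \<and> \<gamma>\<close>, where \<open>\<beta>\<close> has no base points and the degrees satisfy \<open>b + a = d\<close>, \<open>b \<le> a\<close>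
  (\<open>quad_zero_decompose\<close>). If \<open>b \<ge> 1\<close>, a general member of the linear family \<open>\<beta> \<and> \<gamma>'\<close> has no base
  points (\<open>ex_basefree_wedge\<close>) and spans no isotropic subspace (\<open>ex_not_isotropic_wedge\<close>), so
  a general line through \<open>\<phi>\<close> in this family meets \<open>R d\<close> in all but finitely many points. If
  \<open>b = 0\<close>, then \<open>\<beta>\<close> is a constant \<open>l\<close>, and after a general choice of \<open>\<gamma>\<close> the
  line \<open>l \<and> \<gamma> + \<epsilon> k \<and> \<delta>\<close>, where \<open>\<gamma> = k + x \<delta>\<close>, leads from \<open>\<phi>\<close> into \<open>R d\<close>
  (\<open>deform_off_plane\<close>). These deformations replace a dimension count.

  For the strata, multiplication \<open>(\<psi>, \<xi>) \<mapsto> \<xi> \<psi>\<close> is a linear map on Segre coordinates. On points of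
  the product it is injective because the base-point-free part of a tuple is unique. Its inverse is regular because
  \<open>\<psi> \<otimes> \<xi>\<close> spans the solution space of a linear system whose coefficients are linear in the
  coordinates of \<open>\<xi> \<psi>\<close> (\<open>factor_kernel\<close>), and a one-dimensional solution space depends on the
  coefficients through homogeneous polynomials (\<open>elimination_kernel\<close>). The companion
  \<open>elimination_closed\<close> shows that having a common factor of a given degree is a closed
  condition, which makes the strata quasi-projective.
\<close>

section \<open>Exterior algebra of a four-dimensional space\<close>

lemma exhaust_6:
  fixes x :: 6
  shows "x = 1 \<or> x = 2 \<or> x = 3 \<or> x = 4 \<or> x = 5 \<or> x = 6"
proof (induct x)
  case (of_int z)
  then have "z = 0 \<or> z = 1 \<or> z = 2 \<or> z = 3 \<or> z = 4 \<or> z = 5" by fastforce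
  then show ?case by auto
qed

lemma forall_6: "(\<forall>i::6. P i) \<longleftrightarrow> P 1 \<and> P 2 \<and> P 3 \<and> P 4 \<and> P 5 \<and> P 6"
  by (metis exhaust_6)

lemma UNIV_6: "UNIV = {1, 2, 3, 4, 5, 6::6}"
  using exhaust_6 by auto

lemma sum_6: "sum f (UNIV::6 set) = f 1 + f 2 + f 3 + f 4 + f 5 + f 6"
  unfolding UNIV_6 by (simp add: ac_simps)

lemma vector_4 [simp]:
  "(vector [a,b,c,d] :: 'a::zero^4) $ 1 = a"
  "(vector [a,b,c,d] :: 'a::zero^4) $ 2 = b"
  "(vector [a,b,c,d] :: 'a::zero^4) $ 3 = c"
  "(vector [a,b,c,d] :: 'a::zero^4) $ 4 = d"
  unfolding vector_def by simp_all

lemma vector_6 [simp]: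
  "(vector [a,b,c,d,e,f] :: 'a::zero^6) $ 1 = a"
  "(vector [a,b,c,d,e,f] :: 'a::zero^6) $ 2 = b"
  "(vector [a,b,c,d,e,f] :: 'a::zero^6) $ 3 = c"
  "(vector [a,b,c,d,e,f] :: 'a::zero^6) $ 4 = d"
  "(vector [a,b,c,d,e,f] :: 'a::zero^6) $ 5 = e"
  "(vector [a,b,c,d,e,f] :: 'a::zero^6) $ 6 = f"
  unfolding vector_def by simp_all

text \<open>
  The constructions of exterior algebra over an arbitrary commutative ring, so that they apply
  both to vectors over the complex numbers and to vectors of polynomials.
\<close>

definition dot :: "'a::comm_ring_1 ^ 'k \<Rightarrow> 'a ^ 'k \<Rightarrow> 'a" where
  "dot l v = (\<Sum>k\<in>UNIV. l $ k * v $ k)"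

definition wdg :: "'a::comm_ring_1 ^ 4 \<Rightarrow> 'a ^ 4 \<Rightarrow> 'a ^ 6" where
  "wdg v w = vector
     [v $ 1 * w $ 2 - v $ 2 * w $ 1, v $ 1 * w $ 3 - v $ 3 * w $ 1, v $ 1 * w $ 4 - v $ 4 * w $ 1,
      v $ 2 * w $ 3 - v $ 3 * w $ 2, v $ 2 * w $ 4 - v $ 4 * w $ 2, v $ 3 * w $ 4 - v $ 4 * w $ 3]"

text \<open>
  Interior multiplication by a vector: \<open>\<eta>\<close> is read as the alternating form with matrix entries
  \<open>\<eta>\<^sub>i\<^sub>j\<close>, and \<open>contract \<eta> v\<close> is the linear form \<open>\<eta>(v, \<cdot>)\<close>.
\<close>

definition contract :: "'a::comm_ring_1 ^ 6 \<Rightarrow> 'a ^ 4 \<Rightarrow> 'a ^ 4" where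
  "contract \<eta> v = vector
     [- v $ 2 * \<eta> $ 1 - v $ 3 * \<eta> $ 2 - v $ 4 * \<eta> $ 3,
      v $ 1 * \<eta> $ 1 - v $ 3 * \<eta> $ 4 - v $ 4 * \<eta> $ 5,
      v $ 1 * \<eta> $ 2 + v $ 2 * \<eta> $ 4 - v $ 4 * \<eta> $ 6,
      v $ 1 * \<eta> $ 3 + v $ 2 * \<eta> $ 5 + v $ 3 * \<eta> $ 6]"

text \<open>
  The isomorphism between a bivector and an alternating form that the wedge product induces. Up to
  sign, \<open>contract (star \<eta>) l\<close> is the trivector \<open>l \<and> \<eta>\<close>, written in the four dual coordinates.
  Both exterior and interior products are therefore expressed by \<open>contract\<close>, and
  \<open>star\<close> exchanges the two families of isotropic planes.
\<close>

definition star :: "'a::comm_ring_1 ^ 6 \<Rightarrow> 'a ^ 6" where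
  "star \<eta> = vector [\<eta> $ 6, - \<eta> $ 5, \<eta> $ 4, \<eta> $ 3, - \<eta> $ 2, \<eta> $ 1]"

definition quad :: "'a::comm_ring_1 ^ 6 \<Rightarrow> 'a" where
  "quad \<omega> = \<omega> $ 1 * \<omega> $ 6 - \<omega> $ 2 * \<omega> $ 5 + \<omega> $ 3 * \<omega> $ 4"

definition polar :: "'a::comm_ring_1 ^ 6 \<Rightarrow> 'a ^ 6 \<Rightarrow> 'a" where
  "polar \<eta> \<zeta> = \<eta> $ 1 * \<zeta> $ 6 + \<zeta> $ 1 * \<eta> $ 6 - \<eta> $ 2 * \<zeta> $ 5 - \<zeta> $ 2 * \<eta> $ 5 + \<eta> $ 3 * \<zeta> $ 4 + \<zeta> $ 3 * \<eta> $ 4"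

lemmas ext_simps = vec_eq_iff forall_4 forall_6 dot_def sum_4 sum_6 wdg_def contract_def star_def
  quad_def polar_def

lemma q_eq_quad: "q \<omega> = quad \<omega>" by (simp add: q_def quad_def)
lemma wedge_eq_wdg: "wedge v w = wdg v w" by (simp add: wedge_def wdg_def)
lemma pairing_eq_dot: "pairing = dot" by (simp add: pairing_def dot_def fun_eq_iff)

lemma star_star [simp]: "star (star \<eta>) = \<eta>" by (simp add: ext_simps)
lemma quad_star [simp]: "quad (star \<eta>) = quad \<eta>" by (simp add: ext_simps algebra_simps)
lemma polar_star [simp]: "polar (star \<eta>) (star \<zeta>) = polar \<eta> \<zeta>" by (simp add: ext_simps algebra_simps)
lemma polar_self: "polar \<eta> \<eta> = 2 * quad \<eta>" by (simp add: ext_simps algebra_simps)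
lemma polar_commute: "polar \<eta> \<zeta> = polar \<zeta> \<eta>" by (simp add: ext_simps algebra_simps)
lemma quad_add: "quad (\<eta> + \<zeta>) = quad \<eta> + quad \<zeta> + polar \<eta> \<zeta>" by (simp add: ext_simps algebra_simps)
lemma quad_wdg [simp]: "quad (wdg l m) = 0" by (simp add: ext_simps algebra_simps)
lemma contract_wdg: "contract (wdg l m) v = dot l v *s m - dot m v *s l"
  by (simp add: ext_simps algebra_simps)
lemma contract_star_wdg: "contract (star (wdg l m)) l = 0" "contract (star (wdg l m)) m = 0"
  by (simp_all add: ext_simps algebra_simps)
lemma dot_contract: "dot (contract \<eta> v) w = dot \<eta> (wdg v w)"
  by (simp add: ext_simps algebra_simps)
lemma dot_contract_skew: "dot (contract \<eta> v) w = - dot (contract \<eta> w) v"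
  by (simp add: ext_simps algebra_simps)
lemma contract_contract_star: "contract \<eta> (contract (star \<eta>) l) = - quad \<eta> *s l"
  by (simp add: ext_simps algebra_simps)
lemma contract_contract_star_polar:
  "contract \<eta> (contract (star \<zeta>) l) + contract \<zeta> (contract (star \<eta>) l) = - polar \<eta> \<zeta> *s l"
  by (simp add: ext_simps algebra_simps)
text \<open>
  The Cartan formula \<open>\<iota>\<^sub>v (l \<and> \<eta>) = l(v) \<eta> - l \<and> \<iota>\<^sub>v \<eta>\<close>. When \<open>l \<and> \<eta> = 0\<close> it exhibits \<open>l(v) \<eta>\<close> as a
  multiple of \<open>l\<close>, which is the source of all decompositions \<open>\<eta> = l \<and> m\<close> below.
\<close>

lemma koszul: "dot l v *s \<eta> = wdg l (contract \<eta> v) + star (wdg v (contract (star \<eta>) l))"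
  by (simp add: ext_simps algebra_simps)
lemma polar_wdg: "polar (wdg l m) \<zeta> = dot m (contract (star \<zeta>) l)"
  by (simp add: ext_simps algebra_simps)
lemma polar_wdg_wdg: "polar (wdg a b) (wdg c d) = - polar (wdg a c) (wdg b d)"
  by (simp add: ext_simps algebra_simps)
lemma wdg_linear: "wdg l (m + c *s n) = wdg l m + c *s wdg l n"
  by (simp add: ext_simps algebra_simps)
lemma wdg_scale: "wdg l (c *s n) = c *s wdg l n" "wdg (c *s l) n = c *s wdg l n"
  by (simp_all add: ext_simps algebra_simps)
lemma wdg_self [simp]: "wdg l l = 0" by (simp add: ext_simps algebra_simps)
lemma wdg_skew: "wdg m l = - wdg l m"  by (simp add: ext_simps algebra_simps)
lemma wdg_0 [simp]: "wdg 0 l = 0" "wdg l 0 = 0"  by (simp_all add: ext_simps)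
lemma star_linear: "star (\<eta> + c *s \<zeta>) = star \<eta> + c *s star \<zeta>" by (simp add: ext_simps algebra_simps)
lemma star_0 [simp]: "star 0 = 0" by (simp add: ext_simps)
lemma star_eq_0_iff [simp]: "star \<eta> = 0 \<longleftrightarrow> \<eta> = 0" by (metis star_star star_0)
lemma contract_0 [simp]: "contract \<eta> 0 = 0" "contract 0 v = 0" by (simp_all add: ext_simps)
lemma dot_commute: "dot l v = dot v l" by (simp add: dot_def mult.commute)
lemma dot_0 [simp]: "dot l 0 = 0" "dot 0 l = 0" by (simp_all add: dot_def)
lemma contract_scale: "contract \<eta> (c *s v) = c *s contract \<eta> v" "contract (c *s \<eta>) v = c *s contract \<eta> v"
   by (simp_all add: ext_simps algebra_simps)

lemma dot_axis: "dot v (axis k 1) = v $ k"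
  unfolding dot_def by (subst sum.cong[OF refl, of _ _ "\<lambda>i. if i = k then v $ i else 0"]) (auto simp: axis_def)

lemma ex_dot_nonzero: "v \<noteq> 0 \<Longrightarrow> \<exists>w. dot v w \<noteq> 0"
  by (metis dot_axis vec_eq_iff zero_index)

lemma wdg_eq_0_iff:
  fixes l m :: "'a::field ^ 4"
  assumes "l \<noteq> 0"
  shows "wdg l m = 0 \<longleftrightarrow> (\<exists>c. m = c *s l)"
proof
  assume "wdg l m = 0"
  obtain v where v: "dot l v \<noteq> 0" using ex_dot_nonzero[OF assms] by blast
  have "dot l v *s m = dot m v *s l" using contract_wdg[of l m v] \<open>wdg l m = 0\<close> by simp
  then have "m = (dot m v / dot l v) *s l"
    using v by (simp add: vec_eq_iff field_simps)
  then show "\<exists>c. m = c *s l" by blast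
next
  assume "\<exists>c. m = c *s l"
  then show "wdg l m = 0" by (auto simp: wdg_scale)
qed

section \<open>Vectors of binary forms and their base points\<close>

definition at_point :: "complex poly ^ 'k \<Rightarrow> complex \<Rightarrow> complex ^ 'k" where
  "at_point \<phi> x = (\<chi> k. poly (\<phi> $ k) x)"

text \<open>
  For a tuple of forms of degree \<open>n\<close>, \<open>coeff_vec \<psi> n\<close> is the value at the point at infinity
  \<open>(1 : 0)\<close>, as \<open>at_point \<psi> x\<close> is the value at \<open>(x : 1)\<close>.
\<close>

definition coeff_vec :: "complex poly ^ 'k \<Rightarrow> nat \<Rightarrow> complex ^ 'k" where
  "coeff_vec \<phi> i = (\<chi> k. coeff (\<phi> $ k) i)"

definition const_vec :: "complex ^ 'k \<Rightarrow> complex poly ^ 'k" where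
  "const_vec v = (\<chi> k. [:v $ k:])"

definition basefree :: "nat \<Rightarrow> complex poly ^ 'k \<Rightarrow> bool" where
  "basefree n \<psi> \<longleftrightarrow> (\<forall>x. at_point \<psi> x \<noteq> 0) \<and> coeff_vec \<psi> n \<noteq> 0"

lemma at_point_simps [simp]:
  "at_point (\<phi> + \<psi>) x = at_point \<phi> x + at_point \<psi> x"
  "at_point (\<phi> - \<psi>) x = at_point \<phi> x - at_point \<psi> x"
  "at_point (p *s \<phi>) x = poly p x *s at_point \<phi> x"
  "at_point (const_vec v) x = v"
  "at_point 0 x = 0"
  by (simp_all add: at_point_def const_vec_def vec_eq_iff)

lemma coeff_vec_simps [simp]:
  "coeff_vec (\<phi> + \<psi>) n = coeff_vec \<phi> n + coeff_vec \<psi> n"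
  "coeff_vec (\<phi> - \<psi>) n = coeff_vec \<phi> n - coeff_vec \<psi> n"
  "coeff_vec ([:c:] *s \<phi>) n = c *s coeff_vec \<phi> n"
  "coeff_vec 0 n = 0"
  by (simp_all add: coeff_vec_def vec_eq_iff)

lemma at_point_wdg [simp]: "at_point (wdg \<beta> \<gamma>) x = wdg (at_point \<beta> x) (at_point \<gamma> x)"
  by (simp add: at_point_def ext_simps)
lemma at_point_star [simp]: "at_point (star \<phi>) x = star (at_point \<phi> x)"
  by (simp add: at_point_def ext_simps)
lemma coeff_vec_star [simp]: "coeff_vec (star \<phi>) x = star (coeff_vec \<phi> x)"
  by (simp add: coeff_vec_def ext_simps)
lemma at_point_contract [simp]: "at_point (contract \<phi> \<gamma>) x = contract (at_point \<phi> x) (at_point \<gamma> x)"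
  by (simp add: at_point_def ext_simps)
lemma poly_quad [simp]: "poly (quad \<phi>) x = quad (at_point \<phi> x)"
  by (simp add: at_point_def ext_simps)
lemma poly_polar [simp]: "poly (polar \<phi> \<psi>) x = polar (at_point \<phi> x) (at_point \<psi> x)"
  by (simp add: at_point_def ext_simps)

lemma poly_eqI_points: "(\<And>x. poly p x = poly p2 x) \<Longrightarrow> p = (p2 :: complex poly)"
  by (simp add: poly_eq_poly_eq_iff[symmetric] fun_eq_iff)

lemma vec_poly_eqI: "(\<And>x. at_point \<phi> x = at_point \<psi> x) \<Longrightarrow> \<phi> = \<psi>"
  by (simp add: at_point_def vec_eq_iff poly_eqI_points)

lemma homs_iff: "\<psi> \<in> homs n \<longleftrightarrow> (\<forall>k. degree (\<psi> $ k) \<le> n)"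
  by (simp add: homs_def forms_def)

lemma ex_homs: "\<exists>n. \<psi> \<in> homs n"
  unfolding homs_iff by (rule exI[of _ "\<Sum>k\<in>UNIV. degree (\<psi> $ k)"]) (auto intro: member_le_sum)

lemma homs_mono: "\<psi> \<in> homs m \<Longrightarrow> m \<le> n \<Longrightarrow> \<psi> \<in> homs n"
  by (meson homs_iff le_trans)

lemma homs_add: "\<psi> \<in> homs m \<Longrightarrow> \<phi> \<in> homs m \<Longrightarrow> \<psi> + \<phi> \<in> homs m"
  by (simp add: homs_iff degree_add_le)
lemma homs_diff: "\<psi> \<in> homs m \<Longrightarrow> \<phi> \<in> homs m \<Longrightarrow> \<psi> - \<phi> \<in> homs m"
  by (simp add: homs_iff degree_diff_le)
lemma homs_mult: "\<psi> \<in> homs m \<Longrightarrow> degree p \<le> n \<Longrightarrow> p *s \<psi> \<in> homs (n + m)"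
  by (simp add: homs_iff) (meson add_mono degree_mult_le le_trans)
lemma homs_scale: "\<psi> \<in> homs m \<Longrightarrow> [:c:] *s \<psi> \<in> homs m"
  using homs_mult[of \<psi> m "[:c:]" 0] by simp
lemma homs_0 [simp]: "0 \<in> homs m" by (simp add: homs_iff)
lemma homs_const [simp]: "const_vec v \<in> homs m" by (simp add: homs_iff const_vec_def)
lemma degree_mult_leI: "degree p \<le> m \<Longrightarrow> degree p2 \<le> n \<Longrightarrow> degree (p * p2 :: complex poly) \<le> m + n"
  by (meson add_mono degree_mult_le le_trans)
lemma homs_wdg: "\<beta> \<in> homs m \<Longrightarrow> \<gamma> \<in> homs n \<Longrightarrow> wdg \<beta> \<gamma> \<in> homs (m + n)"
  by (auto simp: homs_iff forall_6 forall_4 wdg_def intro!: degree_diff_le degree_mult_leI)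
lemma homs_star: "\<phi> \<in> homs m \<Longrightarrow> star \<phi> \<in> homs m"
  by (auto simp: homs_iff forall_6 star_def)
lemma homs_contract: "\<phi> \<in> homs m \<Longrightarrow> \<gamma> \<in> homs n \<Longrightarrow> contract \<phi> \<gamma> \<in> homs (n + m)"
  by (auto simp: homs_iff forall_6 forall_4 contract_def intro!: degree_diff_le degree_add_le degree_mult_leI)

lemma coeff_mult_top:
  assumes "degree p \<le> m" "degree p2 \<le> n"
  shows "coeff (p * p2 :: complex poly) (m + n) = coeff p m * coeff p2 n"
proof (cases "degree p = m \<and> degree p2 = n")
  case True
  then show ?thesis using coeff_mult_degree_sum[of p p2] by simp
next
  case False
  then have "degree p < m \<or> degree p2 < n" using assms by auto
  moreover have "degree (p * p2) < m + n"
    using False assms degree_mult_le[of p p2] by linarith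
  ultimately show ?thesis by (auto simp: coeff_eq_0)
qed

lemma coeff_vec_wdg: "\<beta> \<in> homs m \<Longrightarrow> \<gamma> \<in> homs n \<Longrightarrow> coeff_vec (wdg \<beta> \<gamma>) (m + n) = wdg (coeff_vec \<beta> m) (coeff_vec \<gamma> n)"
  by (simp add: homs_iff coeff_vec_def wdg_def vec_eq_iff forall_6 coeff_mult_top)

lemma coeff_vec_mult: "degree p \<le> m \<Longrightarrow> \<psi> \<in> homs n \<Longrightarrow> coeff_vec (p *s \<psi>) (m + n) = coeff p m *s coeff_vec \<psi> n"
  by (simp add: homs_iff coeff_vec_def vec_eq_iff coeff_mult_top)

lemma basefree_nonzero: "basefree n \<psi> \<Longrightarrow> \<psi> \<noteq> 0"
  by (auto simp: basefree_def)

text \<open>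
  A zero at a finite point is divided out by a linear form; a zero at infinity, in \<open>drop_top\<close>
  below, is divided out by lowering the bound on the degrees.
\<close>

lemma divide_root:
  fixes \<psi> :: "complex poly ^ 'k"
  assumes "\<psi> \<noteq> 0" "\<psi> \<in> homs n" "at_point \<psi> x = 0"
  shows "\<exists>\<psi>'. \<psi> = [:-x, 1:] *s \<psi>' \<and> \<psi>' \<in> homs (n - 1) \<and> \<psi>' \<noteq> 0 \<and> 1 \<le> n"
proof -
  have "\<exists>r. \<psi> $ k = [:-x, 1:] * r" for k
    using assms(3) by (simp add: at_point_def vec_eq_iff poly_eq_0_iff_dvd dvd_def)
  then obtain r where r: "\<And>k. \<psi> $ k = [:-x, 1:] * r k" by metis
  have deg: "degree (r k) + 1 \<le> n" if "r k \<noteq> 0" for k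
  proof -
    have "degree (\<psi> $ k) = degree (r k) + 1" using that unfolding r[of k] by (subst degree_mult_eq) auto
    then show ?thesis using assms(2) by (metis homs_iff)
  qed
  have "\<psi> = [:-x, 1:] *s (\<chi> k. r k)" using r by (simp add: vec_eq_iff)
  moreover from this have "(\<chi> k. r k) \<noteq> 0" using assms(1) by auto
  moreover from this obtain k where "r k \<noteq> 0" by (auto simp: vec_eq_iff)
  then have "1 \<le> n" using deg by fastforce
  moreover have "(\<chi> k. r k) \<in> homs (n - 1)"
    unfolding homs_iff by (metis (no_types, lifting) add_le_imp_le_diff deg degree_0 le0 vec_lambda_beta)
  ultimately show ?thesis by blast
qed

lemma drop_top:
  fixes \<psi> :: "complex poly ^ 'k"
  assumes "\<psi> \<noteq> 0" "\<psi> \<in> homs n" "coeff_vec \<psi> n = 0"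
  shows "\<psi> \<in> homs (n - 1)" "1 \<le> n"
proof -
  have c: "coeff (\<psi> $ k) n = 0" for k using assms(3) by (simp add: coeff_vec_def vec_eq_iff)
  show "1 \<le> n"
  proof (rule ccontr)
    assume "\<not> 1 \<le> n"
    then have "n = 0" by simp
    then have "\<psi> $ k = 0" for k
      using assms(2) c[of k] by (metis homs_iff le_zero_eq leading_coeff_0_iff)
    then show False using assms(1) by (simp add: vec_eq_iff)
  qed
  show "\<psi> \<in> homs (n - 1)"
    unfolding homs_iff
  proof
    fix k
    have "degree (\<psi> $ k) \<le> n" using assms(2) by (simp add: homs_iff)
    moreover have "degree (\<psi> $ k) \<noteq> n" if "n \<noteq> 0"
      using c[of k] that by (metis degree_0 leading_coeff_0_iff)
    ultimately show "degree (\<psi> $ k) \<le> n - 1" by fastforce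
  qed
qed

text \<open>
  The ideal generated by the entries contains an element of least degree that divides all of
  them; without a common zero it is a constant.
\<close>

lemma bezout:
  fixes \<psi> :: "complex poly ^ 'k"
  assumes "\<And>x. at_point \<psi> x \<noteq> 0"
  shows "\<exists>u. dot u \<psi> = 1"
proof -
  define S where "S = {p. p \<noteq> 0 \<and> (\<exists>u. p = dot u \<psi>)}"
  obtain k where k: "\<psi> $ k \<noteq> 0" using assms[of 0] by (metis at_point_simps(5) vec_eq_iff zero_index)
  then have "\<psi> $ k \<in> S" unfolding S_def by (simp add: dot_commute) (metis dot_axis dot_commute)
  then obtain p where p: "p \<in> S" and min: "\<And>r. r \<in> S \<Longrightarrow> degree p \<le> degree r"
    using ex_has_least_nat[of "\<lambda>p. p \<in> S" _ degree] by blast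
  then obtain u where u: "p = dot u \<psi>" and "p \<noteq> 0" by (auto simp: S_def)
  have dvd: "p dvd \<psi> $ k" for k
  proof (rule ccontr)
    assume nd: "\<not> p dvd \<psi> $ k"
    define r where "r = \<psi> $ k mod p"
    have "r \<noteq> 0" using nd by (simp add: r_def mod_eq_0_iff_dvd)
    moreover have "r = dot (axis k 1 - (\<psi> $ k div p) *s u) \<psi>"
    proof -
      have "dot (axis k 1 - (\<psi> $ k div p) *s u) \<psi> = dot \<psi> (axis k 1) - (\<psi> $ k div p) * dot u \<psi>"
        by (simp add: dot_def sum_subtractf[symmetric] sum_distrib_left algebra_simps)
      also have "\<dots> = r" unfolding dot_axis r_def u[symmetric]
        by (simp add: minus_div_mult_eq_mod[symmetric])
      finally show ?thesis by simp
    qed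
    ultimately have "r \<in> S" by (auto simp: S_def)
    then have "degree p \<le> degree r" by (rule min)
    moreover have "degree r < degree p"
      using \<open>r \<noteq> 0\<close> \<open>p \<noteq> 0\<close> unfolding r_def by (metis degree_mod_less)
    ultimately show False by simp
  qed
  have "degree p = 0"
  proof (rule ccontr)
    assume "degree p \<noteq> 0"
    then obtain x where "poly p x = 0"
      by (metis fundamental_theorem_of_algebra constant_degree)
    then have "at_point \<psi> x = 0"
      using dvd by (simp add: at_point_def vec_eq_iff) (metis dvd_trans poly_eq_0_iff_dvd)
    then show False using assms by blast
  qed
  then obtain c where c: "p = [:c:]" by (metis degree_eq_zeroE)
  then have "c \<noteq> 0" using \<open>p \<noteq> 0\<close> by auto
  have "dot ([:1/c:] *s u) \<psi> = [:1/c:] * dot u \<psi>"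
    by (simp add: dot_def sum_distrib_left algebra_simps del: mult_pCons_left)
  also have "\<dots> = 1" unfolding u[symmetric] using c \<open>c \<noteq> 0\<close> by (simp add: one_pCons)
  finally show ?thesis by blast
qed

definition parallel :: "'a::comm_ring_1 ^ 'k \<Rightarrow> 'a ^ 'k \<Rightarrow> bool" where
  "parallel \<psi> \<phi> \<longleftrightarrow> (\<forall>k l. \<psi> $ k * \<phi> $ l = \<psi> $ l * \<phi> $ k)"

text \<open>
  A tuple without base points generates, over the polynomials, all tuples proportional to it: the
  multiplier is read off from a Bezout relation. The degree bound is the statement at infinity.
\<close>

lemma parallel_basefree:
  fixes \<psi> \<phi> :: "complex poly ^ 'k"
  assumes "basefree m \<psi>" "\<psi> \<in> homs m" "parallel \<phi> \<psi>" "\<phi> \<in> homs n" "\<phi> \<noteq> 0"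
  shows "\<exists>c. c \<noteq> 0 \<and> \<phi> = c *s \<psi> \<and> degree c + m \<le> n"
proof -
  obtain u where u: "dot u \<psi> = 1" using bezout assms(1) unfolding basefree_def by blast
  define c where "c = dot u \<phi>"
  have eq: "\<phi> = c *s \<psi>"
  proof -
    have "c * \<psi> $ l = \<phi> $ l" for l
    proof -
      have "c * \<psi> $ l = (\<Sum>k\<in>UNIV. u $ k * (\<phi> $ k * \<psi> $ l))"
        by (simp add: c_def dot_def sum_distrib_right mult.assoc)
      also have "\<dots> = (\<Sum>k\<in>UNIV. u $ k * \<psi> $ k) * \<phi> $ l"
        using assms(3) unfolding parallel_def sum_distrib_right
        by (intro sum.cong) (auto simp: ac_simps)
      finally show ?thesis using u by (simp add: dot_def)
    qed
    then show ?thesis by (simp add: vec_eq_iff)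
  qed
  have c0: "c \<noteq> 0" using eq assms(5) by auto
  obtain k where k: "coeff (\<psi> $ k) m \<noteq> 0"
    using assms(1) by (auto simp: basefree_def coeff_vec_def vec_eq_iff)
  then have dk: "degree (\<psi> $ k) = m" using assms(2) by (metis homs_iff le_antisym le_degree)
  have "\<psi> $ k \<noteq> 0" using k by auto
  then have "degree c + m = degree (\<phi> $ k)" using eq c0 dk by (simp add: degree_mult_eq)
  then have "degree c + m \<le> n" using assms(4) by (simp add: homs_iff)
  then show ?thesis using eq c0 by blast
qed

lemma factor_basefree:
  fixes \<phi> :: "complex poly ^ 'k"
  assumes "\<phi> \<noteq> 0" "\<phi> \<in> homs d"
  shows "\<exists>e \<xi> \<psi>. e \<le> d \<and> \<xi> \<noteq> 0 \<and> degree \<xi> \<le> d - e \<and> \<psi> \<in> homs e \<and> basefree e \<psi> \<and> \<phi> = \<xi> *s \<psi>"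
proof -
  define P where "P e \<longleftrightarrow> (\<exists>\<xi> \<psi>. e \<le> d \<and> \<xi> \<noteq> 0 \<and> degree \<xi> \<le> d - e \<and> \<psi> \<in> homs e \<and> \<phi> = \<xi> *s \<psi>)" for e
  have "P d" unfolding P_def using assms by (intro exI[of _ 1] exI[of _ \<phi>]) auto
  define e where "e = (LEAST e. P e)"
  have "P e" unfolding e_def using \<open>P d\<close> by (rule LeastI)
  have least: "\<not> P e'" if "e' < e" for e' using that unfolding e_def by (rule not_less_Least)
  from \<open>P e\<close> obtain \<xi> \<psi> where *: "e \<le> d" "\<xi> \<noteq> 0" "degree \<xi> \<le> d - e" "\<psi> \<in> homs e" "\<phi> = \<xi> *s \<psi>"
    unfolding P_def by blast
  have "\<psi> \<noteq> 0" using assms(1) * by auto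
  have "at_point \<psi> x \<noteq> 0" for x
  proof
    assume "at_point \<psi> x = 0"
    then obtain \<psi>' where d: "\<psi> = [:-x, 1:] *s \<psi>'" "\<psi>' \<in> homs (e - 1)" "1 \<le> e"
      using divide_root[OF \<open>\<psi> \<noteq> 0\<close> *(4)] by blast
    have "degree (\<xi> * [:-x,1:]) \<le> d - e + 1"
      using *(3) by (intro degree_mult_leI) auto
    then have "P (e - 1)" unfolding P_def using * d
      by (intro exI[of _ "\<xi> * [:-x,1:]"] exI[of _ \<psi>']) (auto simp del: mult_pCons_right simp: vec_eq_iff mult.assoc)
    then show False using least[of "e - 1"] d by auto
  qed
  moreover have "coeff_vec \<psi> e \<noteq> 0"
  proof
    assume "coeff_vec \<psi> e = 0"
    then have d: "\<psi> \<in> homs (e - 1)" "1 \<le> e"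
      using drop_top[OF \<open>\<psi> \<noteq> 0\<close> *(4)] by auto
    then have "P (e - 1)" unfolding P_def using *
      by (intro exI[of _ "\<xi>"] exI[of _ \<psi>]) auto
    then show False using least[of "e - 1"] d by auto
  qed
  ultimately have "basefree e \<psi>" by (simp add: basefree_def)
  then show ?thesis using * by blast
qed

section \<open>Decomposable bivectors of polynomials\<close>

lemma wdg_diff: "wdg l (m - c *s n) = wdg l m - c *s wdg l n"
  by (simp add: ext_simps algebra_simps)

lemma scalar_mult_eq_0_iff:
  fixes \<psi> :: "complex poly ^ 'k"
  shows "p *s \<psi> = 0 \<longleftrightarrow> p = 0 \<or> \<psi> = 0"
  by (auto simp: vec_eq_iff)

lemma ex_contract_nonzero:
  fixes \<phi> :: "'a::comm_ring_1 ^ 6"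
  assumes "\<phi> \<noteq> 0"
  shows "\<exists>v. contract \<phi> v \<noteq> 0"
proof -
      obtain k where k: "\<phi> $ k \<noteq> 0" using assms(1) by (auto simp: vec_eq_iff)
      have "\<exists>v w. dot \<phi> (wdg v w) = \<phi> $ 1" "\<exists>v w. dot \<phi> (wdg v w) = \<phi> $ 2"
           "\<exists>v w. dot \<phi> (wdg v w) = \<phi> $ 3" "\<exists>v w. dot \<phi> (wdg v w) = \<phi> $ 4"
           "\<exists>v w. dot \<phi> (wdg v w) = \<phi> $ 5" "\<exists>v w. dot \<phi> (wdg v w) = \<phi> $ 6"
        by (rule exI[of _ "vector [1,0,0,0]"] exI[of _ "vector [0,1,0,0]"],
            rule exI[of _ "vector [0,1,0,0]"], simp add: ext_simps)
           (rule exI[of _ "vector [1,0,0,0]"], rule exI[of _ "vector [0,0,1,0]"], simp add: ext_simps,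
            rule exI[of _ "vector [1,0,0,0]"], rule exI[of _ "vector [0,0,0,1]"], simp add: ext_simps,
            rule exI[of _ "vector [0,1,0,0]"], rule exI[of _ "vector [0,0,1,0]"], simp add: ext_simps,
            rule exI[of _ "vector [0,1,0,0]"], rule exI[of _ "vector [0,0,0,1]"], simp add: ext_simps,
            rule exI[of _ "vector [0,0,1,0]"], rule exI[of _ "vector [0,0,0,1]"], simp add: ext_simps)
      then obtain v w where "dot \<phi> (wdg v w) \<noteq> 0" using k exhaust_6[of k] by metis
      then have "contract \<phi> v \<noteq> 0" by (metis dot_contract dot_0(2))
      then show ?thesis by blast
qed

text \<open>
  For a morphism \<open>f\<close> this is the splitting \<open>f\<^sup>*Q \<simeq> O(b) \<oplus> O(a)\<close> in explicit form, but base points are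
  allowed. The vectors \<open>\<beta>\<close> with \<open>\<beta> \<and> \<phi> = 0\<close> make up a saturated module of rank two over the
  polynomials. A nonzero element \<open>\<beta>\<close> of least degree has no base points, and a Bezout
  relation for it turns the Koszul identity into \<open>\<phi> = \<beta> \<and> \<gamma>\<close>. For \<open>\<gamma>\<close> of least
  degree the leading coefficients of \<open>\<beta>\<close> and \<open>\<gamma>\<close> are independent, because otherwise a multiple
  of \<open>\<beta>\<close> could be subtracted from \<open>\<gamma>\<close>; hence the two degrees add up to that of \<open>\<phi>\<close>.
\<close>

lemma quad_zero_decompose:
  fixes \<phi> :: "complex poly ^ 6"
  assumes "\<phi> \<noteq> 0" "\<phi> \<in> homs d" "quad \<phi> = 0"
  shows "\<exists>a b \<beta> \<gamma>. a + b = d \<and> b \<le> a \<and> \<beta> \<in> homs b \<and> basefree b \<beta> \<and> \<gamma> \<in> homs a \<and> \<phi> = wdg \<beta> \<gamma>"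
proof -
  define P where "P b \<longleftrightarrow> (\<exists>\<beta>. \<beta> \<noteq> 0 \<and> \<beta> \<in> homs b \<and> contract (star \<phi>) \<beta> = 0)" for b
  have "\<exists>b. P b"
  proof -
    obtain v where v: "contract \<phi> v \<noteq> 0"
      using ex_contract_nonzero[OF assms(1)] by blast
    have "contract (star \<phi>) (contract \<phi> v) = 0"
      using contract_contract_star[of "star \<phi>" v] assms(3) by simp
    moreover obtain b where "contract \<phi> v \<in> homs b" using ex_homs by blast
    ultimately show ?thesis unfolding P_def using v by blast
  qed
  define b where "b = (LEAST b. P b)"
  have "P b" unfolding b_def using \<open>\<exists>b. P b\<close> by (rule LeastI_ex)
  have least: "\<not> P b'" if "b' < b" for b' using that unfolding b_def by (rule not_less_Least)
  from \<open>P b\<close> obtain \<beta> where \<beta>: "\<beta> \<noteq> 0" "\<beta> \<in> homs b" "contract (star \<phi>) \<beta> = 0" unfolding P_def by blast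
  have bf: "basefree b \<beta>"
    unfolding basefree_def
  proof (intro conjI allI notI)
    fix x assume "at_point \<beta> x = 0"
    then obtain \<beta>' where d: "\<beta> = [:-x, 1:] *s \<beta>'" "\<beta>' \<in> homs (b - 1)" "\<beta>' \<noteq> 0" "1 \<le> b"
      using divide_root[OF \<beta>(1,2)] by blast
    have "[:-x,1:] *s contract (star \<phi>) \<beta>' = 0" using \<beta>(3) d(1) by (simp add: contract_scale)
    then have "contract (star \<phi>) \<beta>' = 0" by (auto simp: scalar_mult_eq_0_iff)
    then have "P (b - 1)" unfolding P_def using d by blast
    then show False using least[of "b - 1"] d by auto
  next
    assume "coeff_vec \<beta> b = 0"
    then have "P (b - 1)" "1 \<le> b" unfolding P_def using drop_top[OF \<beta>(1,2)] \<beta> by auto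
    then show False using least[of "b - 1"] by auto
  qed
  define Q where "Q a \<longleftrightarrow> (\<exists>\<gamma>. \<gamma> \<in> homs a \<and> \<phi> = wdg \<beta> \<gamma>)" for a
  have "\<exists>a. Q a"
  proof -
    obtain v where v: "dot v \<beta> = 1" using bezout bf unfolding basefree_def by blast
    then have "\<phi> = wdg \<beta> (contract \<phi> v)"
      using koszul[of \<beta> v \<phi>] \<beta>(3) by (simp add: dot_commute)
    moreover obtain a where "contract \<phi> v \<in> homs a" using ex_homs by blast
    ultimately show ?thesis unfolding Q_def by blast
  qed
  define a where "a = (LEAST a. Q a)"
  have "Q a" unfolding a_def using \<open>\<exists>a. Q a\<close> by (rule LeastI_ex)
  have leastQ: "\<not> Q a'" if "a' < a" for a' using that unfolding a_def by (rule not_less_Least)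
  from \<open>Q a\<close> obtain \<gamma> where \<gamma>: "\<gamma> \<in> homs a" "\<phi> = wdg \<beta> \<gamma>" unfolding Q_def by blast
  have "\<gamma> \<noteq> 0" using \<gamma>(2) assms(1) by auto
  then have "P a" unfolding P_def using \<gamma> contract_star_wdg(2) by blast
  then have "b \<le> a" using least not_less by blast
  \<comment> \<open>Dependent leading coefficients would allow a division step that lowers the degree of \<open>\<gamma>\<close>.\<close>
  have "wdg (coeff_vec \<beta> b) (coeff_vec \<gamma> a) \<noteq> 0"
  proof
    assume "wdg (coeff_vec \<beta> b) (coeff_vec \<gamma> a) = 0"
    then obtain c where c: "coeff_vec \<gamma> a = c *s coeff_vec \<beta> b"
      using bf wdg_eq_0_iff unfolding basefree_def by blast
    define \<gamma>' where "\<gamma>' = \<gamma> - monom c (a - b) *s \<beta>"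
    have "coeff_vec (monom c (a - b) *s \<beta>) (a - b + b) = c *s coeff_vec \<beta> b"
      using coeff_vec_mult[of "monom c (a - b)" "a - b" \<beta> b] \<beta>(2) by (simp add: degree_monom_le)
    then have top: "coeff_vec \<gamma>' a = 0" using c \<open>b \<le> a\<close> by (simp add: \<gamma>'_def)
    have h: "\<gamma>' \<in> homs a" unfolding \<gamma>'_def
      using homs_mult[OF \<beta>(2), of "monom c (a - b)" "a - b"] \<open>b \<le> a\<close> \<gamma>(1)
      by (intro homs_diff) (simp_all add: degree_monom_le)
    have eq: "\<phi> = wdg \<beta> \<gamma>'" unfolding \<gamma>(2) \<gamma>'_def
      by (simp add: wdg_diff)
    then have "\<gamma>' \<noteq> 0" using assms(1) by auto
    then have "Q (a - 1)" "1 \<le> a" unfolding Q_def using drop_top[OF _ h top] eq by auto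
    then show False using leastQ[of "a - 1"] by auto
  qed
  then have "coeff_vec \<phi> (b + a) \<noteq> 0" unfolding \<gamma>(2) using coeff_vec_wdg[OF \<beta>(2) \<gamma>(1)] by simp
  then have "b + a \<le> d"
    using assms(2) by (auto simp: coeff_vec_def vec_eq_iff homs_iff intro: le_degree order_trans)
  then have "(d - b) + b = d" "b \<le> d - b" "\<gamma> \<in> homs (d - b)"
    using \<open>b \<le> a\<close> homs_mono[OF \<gamma>(1)] by auto
  then show ?thesis using \<beta> bf \<gamma> by blast
qed

section \<open>Homogeneous polynomials and Zariski closures\<close>

lemma homog_scale: "homog_poly n f \<Longrightarrow> f (\<lambda>i. c * v i) = c ^ n * f v"
  by (induction rule: homog_poly.induct) (simp_all add: algebra_simps power_add)

lemma homog_zero: "homog_poly n (\<lambda>_. 0)"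
proof (induction n)
  case 0
  show ?case by (rule homog_poly.const)
next
  case (Suc n)
  show ?case using homog_poly.mult[OF homog_poly.coord Suc] by simp
qed

lemma homog_cmult: "homog_poly n f \<Longrightarrow> homog_poly n (\<lambda>v. c * f v)"
  using homog_poly.mult[OF homog_poly.const] by fastforce

lemma homog_uminus: "homog_poly n f \<Longrightarrow> homog_poly n (\<lambda>v. - f v)"
  using homog_cmult[of n f "-1"] by simp

lemma homog_diff: "homog_poly n f \<Longrightarrow> homog_poly n g \<Longrightarrow> homog_poly n (\<lambda>v. f v - g v)"
  using homog_poly.add[OF _ homog_uminus] by fastforce

lemma homog_sum:
  "(\<And>a. a \<in> A \<Longrightarrow> homog_poly n (f a)) \<Longrightarrow> homog_poly n (\<lambda>v. \<Sum>a\<in>A. f a v)"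
  by (induction A rule: infinite_finite_induct) (auto intro: homog_zero homog_poly.add)

lemma homog_if: "homog_poly n f \<Longrightarrow> homog_poly n g \<Longrightarrow> homog_poly n (\<lambda>v. if b then f v else g v)"
  by (cases b) simp_all

lemma homog_mult': "homog_poly m f \<Longrightarrow> homog_poly n g \<Longrightarrow> k = m + n \<Longrightarrow> homog_poly k (\<lambda>v. f v * g v)"
  by (simp add: homog_poly.mult)

lemma homog_subst:
  "homog_poly n f \<Longrightarrow> (\<And>i. homog_poly m (\<lambda>v. L v i)) \<Longrightarrow> homog_poly (n * m) (\<lambda>v. f (L v))"
  by (induction rule: homog_poly.induct) (auto intro: homog_poly.intros simp: algebra_simps)

text \<open>
  This is used to count zeros: a homogeneous polynomial that does not vanish on a line has finitely
  many zeros there.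
\<close>

lemma homog_line: "homog_poly n f \<Longrightarrow> \<exists>P. \<forall>\<epsilon>. f (\<lambda>i. u i + \<epsilon> * w i) = poly P \<epsilon>"
proof (induction rule: homog_poly.induct)
  case (const c)
  show ?case by (rule exI[of _ "[:c:]"]) simp
next
  case (coord i)
  show ?case by (rule exI[of _ "[:u i, w i:]"]) simp
next
  case (add n f g)
  then show ?case by (metis poly_add)
next
  case (mult m f n g)
  then show ?case by (metis poly_mult)
qed

lemma mem_pt: "v \<in> pt u \<longleftrightarrow> (\<exists>c. c \<noteq> 0 \<and> v = (\<lambda>i. c * u i))"
  by (auto simp: pt_def)

lemma self_mem_pt: "v \<in> pt v"
  unfolding mem_pt by (rule exI[of _ 1]) simp

lemma pt_scale: "c \<noteq> 0 \<Longrightarrow> pt (\<lambda>i. c * v i) = pt v"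
proof -
  assume "c \<noteq> 0"
  have "x \<in> pt (\<lambda>i. c * v i) \<longleftrightarrow> x \<in> pt v" for x
    unfolding mem_pt
  proof
    assume "\<exists>b. b \<noteq> 0 \<and> x = (\<lambda>i. b * (c * v i))"
    then obtain b where "b \<noteq> 0" "x = (\<lambda>i. b * (c * v i))" by blast
    then show "\<exists>c. c \<noteq> 0 \<and> x = (\<lambda>i. c * v i)"
      using \<open>c \<noteq> 0\<close> by (intro exI[of _ "b * c"]) (simp add: mult.assoc)
  next
    assume "\<exists>c. c \<noteq> 0 \<and> x = (\<lambda>i. c * v i)"
    then obtain b where "b \<noteq> 0" "x = (\<lambda>i. b * v i)" by blast
    then show "\<exists>b. b \<noteq> 0 \<and> x = (\<lambda>i. b * (c * v i))"
      using \<open>c \<noteq> 0\<close> by (intro exI[of _ "b / c"]) simp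
  qed
  then show ?thesis by blast
qed

lemma pt_eq_iff: "pt v = pt w \<longleftrightarrow> (\<exists>c. c \<noteq> 0 \<and> w = (\<lambda>i. c * v i))"
proof
  assume "pt v = pt w"
  then have "w \<in> pt v" using self_mem_pt by blast
  then show "\<exists>c. c \<noteq> 0 \<and> w = (\<lambda>i. c * v i)" by (simp add: mem_pt)
qed (auto simp: pt_scale)

definition supported :: "'i set \<Rightarrow> ('i \<Rightarrow> complex) \<Rightarrow> bool" where
  "supported I v \<longleftrightarrow> (\<forall>i. i \<notin> I \<longrightarrow> v i = 0)"

lemma proj_space_eq: "proj_space I = {pt v | v. v \<noteq> (\<lambda>_. 0) \<and> supported I v}"
  by (simp add: proj_space_def supported_def)

lemma pt_mem_proj_space: "pt v \<in> proj_space I \<longleftrightarrow> v \<noteq> (\<lambda>_. 0) \<and> supported I v"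
proof
  assume "pt v \<in> proj_space I"
  then obtain w where w: "pt v = pt w" "w \<noteq> (\<lambda>_. 0)" "supported I w" by (auto simp: proj_space_eq)
  then obtain c where "c \<noteq> 0" "v = (\<lambda>i. c * w i)" by (metis pt_eq_iff)
  with w show "v \<noteq> (\<lambda>_. 0) \<and> supported I v" by (simp add: supported_def fun_eq_iff)
qed (auto simp: proj_space_eq)

lemma homog_vanish_pt: "homog_poly n f \<Longrightarrow> (\<forall>v\<in>pt u. f v = 0) \<longleftrightarrow> f u = 0"
proof
  assume "\<forall>v\<in>pt u. f v = 0" then show "f u = 0" using self_mem_pt by blast
next
  assume "homog_poly n f" "f u = 0"
  then show "\<forall>v\<in>pt u. f v = 0" by (auto simp: mem_pt homog_scale)
qed

lemma closure_minimal: "zariski_closed I Z \<Longrightarrow> A \<subseteq> Z \<Longrightarrow> zariski_closure I A \<subseteq> Z"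
  by (auto simp: zariski_closure_def)

lemma closure_subset_closure: "A \<subseteq> zariski_closure I B \<Longrightarrow> zariski_closure I A \<subseteq> zariski_closure I B"
  unfolding zariski_closure_def by blast

text \<open>
  All density arguments go through this lemma: a point is in the closure of \<open>A\<close> as soon as some
  line through it meets \<open>A\<close> infinitely often, because a polynomial that vanishes on \<open>A\<close> then
  vanishes on the line.
\<close>

lemma closure_line:
  assumes "pt u \<in> proj_space I" "infinite {\<epsilon>. pt (\<lambda>i. u i + \<epsilon> * w i) \<in> A}"
  shows "pt u \<in> zariski_closure I A"
  unfolding zariski_closure_def
proof clarify
  fix Z assume Z: "zariski_closed I Z" "A \<subseteq> Z"
  then obtain F where F: "\<forall>f\<in>F. \<exists>n. homog_poly n f"
    and ZF: "Z = {p \<in> proj_space I. \<forall>f\<in>F. \<forall>v\<in>p. f v = 0}"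
    unfolding zariski_closed_def by blast
  have "f u = 0" if "f \<in> F" for f
  proof -
    from F that obtain n where n: "homog_poly n f" by (elim ballE) auto
    from homog_line[OF n, of u w] obtain P where P: "f (\<lambda>i. u i + \<epsilon> * w i) = poly P \<epsilon>" for \<epsilon>
      by (elim exE) simp
    have "{\<epsilon>. pt (\<lambda>i. u i + \<epsilon> * w i) \<in> A} \<subseteq> {\<epsilon>. poly P \<epsilon> = 0}"
    proof clarify
      fix \<epsilon> assume "pt (\<lambda>i. u i + \<epsilon> * w i) \<in> A"
      then have "pt (\<lambda>i. u i + \<epsilon> * w i) \<in> Z" using Z(2) by (rule subsetD[rotated])
      then have "\<forall>v\<in>pt (\<lambda>i. u i + \<epsilon> * w i). f v = 0" using that unfolding ZF by simp
      then show "poly P \<epsilon> = 0" unfolding P[symmetric] using self_mem_pt by (rule bspec)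
    qed
    then have "infinite {\<epsilon>. poly P \<epsilon> = 0}" using assms(2) finite_subset by blast
    then have "P = 0" using poly_roots_finite by blast
    then show ?thesis using P[of 0] by simp
  qed
  then have "\<forall>f\<in>F. \<forall>v\<in>pt u. f v = 0" using F homog_vanish_pt by metis
  then show "pt u \<in> Z" unfolding ZF using assms(1) by simp
qed

section \<open>Zariski closed conditions on coordinate vectors\<close>

text \<open>
  A pointwise form of being Zariski closed: the vectors outside of \<open>P\<close> are separated from \<open>P\<close> by
  homogeneous polynomials. This is how polynomials are found below, one at a time, and it makes
  conjunctions, disjunctions and pullbacks immediate.
\<close>

definition closed_cond :: "'i set \<Rightarrow> (('i \<Rightarrow> complex) \<Rightarrow> bool) \<Rightarrow> bool" where
  "closed_cond I P \<longleftrightarrow> (\<forall>u. supported I u \<and> \<not> P u \<longrightarrow>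
     (\<exists>n f. homog_poly n f \<and> f u \<noteq> 0 \<and> (\<forall>w. supported I w \<and> P w \<longrightarrow> f w = 0)))"

lemma closed_cond_conj: "closed_cond I P \<Longrightarrow> closed_cond I Q \<Longrightarrow> closed_cond I (\<lambda>v. P v \<and> Q v)"
  unfolding closed_cond_def by metis

lemma closed_cond_all: "(\<And>a. closed_cond I (P a)) \<Longrightarrow> closed_cond I (\<lambda>v. \<forall>a. P a v)"
  unfolding closed_cond_def by metis

lemma closed_cond_disj:
  assumes "closed_cond I P" "closed_cond I Q"
  shows "closed_cond I (\<lambda>v. P v \<or> Q v)"
  unfolding closed_cond_def
proof (intro allI impI)
  fix u assume u: "supported I u \<and> \<not> (P u \<or> Q u)"
  obtain n f where f: "homog_poly n f" "f u \<noteq> 0" "\<And>w. supported I w \<Longrightarrow> P w \<Longrightarrow> f w = 0"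
    using assms(1) u unfolding closed_cond_def by metis
  obtain m g where g: "homog_poly m g" "g u \<noteq> 0" "\<And>w. supported I w \<Longrightarrow> Q w \<Longrightarrow> g w = 0"
    using assms(2) u unfolding closed_cond_def by metis
  show "\<exists>n f. homog_poly n f \<and> f u \<noteq> 0 \<and> (\<forall>w. supported I w \<and> (P w \<or> Q w) \<longrightarrow> f w = 0)"
    using homog_poly.mult[OF f(1) g(1)] f g by (intro exI[of _ "n + m"] exI[of _ "\<lambda>v. f v * g v"]) auto
qed

lemma closed_cond_homog: "homog_poly n f \<Longrightarrow> closed_cond I (\<lambda>v. f v = 0)"
  unfolding closed_cond_def by blast

lemma closed_cond_closed:
  assumes "closed_cond I P"
  shows "zariski_closed I {pt u | u. u \<noteq> (\<lambda>_. 0) \<and> supported I u \<and> P u}"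
proof -
  define F where "F = {f. \<exists>n. homog_poly n f \<and> (\<forall>w. supported I w \<and> P w \<longrightarrow> f w = 0)}"
  have "{pt u | u. u \<noteq> (\<lambda>_. 0) \<and> supported I u \<and> P u} = {p \<in> proj_space I. \<forall>f\<in>F. \<forall>v\<in>p. f v = 0}"
  proof (intro set_eqI iffI)
    fix p assume "p \<in> {pt u | u. u \<noteq> (\<lambda>_. 0) \<and> supported I u \<and> P u}"
    then obtain u where u: "p = pt u" "u \<noteq> (\<lambda>_. 0)" "supported I u" "P u" by blast
    then have "\<forall>f\<in>F. \<forall>v\<in>pt u. f v = 0" unfolding F_def using homog_vanish_pt by blast
    then show "p \<in> {p \<in> proj_space I. \<forall>f\<in>F. \<forall>v\<in>p. f v = 0}" using u by (simp add: pt_mem_proj_space)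
  next
    fix p assume p: "p \<in> {p \<in> proj_space I. \<forall>f\<in>F. \<forall>v\<in>p. f v = 0}"
    then obtain u where u: "p = pt u" "u \<noteq> (\<lambda>_. 0)" "supported I u" by (auto simp: proj_space_eq)
    have "P u"
    proof (rule ccontr)
      assume "\<not> P u"
      then obtain n f where "homog_poly n f" "f u \<noteq> 0" "\<forall>w. supported I w \<and> P w \<longrightarrow> f w = 0"
        using assms u unfolding closed_cond_def by blast
      then show False using p u self_mem_pt unfolding F_def by blast
    qed
    then show "p \<in> {pt u | u. u \<noteq> (\<lambda>_. 0) \<and> supported I u \<and> P u}" using u by blast
  qed
  moreover have "\<forall>f\<in>F. \<exists>n. homog_poly n f" unfolding F_def by simp
  ultimately show ?thesis unfolding zariski_closed_def by (intro exI[of _ F] conjI)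
qed

lemma quasi_projectiveI:
  assumes "finite I" "closed_cond I P" "closed_cond I Q"
    and inv: "\<And>c u. c \<noteq> 0 \<Longrightarrow> Q (\<lambda>i. c * u i) \<Longrightarrow> Q u"
    and X: "X = {pt u | u. u \<noteq> (\<lambda>_. 0) \<and> supported I u \<and> P u \<and> \<not> Q u}"
  shows "quasi_projective X"
proof -
  have "X = {pt u | u. u \<noteq> (\<lambda>_. 0) \<and> supported I u \<and> P u} - {pt u | u. u \<noteq> (\<lambda>_. 0) \<and> supported I u \<and> Q u}"
  proof (intro set_eqI iffI)
    fix p assume "p \<in> X"
    then obtain u where u: "p = pt u" "u \<noteq> (\<lambda>_. 0)" "supported I u" "P u" "\<not> Q u" unfolding X by blast
    have "\<not> Q w" if "p = pt w" for w
    proof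
      assume "Q w"
      have "pt u = pt w" using that u(1) by simp
      then obtain c where "c \<noteq> 0" "w = (\<lambda>i. c * u i)" unfolding pt_eq_iff by (elim exE conjE)
      with \<open>Q w\<close> inv u(5) show False by simp
    qed
    then show "p \<in> {pt u | u. u \<noteq> (\<lambda>_. 0) \<and> supported I u \<and> P u} - {pt u | u. u \<noteq> (\<lambda>_. 0) \<and> supported I u \<and> Q u}"
      using u by blast
  next
    fix p assume "p \<in> {pt u | u. u \<noteq> (\<lambda>_. 0) \<and> supported I u \<and> P u} - {pt u | u. u \<noteq> (\<lambda>_. 0) \<and> supported I u \<and> Q u}"
    then show "p \<in> X" unfolding X by blast
  qed
  then show ?thesis
    unfolding quasi_projective_def
    using assms(1) closed_cond_closed[OF assms(2)] closed_cond_closed[OF assms(3)]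
    by (intro exI[of _ I] exI[of _ "{pt u | u. u \<noteq> (\<lambda>_. 0) \<and> supported I u \<and> P u}"]
        exI[of _ "{pt u | u. u \<noteq> (\<lambda>_. 0) \<and> supported I u \<and> Q u}"] conjI)
qed

text \<open>
  A polynomial that separates one point of the line from \<open>P\<close> has finitely many zeros on the line.
\<close>

lemma closed_cond_line:
  assumes "closed_cond I P" "supported I u" "supported I w" "\<not> P (\<lambda>i. u i + \<epsilon>0 * w i)"
  shows "finite {\<epsilon>. P (\<lambda>i. u i + \<epsilon> * w i)}"
proof -
  have s: "supported I (\<lambda>i. u i + \<epsilon> * w i)" for \<epsilon> using assms(2,3) by (simp add: supported_def)
  then obtain n f where f: "homog_poly n f" "f (\<lambda>i. u i + \<epsilon>0 * w i) \<noteq> 0"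
      "\<And>w. supported I w \<Longrightarrow> P w \<Longrightarrow> f w = 0"
    using assms(1,4) unfolding closed_cond_def by blast
  from homog_line[OF f(1), of u w] obtain p where p: "f (\<lambda>i. u i + \<epsilon> * w i) = poly p \<epsilon>" for \<epsilon>
    by (elim exE) simp
  have "p \<noteq> 0" using f(2) p by auto
  moreover have "{\<epsilon>. P (\<lambda>i. u i + \<epsilon> * w i)} \<subseteq> {\<epsilon>. poly p \<epsilon> = 0}"
    unfolding p[symmetric] by (auto intro!: f(3)[OF s])
  ultimately show ?thesis using poly_roots_finite finite_subset by blast
qed

section \<open>Linear systems with homogeneous coefficients\<close>

text \<open>
  Linear systems in unknowns \<open>x u\<close> for \<open>u \<in> I\<close>, with equations indexed by \<open>r\<close>, whose coefficients
  are functions of a parameter \<open>v\<close>.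
\<close>

definition solves :: "'u set \<Rightarrow> ('r \<Rightarrow> 'u \<Rightarrow> 'v \<Rightarrow> complex) \<Rightarrow> 'v \<Rightarrow> ('u \<Rightarrow> complex) \<Rightarrow> bool" where
  "solves I A v x \<longleftrightarrow> (\<forall>r. (\<Sum>u\<in>I. A r u v * x u) = 0)"

text \<open>
  One step of Gaussian elimination, cross-multiplied so that the new coefficients are again
  homogeneous polynomials in the parameter.
\<close>

definition pivot :: "('r \<Rightarrow> 'u \<Rightarrow> 'v \<Rightarrow> complex) \<Rightarrow> 'r \<Rightarrow> 'u \<Rightarrow> 'r \<Rightarrow> 'u \<Rightarrow> 'v \<Rightarrow> complex" where
  "pivot A r0 u0 r u v = A r0 u0 v * A r u v - A r u0 v * A r0 u v"

lemma homog_pivot: "(\<And>r u. homog_poly n (A r u)) \<Longrightarrow> homog_poly (n + n) (pivot A r0 u0 r u)"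
  unfolding pivot_def[abs_def] by (intro homog_diff homog_poly.mult)

lemma sum_pivot:
  "(\<Sum>u\<in>J. pivot A r0 u0 r u v * x u) =
     A r0 u0 v * (\<Sum>u\<in>J. A r u v * x u) - A r u0 v * (\<Sum>u\<in>J. A r0 u v * x u)"
  by (simp add: pivot_def sum_distrib_left sum_subtractf[symmetric] algebra_simps)

lemma pivot_solves:
  assumes "finite I" "u0 \<in> I" "solves I A v x"
  shows "solves (I - {u0}) (pivot A r0 u0) v x"
proof -
  have "A r u0 v * x u0 + (\<Sum>u\<in>I - {u0}. A r u v * x u) = 0" for r
    using assms by (simp add: solves_def sum.remove)
  then have e: "(\<Sum>u\<in>I - {u0}. A r u v * x u) = - A r u0 v * x u0" for r
    by (metis add_eq_0_iff mult_minus_left)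
  show ?thesis by (simp add: solves_def sum_pivot e)
qed

lemma pivot_nonzero:
  assumes "finite I" "u0 \<in> I" "solves I A v x" "A r0 u0 v \<noteq> 0" "u \<in> I" "x u \<noteq> 0"
  shows "\<exists>u\<in>I - {u0}. x u \<noteq> 0"
proof (rule ccontr)
  assume zero: "\<not> ?thesis"
  then have "(\<Sum>u\<in>I - {u0}. A r0 u v * x u) = 0" by (intro sum.neutral) auto
  moreover have "A r0 u0 v * x u0 + (\<Sum>u\<in>I - {u0}. A r0 u v * x u) = 0"
    using assms by (simp add: solves_def sum.remove)
  ultimately have "x u0 = 0" using assms(4) by simp
  then show False using assms zero by (cases "u = u0") auto
qed

text \<open>
  Back substitution, multiplied by the square of the pivot to avoid division.
\<close>

lemma pivot_extend:
  assumes "finite I" "u0 \<in> I" "solves (I - {u0}) (pivot A r0 u0) v y"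
  shows "solves I A v (\<lambda>u. if u = u0 then - A r0 u0 v * (\<Sum>w\<in>I - {u0}. A r0 w v * y w)
                           else A r0 u0 v * A r0 u0 v * y u)"
  unfolding solves_def
proof
  fix r
  let ?a = "A r0 u0 v" and ?S = "\<lambda>r. \<Sum>u\<in>I - {u0}. A r u v * y u"
  have "(\<Sum>u\<in>I. A r u v * (if u = u0 then - ?a * ?S r0 else ?a * ?a * y u)) =
      A r u0 v * (- ?a * ?S r0) + (\<Sum>u\<in>I - {u0}. A r u v * (?a * ?a * y u))"
    using assms(1,2) by (subst sum.remove[of _ u0]) (auto intro!: sum.cong)
  also have "(\<Sum>u\<in>I - {u0}. A r u v * (?a * ?a * y u)) = ?a * ?a * ?S r"
    by (simp add: sum_distrib_left algebra_simps)
  also have "A r u0 v * (- ?a * ?S r0) + ?a * ?a * ?S r = ?a * (?a * ?S r - A r u0 v * ?S r0)"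
    by (simp add: algebra_simps)
  also have "\<dots> = 0" using assms(3) unfolding solves_def sum_pivot by simp
  finally show "(\<Sum>u\<in>I. A r u v * (if u = u0 then - ?a * ?S r0 else ?a * ?a * y u)) = 0" .
qed

text \<open>
  When the system is solved at \<open>v0\<close> by elimination, the product of the pivots is a homogeneous
  polynomial in the parameter. Where it does not vanish, the same elimination shows that there is no
  nonzero solution. Hence having a nonzero solution is a closed condition.
\<close>

lemma elimination_closed:
  assumes "finite I" "\<And>r u. homog_poly n (A r u)"
    and "\<And>x. solves I A v0 x \<Longrightarrow> \<forall>u\<in>I. x u = 0"
  shows "\<exists>m f. homog_poly m f \<and> f v0 \<noteq> 0 \<and> (\<forall>v x. solves I A v x \<and> (\<exists>u\<in>I. x u \<noteq> 0) \<longrightarrow> f v = 0)"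
  using assms
proof (induction "card I" arbitrary: I n A)
  case 0
  then show ?case
    by (intro exI[of _ 0] exI[of _ "\<lambda>_. 1"]) (auto intro: homog_poly.const)
next
  case (Suc k)
  have "\<exists>r0. \<exists>u0\<in>I. A r0 u0 v0 \<noteq> 0"
  proof (rule ccontr)
    assume "\<not> ?thesis"
    then have "solves I A v0 (\<lambda>_. 1)" by (simp add: solves_def)
    then have "\<forall>u\<in>I. (1::complex) = 0" by (rule Suc.prems(3))
    then show False using Suc.hyps(2) by (metis card.empty ex_in_conv nat.distinct(1) zero_neq_one)
  qed
  then obtain r0 u0 where r0: "u0 \<in> I" "A r0 u0 v0 \<noteq> 0" by blast
  let ?I = "I - {u0}" and ?A = "pivot A r0 u0"
  have k: "k = card ?I" using Suc.hyps(2) r0 Suc.prems(1) by simp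
  have ker: "\<forall>u\<in>?I. y u = 0" if "solves ?I ?A v0 y" for y
  proof
    fix u assume u: "u \<in> ?I"
    then have "A r0 u0 v0 * A r0 u0 v0 * y u = 0"
      using bspec[OF Suc.prems(3)[OF pivot_extend[OF Suc.prems(1) r0(1) that]], of u] by simp
    then show "y u = 0" using r0(2) by simp
  qed
  have fin: "finite ?I" using Suc.prems(1) by simp
  have hom: "homog_poly (n + n) (?A r u)" for r u by (rule homog_pivot, rule Suc.prems(2))
  have "\<exists>m f. homog_poly m f \<and> f v0 \<noteq> 0 \<and>
      (\<forall>v x. solves ?I ?A v x \<and> (\<exists>u\<in>?I. x u \<noteq> 0) \<longrightarrow> f v = 0)"
    by (rule Suc.hyps(1)[of ?I "n + n" ?A, OF k fin hom]) (rule ker)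
  then obtain m f where f: "homog_poly m f" "f v0 \<noteq> 0"
      "\<forall>v x. solves ?I ?A v x \<and> (\<exists>u\<in>?I. x u \<noteq> 0) \<longrightarrow> f v = 0"
    by (elim exE conjE)
  show ?case
  proof (intro exI[of _ "n + m"] exI[of _ "\<lambda>v. A r0 u0 v * f v"] conjI allI impI)
    show "homog_poly (n + m) (\<lambda>v. A r0 u0 v * f v)" using Suc.prems(2) f(1) by (rule homog_poly.mult)
    show "A r0 u0 v0 * f v0 \<noteq> 0" using r0 f by simp
    fix v x assume x: "solves I A v x \<and> (\<exists>u\<in>I. x u \<noteq> 0)"
    show "A r0 u0 v * f v = 0"
    proof (cases "A r0 u0 v = 0")
      case False
      then have "\<exists>u\<in>?I. x u \<noteq> 0" using pivot_nonzero Suc.prems(1) r0(1) x by metis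
      then show ?thesis using f(3) pivot_solves Suc.prems(1) r0(1) x by (metis mult_zero_right)
    qed simp
  qed
qed

text \<open>
  A one-dimensional solution space is spanned, near \<open>v0\<close>, by a vector that depends polynomially on
  the parameter. This is Cramer's rule; eliminating one unknown after the other avoids
  minors and their signs.
\<close>

lemma elimination_kernel:
  assumes "finite I" "\<And>r u. homog_poly n (A r u)"
    and "solves I A v0 \<kappa>" "\<exists>u\<in>I. \<kappa> u \<noteq> 0"
    and "\<And>x. solves I A v0 x \<Longrightarrow> \<exists>c. \<forall>u\<in>I. x u = c * \<kappa> u"
  shows "\<exists>m G. (\<forall>u. homog_poly m (G u)) \<and> (\<exists>u\<in>I. G u v0 \<noteq> 0) \<and>
           (\<forall>v x. solves I A v x \<and> (\<exists>u\<in>I. x u \<noteq> 0) \<longrightarrow> solves I A v (\<lambda>u. G u v))"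
  using assms
proof (induction "card I" arbitrary: I n A)
  case 0
  then show ?case by auto
next
  case (Suc k)
  show ?case
  proof (cases "\<exists>r0. \<exists>u0\<in>I. A r0 u0 v0 \<noteq> 0")
    \<comment> \<open>All coefficients vanish at \<open>v0\<close>, so a one-dimensional solution space leaves one unknown only.\<close>
    case False
    then have all: "solves I A v0 x" for x by (simp add: solves_def)
    obtain u1 where u1: "u1 \<in> I" "\<kappa> u1 \<noteq> 0" using Suc.prems(4) by blast
    have "u = u1" if "u \<in> I" for u
    proof (rule ccontr)
      assume "u \<noteq> u1"
      obtain c where c: "\<forall>w\<in>I. (if w = u then 1 else 0) = c * \<kappa> w"
        using Suc.prems(5)[OF all, of "\<lambda>w. if w = u then 1 else 0"] by blast
      then have "c = 0" using u1 \<open>u \<noteq> u1\<close> by (metis mult_eq_0_iff)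
      then show False using c that by auto
    qed
    then have I: "I = {u1}" using u1 by blast
    show ?thesis
      by (intro exI[of _ 0] exI[of _ "\<lambda>_ _. 1"]) (auto simp: I solves_def intro: homog_poly.const)
  next
    case True
    then obtain r0 u0 where r0: "u0 \<in> I" "A r0 u0 v0 \<noteq> 0" by blast
    let ?I = "I - {u0}" and ?A = "pivot A r0 u0"
    have k: "k = card ?I" using Suc.hyps(2) r0 Suc.prems(1) by simp
    have ker: "\<exists>c. \<forall>u\<in>?I. y u = c * \<kappa> u" if y: "solves ?I ?A v0 y" for y
    proof -
      obtain c where c: "\<forall>u\<in>I. (if u = u0 then - A r0 u0 v0 * (\<Sum>w\<in>I - {u0}. A r0 w v0 * y w)
                           else A r0 u0 v0 * A r0 u0 v0 * y u) = c * \<kappa> u"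
        using Suc.prems(5)[OF pivot_extend[OF Suc.prems(1) r0(1) y]] by (elim exE)
      have "A r0 u0 v0 * A r0 u0 v0 * y u = c * \<kappa> u" if "u \<in> ?I" for u
        using c that by (metis DiffD1 DiffD2 singletonI)
      then have "y u = c / (A r0 u0 v0 * A r0 u0 v0) * \<kappa> u" if "u \<in> ?I" for u
        using that r0(2) by (simp add: field_simps)
      then show ?thesis by blast
    qed
    obtain u1 where u1: "u1 \<in> I" "\<kappa> u1 \<noteq> 0" using Suc.prems(4) by blast
    have fin: "finite ?I" using Suc.prems(1) by simp
    have hom: "homog_poly (n + n) (?A r u)" for r u by (rule homog_pivot, rule Suc.prems(2))
    have "\<exists>m G. (\<forall>u. homog_poly m (G u)) \<and> (\<exists>u\<in>?I. G u v0 \<noteq> 0) \<and>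
        (\<forall>v x. solves ?I ?A v x \<and> (\<exists>u\<in>?I. x u \<noteq> 0) \<longrightarrow> solves ?I ?A v (\<lambda>u. G u v))"
      by (rule Suc.hyps(1)[of ?I "n + n" ?A, OF k fin hom pivot_solves[OF Suc.prems(1) r0(1) Suc.prems(3)]
          pivot_nonzero[of I u0 A v0 \<kappa> r0 u1, OF Suc.prems(1) r0(1) Suc.prems(3) r0(2) u1]]) (rule ker)
    then obtain m G where G: "\<forall>u. homog_poly m (G u)" "\<exists>u\<in>?I. G u v0 \<noteq> 0"
        "\<forall>v x. solves ?I ?A v x \<and> (\<exists>u\<in>?I. x u \<noteq> 0) \<longrightarrow> solves ?I ?A v (\<lambda>u. G u v)"
      by (elim exE conjE)
    let ?G = "\<lambda>u v. if u = u0 then - A r0 u0 v * (\<Sum>w\<in>I - {u0}. A r0 w v * G w v)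
                           else A r0 u0 v * A r0 u0 v * G u v"
    show ?thesis
    proof (intro exI[of _ "n + (n + m)"] exI[of _ ?G] conjI allI impI)
      fix u
      show "homog_poly (n + (n + m)) (?G u)"
      proof (cases "u = u0")
        case True
        have "homog_poly (n + (n + m)) (\<lambda>v. - A r0 u0 v * (\<Sum>w\<in>I - {u0}. A r0 w v * G w v))"
          by (intro homog_poly.mult homog_uminus homog_sum Suc.prems(2) G(1)[rule_format])
        then show ?thesis using True by simp
      next
        case False
        have "homog_poly (n + (n + m)) (\<lambda>v. A r0 u0 v * (A r0 u0 v * G u v))"
          by (intro homog_poly.mult Suc.prems(2) G(1)[rule_format])
        then show ?thesis using False by (simp add: mult.assoc)
      qed
    next
      obtain u where "u \<in> ?I" "G u v0 \<noteq> 0" using G(2) by blast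
      then show "\<exists>u\<in>I. ?G u v0 \<noteq> 0" using r0 by (intro bexI[of _ u]) auto
    next
      fix v x assume x: "solves I A v x \<and> (\<exists>u\<in>I. x u \<noteq> 0)"
      show "solves I A v (\<lambda>u. ?G u v)"
      proof (cases "A r0 u0 v = 0")
        case True
        then show ?thesis by (simp add: solves_def if_distrib cong: if_cong)
      next
        case False
        then have "\<exists>u\<in>?I. x u \<noteq> 0" using pivot_nonzero Suc.prems(1) r0(1) x by metis
        then have "solves ?I ?A v (\<lambda>u. G u v)"
          using G(3) pivot_solves Suc.prems(1) r0(1) x by metis
        from pivot_extend[OF Suc.prems(1) r0(1) this] show ?thesis .
      qed
    qed
  qed
qed

section \<open>Evaluation on the projective line\<close>

lemma form_eval_infinity: "form_eval n p s 0 = coeff p n * s ^ n"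
proof -
  have "form_eval n p s 0 = (\<Sum>i\<in>{..n}. if i = n then coeff p n * s ^ n else 0)"
    unfolding form_eval_def by (rule sum.cong) auto
  then show ?thesis by simp
qed

lemma form_eval_finite:
  assumes "degree p \<le> n" "t \<noteq> 0"
  shows "form_eval n p s t = t ^ n * poly p (s / t)"
proof -
  have e1: "poly p (s / t) = (\<Sum>i\<le>n. coeff p i * (s / t) ^ i)"
    unfolding poly_altdef using assms(1)
    by (intro sum.mono_neutral_left) (auto simp: coeff_eq_0)
  have e2: "t ^ n * (coeff p i * (s / t) ^ i) = coeff p i * s ^ i * t ^ (n - i)" if "i \<le> n" for i
    using assms(2) that by (simp add: power_divide power_diff)
  show ?thesis unfolding form_eval_def e1 sum_distrib_left by (rule sum.cong) (simp_all add: e2)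
qed

lemma hom_eval_infinity: "hom_eval n \<psi> s 0 = s ^ n *s coeff_vec \<psi> n"
  by (simp add: hom_eval_def coeff_vec_def vec_eq_iff form_eval_infinity mult.commute)

lemma hom_eval_finite: "\<psi> \<in> homs n \<Longrightarrow> t \<noteq> 0 \<Longrightarrow> hom_eval n \<psi> s t = t ^ n *s at_point \<psi> (s / t)"
  by (simp add: hom_eval_def at_point_def vec_eq_iff form_eval_finite homs_iff)

text \<open>
  The points of the projective line are the finite points \<open>(x : 1)\<close> and the point \<open>(1 : 0)\<close>.
\<close>

lemma all_points_iff:
  assumes "\<psi> \<in> homs n" "\<And>c v. c \<noteq> 0 \<Longrightarrow> P (c *s v) \<longleftrightarrow> P v"
  shows "(\<forall>s t. (s, t) \<noteq> (0, 0) \<longrightarrow> P (hom_eval n \<psi> s t)) \<longleftrightarrow> (\<forall>x. P (at_point \<psi> x)) \<and> P (coeff_vec \<psi> n)"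
    (is "?L \<longleftrightarrow> ?R")
proof
  assume ?L
  have "P (at_point \<psi> x)" for x
    using \<open>?L\<close>[rule_format, of x 1] hom_eval_finite[OF assms(1), of 1 x] by simp
  moreover have "P (coeff_vec \<psi> n)"
    using \<open>?L\<close>[rule_format, of 1 0] hom_eval_infinity[of n \<psi> 1] by simp
  ultimately show ?R by blast
next
  assume R: ?R
  show ?L
  proof (intro allI impI)
    fix s t :: complex assume st: "(s, t) \<noteq> (0, 0)"
    show "P (hom_eval n \<psi> s t)"
    proof (cases "t = 0")
      case True
      then show ?thesis using R st assms(2)[of "s ^ n"] by (simp add: hom_eval_infinity)
    next
      case False
      then show ?thesis using R assms(2)[of "t ^ n"] by (simp add: hom_eval_finite[OF assms(1)])
    qed
  qed
qed

lemma basefree_hom_eval: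
  assumes "\<psi> \<in> homs d" "basefree d \<psi>" "(s, t) \<noteq> (0, 0)"
  shows "hom_eval d \<psi> s t \<noteq> 0"
  using all_points_iff[OF assms(1), of "\<lambda>v. v \<noteq> 0"] assms(2,3) by (simp add: basefree_def)

lemma coeff_quad_top: "\<psi> \<in> homs n \<Longrightarrow> coeff (quad \<psi>) (n + n) = quad (coeff_vec \<psi> n)"
  by (simp add: quad_def coeff_vec_def coeff_mult_top homs_iff)

lemma quad_scale: "quad (c *s \<eta>) = c * c * quad \<eta>"
  by (simp add: quad_def algebra_simps)

lemma quad_zero_iff_points: "quad \<psi> = 0 \<longleftrightarrow> (\<forall>x. quad (at_point \<psi> x) = 0)"
  by (metis poly_0 poly_eqI_points poly_quad)

lemma Mor_iff: "\<psi> \<in> Mor e \<longleftrightarrow> \<psi> \<in> homs e \<and> basefree e \<psi> \<and> quad \<psi> = 0"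
proof (cases "\<psi> \<in> homs e")
  case True
  have "\<psi> \<in> Mor e \<longleftrightarrow> (\<forall>s t. (s, t) \<noteq> (0, 0) \<longrightarrow> hom_eval e \<psi> s t \<noteq> 0 \<and> quad (hom_eval e \<psi> s t) = 0)"
    using True by (simp add: Mor_def q_eq_quad)
  also have "\<dots> \<longleftrightarrow> (\<forall>x. at_point \<psi> x \<noteq> 0 \<and> quad (at_point \<psi> x) = 0) \<and> coeff_vec \<psi> e \<noteq> 0 \<and> quad (coeff_vec \<psi> e) = 0"
    by (rule all_points_iff[OF True]) (simp add: quad_scale)
  also have "\<dots> \<longleftrightarrow> basefree e \<psi> \<and> quad \<psi> = 0"
    using coeff_quad_top[OF True] quad_zero_iff_points[of \<psi>] by (auto simp: basefree_def)
  finally show ?thesis using True by blast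
qed (simp add: Mor_def)

section \<open>Tuples spanning an isotropic subspace\<close>

text \<open>
  Two points of the quadric span an isotropic line if and only if they are orthogonal for the polar
  form. By \<open>in_isotropic_plane_iff\<close> below, this describes the morphisms with image in an
  isotropic plane, and it is visibly a closed condition.
\<close>

definition isotropic_span :: "complex poly ^ 6 \<Rightarrow> bool" where
  "isotropic_span \<phi> \<longleftrightarrow> (\<forall>x y. polar (at_point \<phi> x) (at_point \<phi> y) = 0)"

lemma contract_star_add: "contract (star (\<eta> + \<zeta>)) l = contract (star \<eta>) l + contract (star \<zeta>) l"
  by (simp add: ext_simps algebra_simps)

lemma dot_scale: "dot l (c *s v) = c * dot l v"
  by (simp add: dot_def sum_distrib_left algebra_simps)

lemma ex_dual_vector:
  fixes l m :: "'a::field ^ 4"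
  assumes "wdg l m \<noteq> 0"
  shows "\<exists>w. dot l w = 0 \<and> dot m w = 1"
proof -
  obtain w' where "contract (wdg l m) w' \<noteq> 0" using ex_contract_nonzero[OF assms] by blast
  then obtain w'' where w: "dot (contract (wdg l m) w') w'' \<noteq> 0" using ex_dot_nonzero by blast
  let ?n = "dot (contract (wdg l m) w') w''"
  define w where "w = dot l w' *s w'' - dot l w'' *s w'"
  have "dot l w = 0" by (simp add: w_def dot_def sum_4 algebra_simps)
  moreover have "dot m w = ?n"
    by (simp add: w_def contract_wdg) (simp add: dot_def sum_4 algebra_simps)
  ultimately have "dot l ((1 / ?n) *s w) = 0" "dot m ((1 / ?n) *s w) = 1"
    using w by (simp_all add: dot_scale)
  then show ?thesis by blast
qed

lemma wedge_annihilated: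
  fixes l m :: "'a::field ^ 4"
  assumes "wdg l m \<noteq> 0" "contract (star \<zeta>) l = 0" "contract (star \<zeta>) m = 0"
  shows "\<exists>k. \<zeta> = k *s wdg l m"
proof -
  obtain w where w: "dot l w = 0" "dot m w = 1" using ex_dual_vector[OF assms(1)] by blast
  have "wdg m l \<noteq> 0" using assms(1) by (simp add: wdg_skew[of m l])
  then obtain u where u: "dot m u = 0" "dot l u = 1" using ex_dual_vector by blast
  define n where "n = contract \<zeta> u"
  have z: "\<zeta> = wdg l n" using koszul[of l u \<zeta>] u assms(2) by (simp add: n_def)
  have "\<zeta> = wdg m (contract \<zeta> w)" using koszul[of m w \<zeta>] w assms(3) by simp
  also have "contract \<zeta> w = - dot n w *s l" unfolding z contract_wdg using w by simp
  also have "wdg m (- dot n w *s l) = dot n w *s wdg l m"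
    by (simp add: ext_simps algebra_simps)
  finally show ?thesis by blast
qed

text \<open>
  Two independent vectors in the kernel of three independent linear forms would have a wedge
  product whose star is proportional to both \<open>p \<and> m\<close> and \<open>p \<and> n\<close>.
\<close>

lemma common_kernel:
  fixes p m n :: "'a::field ^ 4"
  assumes "wdg p m \<noteq> 0" "\<And>k. wdg p n \<noteq> k *s wdg p m"
    and v: "v \<noteq> 0" "dot p v = 0" "dot m v = 0" "dot n v = 0"
    and u: "dot p u = 0" "dot m u = 0" "dot n u = 0"
  shows "\<exists>k. u = k *s v"
proof (rule ccontr)
  assume "\<nexists>k. u = k *s v"
  then have w0: "wdg v u \<noteq> 0" using wdg_eq_0_iff[OF v(1)] by blast
  have "contract (wdg v u) p = 0" "contract (wdg v u) m = 0" "contract (wdg v u) n = 0"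
    unfolding contract_wdg using v u by (simp_all add: dot_commute[of v] dot_commute[of u])
  then have c: "contract (star (star (wdg v u))) p = 0" "contract (star (star (wdg v u))) m = 0"
     "contract (star (star (wdg v u))) n = 0" by simp_all
  obtain k where k: "star (wdg v u) = k *s wdg p m" using wedge_annihilated[OF assms(1) c(1,2)] by blast
  have n0: "wdg p n \<noteq> 0" using assms(2)[of 0] by simp
  obtain j where j: "star (wdg v u) = j *s wdg p n" using wedge_annihilated[OF n0 c(1,3)] by blast
  have "j \<noteq> 0" using j w0 by auto
  have "j *s wdg p n = k *s wdg p m" using k j by simp
  then have "wdg p n = (k / j) *s wdg p m" using \<open>j \<noteq> 0\<close> by (simp add: vec_eq_iff field_simps)
  then show False using assms(2) by blast
qed

lemma contract_star_const_points:
  "contract (star \<phi>) (const_vec l) = 0 \<longleftrightarrow> (\<forall>x. contract (star (at_point \<phi> x)) l = 0)"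
proof
  assume "contract (star \<phi>) (const_vec l) = 0"
  then have "at_point (contract (star \<phi>) (const_vec l)) x = 0" for x by simp
  then show "\<forall>x. contract (star (at_point \<phi> x)) l = 0" by simp
next
  assume "\<forall>x. contract (star (at_point \<phi> x)) l = 0"
  then show "contract (star \<phi>) (const_vec l) = 0" by (intro vec_poly_eqI) simp
qed

lemma contract_const_points:
  "contract \<phi> (const_vec l) = 0 \<longleftrightarrow> (\<forall>x. contract (at_point \<phi> x) l = 0)"
  using contract_star_const_points[of "star \<phi>" l] by simp

lemma wedge_factor:
  fixes l :: "'a::field ^ 4"
  assumes "l \<noteq> 0" "contract (star \<eta>) l = 0"
  shows "\<exists>m. \<eta> = wdg l m"
proof -
  obtain w where w: "dot l w \<noteq> 0" using ex_dot_nonzero[OF assms(1)] by blast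
  have "dot l w *s \<eta> = wdg l (contract \<eta> w)" using koszul[of l w \<eta>] assms(2) by simp
  then have "\<eta> = wdg l ((1 / dot l w) *s contract \<eta> w)"
    using w by (simp add: wdg_scale vec_eq_iff field_simps)
  then show ?thesis by blast
qed

lemma quad_zero_decomposable:
  fixes \<omega> :: "'a::field ^ 6"
  assumes "\<omega> \<noteq> 0" "quad \<omega> = 0"
  shows "\<exists>l m. l \<noteq> 0 \<and> \<omega> = wdg l m"
proof -
  obtain v where v: "contract \<omega> v \<noteq> 0" using ex_contract_nonzero[OF assms(1)] by blast
  have "contract (star \<omega>) (contract \<omega> v) = 0"
    using contract_contract_star[of "star \<omega>" v] assms(2) by simp
  then show ?thesis using wedge_factor[OF v] v by blast
qed

lemma homs_0_const: "\<beta> \<in> homs 0 \<Longrightarrow> \<beta> = const_vec (at_point \<beta> 0)"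
proof -
  assume "\<beta> \<in> homs 0"
  then have "\<beta> $ k = [:poly (\<beta> $ k) 0:]" for k
    by (metis degree_eq_zeroE homs_iff le_zero_eq poly_const_conv poly_pCons mult_zero_left add.right_neutral)
  then show ?thesis by (simp add: const_vec_def at_point_def vec_eq_iff)
qed

text \<open>
  In degree at most one the splitting type \<open>b \<le> a\<close>, \<open>a + b = d\<close> forces \<open>b = 0\<close>.
\<close>

lemma ex_constant_factor:
  fixes \<phi> :: "complex poly ^ 6"
  assumes "\<phi> \<noteq> 0" "\<phi> \<in> homs d" "quad \<phi> = 0" "d \<le> 1"
  shows "\<exists>l. l \<noteq> 0 \<and> contract (star \<phi>) (const_vec l) = 0"
proof -
  obtain a b \<beta> \<gamma> where *: "a + b = d" "b \<le> a" "\<beta> \<in> homs b" "basefree b \<beta>" "\<phi> = wdg \<beta> \<gamma>"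
    using quad_zero_decompose[OF assms(1,2,3)] by blast
  then have "b = 0" using assms(4) by simp
  then have "\<beta> = const_vec (at_point \<beta> 0)" using *(3) homs_0_const by blast
  moreover have "at_point \<beta> 0 \<noteq> 0" using *(4) by (simp add: basefree_def)
  moreover have "contract (star \<phi>) \<beta> = 0" unfolding *(5) by (rule contract_star_wdg)
  ultimately show ?thesis by metis
qed

text \<open>
  The two families of isotropic planes. In terms of lines in three-space: lines that meet
  pairwise all pass through one point or all lie in one plane. Two distinct members
  of the family span a pencil and hence share a factor \<open>p\<close>. If some third member \<open>\<eta>3\<close> does not contain
  \<open>p\<close>, then it determines with the first two a three-dimensional space, the kernel of the vector
  \<open>v\<close> representing \<open>p \<and> \<eta>3\<close>. Orthogonality to all three forces every member into this
  space.
\<close>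

lemma isotropic_classification:
  assumes "\<phi> \<noteq> 0" "quad \<phi> = 0" "isotropic_span \<phi>"
  shows "(\<exists>l. l \<noteq> 0 \<and> contract (star \<phi>) (const_vec l) = 0) \<or> (\<exists>v. v \<noteq> 0 \<and> contract \<phi> (const_vec v) = 0)"
proof -
  define U where "U = range (at_point \<phi>)"
  have q0: "quad \<eta> = 0" if "\<eta> \<in> U" for \<eta> using that assms(2) quad_zero_iff_points by (auto simp: U_def)
  have B0: "polar \<eta> \<zeta> = 0" if "\<eta> \<in> U" "\<zeta> \<in> U" for \<eta> \<zeta>
    using that assms(3) by (auto simp: U_def isotropic_span_def)
  obtain \<eta>1 where \<eta>1: "\<eta>1 \<in> U" "\<eta>1 \<noteq> 0"
  proof -
    have "\<exists>x. at_point \<phi> x \<noteq> 0" using assms(1) vec_poly_eqI[of \<phi> 0] by auto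
    then show ?thesis using that by (auto simp: U_def)
  qed
  show ?thesis
  proof (cases "\<forall>\<eta>\<in>U. \<exists>k. \<eta> = k *s \<eta>1")
    case True
    obtain l m where l: "l \<noteq> 0" "\<eta>1 = wdg l m"
      using quad_zero_decomposable[OF \<eta>1(2) q0[OF \<eta>1(1)]] by blast
    then have "contract (star (k *s \<eta>1)) l = 0" for k
      using star_linear[of 0 k \<eta>1] by (simp add: contract_scale contract_star_wdg)
    then have "contract (star (at_point \<phi> x)) l = 0" for x
      using True unfolding U_def by (metis rangeI)
    then show ?thesis using l(1) contract_star_const_points by blast
  next
    case False
    then obtain \<eta>2 where \<eta>2: "\<eta>2 \<in> U" "\<And>k. \<eta>2 \<noteq> k *s \<eta>1" by blast
    \<comment> \<open>The pencil is an isotropic tuple of degree one, so it has a constant factor.\<close>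
    define \<phi>0 where "\<phi>0 = const_vec \<eta>1 + [:0, 1:] *s const_vec \<eta>2"
    have at0: "at_point \<phi>0 x = \<eta>1 + x *s \<eta>2" for x by (simp add: \<phi>0_def)
    have "\<phi>0 \<in> homs (1 + 0)" unfolding \<phi>0_def by (intro homs_add homs_mult homs_const) simp
    moreover have "\<phi>0 \<noteq> 0" using at0[of 0] \<eta>1(2) by auto
    moreover have "quad \<phi>0 = 0"
    proof -
      have "polar \<eta>1 (x *s \<eta>2) = x * polar \<eta>1 \<eta>2" for x by (simp add: polar_def algebra_simps)
      then show ?thesis
        unfolding quad_zero_iff_points at0 quad_add quad_scale using q0 B0 \<eta>1 \<eta>2 by simp
    qed
    ultimately obtain p where p: "p \<noteq> 0" "contract (star \<phi>0) (const_vec p) = 0"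
      using ex_constant_factor by force
    then have c0: "contract (star (\<eta>1 + x *s \<eta>2)) p = 0" for x
      using at0 contract_star_const_points by metis
    have c1: "contract (star \<eta>1) p = 0" using c0[of 0] by simp
    have c2: "contract (star \<eta>2) p = 0" using c0[of 1] c1 by (simp add: contract_star_add)
    obtain m1 where m1: "\<eta>1 = wdg p m1" using wedge_factor[OF p(1) c1] by blast
    obtain m2 where m2: "\<eta>2 = wdg p m2" using wedge_factor[OF p(1) c2] by blast
    show ?thesis
    proof (cases "\<forall>\<eta>\<in>U. contract (star \<eta>) p = 0")
      case True
      then show ?thesis using p(1) contract_star_const_points unfolding U_def by blast
    next
      case False
      then obtain \<eta>3 where \<eta>3: "\<eta>3 \<in> U" "contract (star \<eta>3) p \<noteq> 0" by blast
      let ?v = "contract (star \<eta>3) p"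
      have kill: "dot p (contract (star \<eta>) p) = 0" "dot m1 (contract (star \<eta>) p) = 0"
          "dot m2 (contract (star \<eta>) p) = 0" if "\<eta> \<in> U" for \<eta>
        using dot_contract_skew[of "star \<eta>" p p] polar_wdg[of p m1 \<eta>] polar_wdg[of p m2 \<eta>]
          B0[OF \<eta>1(1) that] B0[OF \<eta>2(1) that] m1 m2 by (simp_all add: dot_commute[of p])
      have "contract \<eta> ?v = 0" if \<eta>: "\<eta> \<in> U" for \<eta>
      proof -
        \<comment> \<open>All the trivectors \<open>p \<and> \<eta>\<close> are killed by \<open>p\<close>, \<open>m1\<close>, \<open>m2\<close>, hence proportional to one of them.\<close>
        obtain k where k: "contract (star \<eta>) p = k *s ?v"
          using common_kernel[of p m1 m2 ?v "contract (star \<eta>) p"] \<eta>1(2) \<eta>2(2) m1 m2 \<eta>3 kill \<eta> by blast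
        have "contract \<eta>3 (contract (star \<eta>) p) = 0"
          unfolding k contract_scale contract_contract_star using q0[OF \<eta>3(1)] by simp
        then show ?thesis
          using contract_contract_star_polar[of \<eta> \<eta>3 p] B0[OF \<eta> \<eta>3(1)] by simp
      qed
      then show ?thesis using \<eta>3(2) contract_const_points unfolding U_def by blast
    qed
  qed
qed

lemma wedge_const_form:
  assumes "l \<noteq> 0" "contract (star \<phi>) (const_vec l) = 0" "\<phi> \<in> homs d"
  shows "\<exists>\<gamma>\<in>homs d. \<phi> = wdg (const_vec l) \<gamma>"
proof -
  obtain w where w: "dot l w \<noteq> 0" using ex_dot_nonzero[OF assms(1)] by blast
  define u where "u = (1 / dot l w) *s w"
  have d1: "dot l u = 1"
    using w by (simp add: u_def dot_scale)
  have "dot (const_vec l) (const_vec u) = [:dot l u:]"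
    by (rule poly_eqI_points) (simp add: dot_def const_vec_def poly_sum mult.commute)
  then have "dot (const_vec l) (const_vec u) = 1" using d1 by (simp add: one_pCons)
  then have "\<phi> = wdg (const_vec l) (contract \<phi> (const_vec u))"
    using koszul[of "const_vec l" "const_vec u" \<phi>] assms(2) by simp
  moreover have "contract \<phi> (const_vec u) \<in> homs d"
    using homs_contract[OF assms(3), of "const_vec u" 0] by simp
  ultimately show ?thesis by blast
qed

lemma polar_same_factor: "polar (wdg l m) (wdg l n) = 0"
  by (simp add: ext_simps algebra_simps)

lemma isotropic_span_wdg: "isotropic_span (wdg (const_vec l) \<gamma>)"
  by (simp add: isotropic_span_def polar_same_factor)

lemma isotropic_span_star [simp]: "isotropic_span (star \<phi>) \<longleftrightarrow> isotropic_span \<phi>"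
  by (simp add: isotropic_span_def)

lemma isotropic_span_if_contract:
  assumes "l \<noteq> 0" "contract (star \<phi>) (const_vec l) = 0 \<or> contract \<phi> (const_vec l) = 0"
  shows "isotropic_span \<phi>"
proof -
  have *: "isotropic_span \<zeta>" if "contract (star \<zeta>) (const_vec l) = 0" for \<zeta>
    using wedge_const_form[OF assms(1) that] ex_homs isotropic_span_wdg by metis
  then show ?thesis using assms(2) *[of \<phi>] *[of "star \<phi>"] by auto
qed

text \<open>
  The plane is the image of \<open>m \<mapsto> l \<and> m\<close>, which is injective on the coordinate hyperplane \<open>m\<^sub>i = 0\<close>
  when \<open>l\<^sub>i \<noteq> 0\<close>.
\<close>

lemma isotropic_plane_contract_star:
  assumes "l \<noteq> 0"
  shows "isotropic_plane {\<eta>. contract (star \<eta>) l = 0}"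
proof -
  obtain i where i: "l $ i \<noteq> 0" using assms by (auto simp: vec_eq_iff)
  define S where "S = {m :: complex ^ 4. \<forall>j. j \<notin> UNIV - {i} \<longrightarrow> m $ j = 0}"
  have lin: "Vector_Spaces.linear (*s) (*s) (wdg l)"
    by unfold_locales (simp_all add: ext_simps algebra_simps)
  have P: "{\<eta>. contract (star \<eta>) l = 0} = wdg l ` S"
  proof (intro set_eqI iffI)
    fix \<eta> assume "\<eta> \<in> {\<eta>. contract (star \<eta>) l = 0}"
    then obtain m where m: "\<eta> = wdg l m" using wedge_factor[OF assms] by blast
    have "wdg l m = wdg l (m - (m $ i / l $ i) *s l)" by (simp add: wdg_diff)
    moreover have "m - (m $ i / l $ i) *s l \<in> S" using i by (simp add: S_def)
    ultimately show "\<eta> \<in> wdg l ` S" using m by (metis image_eqI)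
  qed (auto simp: contract_star_wdg)
  have S: "vec.subspace S" unfolding S_def by (auto simp: vec.subspace_def)
  have "inj_on (wdg l) (vec.span S)"
  proof (rule inj_onI)
    fix m n assume mn: "m \<in> vec.span S" "n \<in> vec.span S" "wdg l m = wdg l n"
    then have "m \<in> S" "n \<in> S" by (simp_all add: vec.span_eq_iff[THEN iffD2, OF S])
    have "wdg l (m - 1 *s n) = 0" unfolding wdg_diff using mn(3) by simp
    then obtain c where c: "m - n = c *s l" using wdg_eq_0_iff[OF assms] by auto
    have "(m - n) $ i = 0" using \<open>m \<in> S\<close> \<open>n \<in> S\<close> by (simp add: S_def)
    then show "m = n" using c i by simp
  qed
  then have "vec.dim (wdg l ` S) = vec.dim S" by (rule vec.dim_image_eq[OF lin])
  also have "\<dots> = card (UNIV - {i})" unfolding S_def by (rule dim_substandard_cart)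
  also have "\<dots> = 3" by (simp add: card_Diff_singleton)
  finally have "vec.dim (wdg l ` S) = 3" .
  moreover have "vec.subspace (wdg l ` S)"
    unfolding P[symmetric] by (auto simp: vec.subspace_def contract_star_add contract_scale star_linear[of 0, simplified])
  ultimately show ?thesis
    unfolding isotropic_plane_def P q_eq_quad by auto
qed

lemma isotropic_plane_star:
  assumes "isotropic_plane P"
  shows "isotropic_plane (star ` P)"
proof -
  have lin: "Vector_Spaces.linear (*s) (*s) (star :: complex ^ 6 \<Rightarrow> complex ^ 6)"
    by unfold_locales (simp_all add: ext_simps algebra_simps)
  have "inj_on (star :: complex ^ 6 \<Rightarrow> complex ^ 6) A" for A by (metis inj_onI star_star)
  then have "vec.dim (star ` P) = vec.dim P" by (rule vec.dim_image_eq[OF lin])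
  moreover have "vec.subspace (star ` P)"
  proof -
    have "star ` P = {\<eta>. star \<eta> \<in> P}" by (auto simp: image_iff) (metis star_star)
    moreover have "star (\<eta> + \<zeta>) = star \<eta> + star \<zeta>" "star (c *s \<eta>) = c *s star \<eta>"
      for c and \<eta> \<zeta> :: "complex ^ 6" by (simp_all add: ext_simps)
    ultimately show ?thesis using assms by (simp add: isotropic_plane_def vec.subspace_def)
  qed
  ultimately show ?thesis using assms by (auto simp: isotropic_plane_def q_eq_quad)
qed

lemma isotropic_plane_contract:
  assumes "l \<noteq> 0"
  shows "isotropic_plane {\<eta>. contract \<eta> l = 0}"
proof -
  have "{\<eta>. contract \<eta> l = 0} = star ` {\<eta>. contract (star \<eta>) l = 0}"
    by (auto simp: image_iff) (metis star_star)
  then show ?thesis using isotropic_plane_star[OF isotropic_plane_contract_star[OF assms]] by simp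
qed

lemma coeff_vec_contract_const: "coeff_vec (contract \<phi> (const_vec l)) n = contract (coeff_vec \<phi> n) l"
  by (simp add: coeff_vec_def const_vec_def ext_simps mult.commute)

text \<open>
  A subspace on which \<open>q\<close> vanishes is also isotropic for the polar form. Conversely a tuple with
  isotropic span lies in a plane of one of the two families.
\<close>

lemma in_isotropic_plane_iff:
  assumes "\<psi> \<in> homs e" "quad \<psi> = 0" "\<psi> \<noteq> 0"
  shows "(\<exists>P. isotropic_plane P \<and> (\<forall>s t. (s, t) \<noteq> (0, 0) \<longrightarrow> hom_eval e \<psi> s t \<in> P)) \<longleftrightarrow> isotropic_span \<psi>"
proof
  assume "\<exists>P. isotropic_plane P \<and> (\<forall>s t. (s, t) \<noteq> (0, 0) \<longrightarrow> hom_eval e \<psi> s t \<in> P)"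
  then obtain P where P: "isotropic_plane P" "\<And>s t. (s, t) \<noteq> (0, 0) \<Longrightarrow> hom_eval e \<psi> s t \<in> P" by blast
  have mem: "at_point \<psi> x \<in> P" for x
    using P(2)[of x 1] hom_eval_finite[OF assms(1), of 1 x] by simp
  have "polar u v = 0" if "u \<in> P" "v \<in> P" for u v
  proof -
    have "u + v \<in> P" using P(1) that vec.subspace_add unfolding isotropic_plane_def by blast
    then show ?thesis using P(1) that quad_add[of u v] by (simp add: isotropic_plane_def q_eq_quad)
  qed
  then show "isotropic_span \<psi>" using mem by (simp add: isotropic_span_def)
next
  assume "isotropic_span \<psi>"
  have suff: ?thesis if P: "isotropic_plane P" "\<And>x. at_point \<psi> x \<in> P" "coeff_vec \<psi> e \<in> P" for P
  proof -
    have sc: "c *s v \<in> P" if "v \<in> P" for c v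
      using P(1) that vec.subspace_scale unfolding isotropic_plane_def by blast
    have "c *s v \<in> P \<longleftrightarrow> v \<in> P" if "c \<noteq> 0" for c v
      using sc[of v c] sc[of "c *s v" "1 / c"] that by (auto simp: vector_smult_assoc)
    then have "\<forall>s t. (s, t) \<noteq> (0, 0) \<longrightarrow> hom_eval e \<psi> s t \<in> P"
      using all_points_iff[OF assms(1), of "\<lambda>v. v \<in> P"] P(2,3) by blast
    then show ?thesis using P(1) \<open>isotropic_span \<psi>\<close> by blast
  qed
  from \<open>isotropic_span \<psi>\<close> consider l where "l \<noteq> 0" "contract (star \<psi>) (const_vec l) = 0"
    | l where "l \<noteq> 0" "contract \<psi> (const_vec l) = 0"
    using isotropic_classification[OF assms(3,2)] by blast
  then have ?thesis
  proof cases
    case 1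
    have "contract (star (coeff_vec \<psi> e)) l = 0"
      using 1(2) coeff_vec_contract_const[of "star \<psi>" l e] by simp
    then show ?thesis
      using suff[OF isotropic_plane_contract_star[OF 1(1)]] 1(2) by (simp add: contract_star_const_points)
  next
    case 2
    have "contract (coeff_vec \<psi> e) l = 0"
      using 2(2) coeff_vec_contract_const[of \<psi> l e] by simp
    then show ?thesis
      using suff[OF isotropic_plane_contract[OF 2(1)]] 2(2) by (simp add: contract_const_points)
  qed
  then show "\<exists>P. isotropic_plane P \<and> (\<forall>s t. (s, t) \<noteq> (0, 0) \<longrightarrow> hom_eval e \<psi> s t \<in> P)"
    using \<open>isotropic_span \<psi>\<close> by blast
qed

lemma R_eq:
  "R e = {pt (hom_coords \<psi>) | \<psi>. \<psi> \<in> homs e \<and> basefree e \<psi> \<and> quad \<psi> = 0 \<and> \<not> isotropic_span \<psi>}"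
proof -
  have "\<psi> \<in> Mor e \<and> \<not> (\<exists>P. isotropic_plane P \<and> (\<forall>s t. (s, t) \<noteq> (0, 0) \<longrightarrow> hom_eval e \<psi> s t \<in> P))
     \<longleftrightarrow> \<psi> \<in> homs e \<and> basefree e \<psi> \<and> quad \<psi> = 0 \<and> \<not> isotropic_span \<psi>" for \<psi>
  proof (cases "\<psi> \<in> homs e \<and> basefree e \<psi> \<and> quad \<psi> = 0")
    case True
    then have "\<psi> \<in> homs e" "quad \<psi> = 0" "\<psi> \<noteq> 0" by (auto dest: basefree_nonzero)
    then show ?thesis unfolding Mor_iff in_isotropic_plane_iff[OF \<open>\<psi> \<in> homs e\<close> \<open>quad \<psi> = 0\<close> \<open>\<psi> \<noteq> 0\<close>]
      by simp
  next
    case False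
    then show ?thesis unfolding Mor_iff by (simp only: simp_thms) blast
  qed
  then show ?thesis unfolding R_def by simp
qed

section \<open>Splitting types and the two families of isotropic planes\<close>

lemma taut_K_eq: "taut_K \<eta> = {v. contract \<eta> v = 0}"
proof -
  have "(\<forall>w. dot (contract \<eta> v) w = 0) \<longleftrightarrow> contract \<eta> v = 0" for v
    using ex_dot_nonzero by fastforce
  then show ?thesis by (simp add: taut_K_def pairing_eq_dot wedge_eq_wdg dot_contract[symmetric])
qed

lemma hom_eval_0: "\<alpha> \<in> homs 0 \<Longrightarrow> (s, t) \<noteq> (0, 0) \<Longrightarrow> hom_eval 0 \<alpha> s t = at_point \<alpha> 0"
proof -
  assume a: "\<alpha> \<in> homs 0" "(s, t) \<noteq> (0, 0)"
  obtain l where l: "\<alpha> = const_vec l" using homs_0_const[OF a(1)] by blast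
  have "coeff_vec (const_vec l) 0 = l" by (simp add: coeff_vec_def const_vec_def)
  then show ?thesis using a l by (cases "t = 0") (simp_all add: hom_eval_infinity hom_eval_finite)
qed

lemma hom_eval_wdg_const:
  assumes "\<gamma> \<in> homs d"
  shows "hom_eval d (wdg (const_vec l) \<gamma>) s t = wdg l (hom_eval d \<gamma> s t)"
proof (cases "t = 0")
  case True
  have "coeff_vec (wdg (const_vec l) \<gamma>) (0 + d) = wdg (coeff_vec (const_vec l) 0) (coeff_vec \<gamma> d)"
    by (rule coeff_vec_wdg[OF homs_const assms])
  moreover have "coeff_vec (const_vec l) 0 = l" by (simp add: coeff_vec_def const_vec_def)
  ultimately show ?thesis using True by (simp add: hom_eval_infinity wdg_scale)
next
  case False
  have "wdg (const_vec l) \<gamma> \<in> homs d" using homs_wdg[OF homs_const[of l 0] assms] by simp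
  then show ?thesis using False assms by (simp add: hom_eval_finite wdg_scale)
qed

lemma hom_eval_star: "\<phi> \<in> homs d \<Longrightarrow> hom_eval d (star \<phi>) s t = star (hom_eval d \<phi> s t)"
proof -
  assume a: "\<phi> \<in> homs d"
  have sc: "star (c *s \<eta>) = c *s star \<eta>" for c and \<eta> :: "complex ^ 6" using star_linear[of 0 c \<eta>] by simp
  show ?thesis using a homs_star[OF a]
    by (cases "t = 0") (simp_all add: hom_eval_infinity hom_eval_finite sc)
qed

lemma surj_dot_pair:
  fixes l m :: "complex ^ 4"
  assumes "wdg l m \<noteq> 0"
  shows "surj (\<lambda>v. (dot l v, dot m v))"
proof -
  obtain w where w: "dot l w = 0" "dot m w = 1" using ex_dual_vector[OF assms] by blast
  have "wdg m l \<noteq> 0" using assms by (simp add: wdg_skew[of m l])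
  then obtain u where u: "dot m u = 0" "dot l u = 1" using ex_dual_vector by blast
  have "dot k (a *s u + b *s w) = a * dot k u + b * dot k w" for a b and k :: "complex ^ 4"
    by (simp add: dot_def sum_4 algebra_simps)
  then have "y = (dot l (fst y *s u + snd y *s w), dot m (fst y *s u + snd y *s w))" for y
    using u w by simp
  then show ?thesis unfolding surj_def by (intro allI exI)
qed

lemma contract_wdg_eq_0_iff:
  fixes l m :: "complex ^ 4"
  assumes "wdg l m \<noteq> 0"
  shows "contract (wdg l m) v = 0 \<longleftrightarrow> dot l v = 0 \<and> dot m v = 0"
proof
  assume "contract (wdg l m) v = 0"
  then have e: "dot l v *s m - dot m v *s l = 0" by (simp add: contract_wdg)
  have "wdg l (dot l v *s m - dot m v *s l) = dot l v *s wdg l m"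
    by (simp add: ext_simps algebra_simps)
  moreover have "wdg m (dot l v *s m - dot m v *s l) = dot m v *s wdg l m"
    by (simp add: ext_simps algebra_simps)
  ultimately show "dot l v = 0 \<and> dot m v = 0" using assms unfolding e by auto
qed (simp add: contract_wdg)

lemma annihilator_taut_K:
  fixes v m :: "complex ^ 4"
  assumes "wdg v m \<noteq> 0"
  shows "annihilator (taut_K (star (wdg v m))) = {l. dot v l = 0 \<and> dot m l = 0}"
proof (intro set_eqI iffI)
  fix l assume "l \<in> annihilator (taut_K (star (wdg v m)))"
  then show "l \<in> {l. dot v l = 0 \<and> dot m l = 0}"
    by (simp add: annihilator_def taut_K_eq pairing_eq_dot contract_star_wdg dot_commute[of v] dot_commute[of m])
next
  fix l assume "l \<in> {l. dot v l = 0 \<and> dot m l = 0}"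
  then have l: "contract (wdg v m) l = 0" by (simp add: contract_wdg)
  have "dot l u = 0" if "contract (star (wdg v m)) u = 0" for u
  proof -
    have "dot u l *s wdg v m = 0" using koszul[of u l "wdg v m"] that l by simp
    then show ?thesis using assms by (simp add: dot_commute)
  qed
  then show "l \<in> annihilator (taut_K (star (wdg v m)))"
    by (simp add: annihilator_def taut_K_eq pairing_eq_dot)
qed

text \<open>
  The projection of the quotient to its trivial summand is one linear form \<open>l\<close>, the same for all
  points, that vanishes on the fibres of the subbundle.
\<close>

lemma quotient_iso_split_functional:
  assumes "quotient_iso_split N 0 d"
  shows "\<exists>l. l \<noteq> 0 \<and> (\<forall>s t. (s, t) \<noteq> (0, 0) \<longrightarrow> N s t \<subseteq> {v. dot l v = 0})"
proof -
  obtain \<alpha> \<beta> where \<alpha>: "\<alpha> \<in> homs 0" and *: "\<And>s t. (s, t) \<noteq> (0, 0) \<Longrightarrow>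
      surj (\<lambda>v. (dot (hom_eval 0 \<alpha> s t) v, dot (hom_eval d \<beta> s t) v)) \<and>
      {v. dot (hom_eval 0 \<alpha> s t) v = 0 \<and> dot (hom_eval d \<beta> s t) v = 0} = N s t"
    using assms unfolding quotient_iso_split_def pairing_eq_dot Let_def by auto
  define l where "l = at_point \<alpha> 0"
  have ev: "hom_eval 0 \<alpha> s t = l" if "(s, t) \<noteq> (0, 0)" for s t
    unfolding l_def using hom_eval_0[OF \<alpha> that] .
  have "l \<noteq> 0"
  proof
    assume "l = 0"
    then have "surj (\<lambda>v. (0 :: complex, dot (hom_eval d \<beta> 0 1) v))" using *[of 0 1] ev[of 0 1] by simp
    then obtain v where "(1 :: complex, 0 :: complex) = (0, dot (hom_eval d \<beta> 0 1) v)" by (metis surjD)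
    then show False by simp
  qed
  moreover have "N s t \<subseteq> {v. dot l v = 0}" if "(s, t) \<noteq> (0, 0)" for s t
    using *[OF that] ev[OF that] by blast
  ultimately show ?thesis by blast
qed

lemma quotient_iso_splitI:
  assumes "\<gamma> \<in> homs d"
    and "\<And>s t. (s, t) \<noteq> (0, 0) \<Longrightarrow> wdg l (hom_eval d \<gamma> s t) \<noteq> 0 \<and>
      N s t = {v. dot l v = 0 \<and> dot (hom_eval d \<gamma> s t) v = 0}"
  shows "quotient_iso_split N 0 d"
  unfolding quotient_iso_split_def pairing_eq_dot Let_def
proof (rule bexI[OF _ homs_const[of l]], rule bexI[OF _ assms(1)], intro allI impI)
  fix s t :: complex assume st: "(s, t) \<noteq> (0, 0)"
  have e: "hom_eval 0 (const_vec l) s t = l" using hom_eval_0[OF homs_const st] by simp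
  show "surj (\<lambda>v. (dot (hom_eval 0 (const_vec l) s t) v, dot (hom_eval d \<gamma> s t) v)) \<and>
       {v. (dot (hom_eval 0 (const_vec l) s t) v, dot (hom_eval d \<gamma> s t) v) = (0, 0)} = N s t"
    unfolding e using surj_dot_pair assms(2)[OF st] by simp
qed

text \<open>
  The splitting type \<open>O \<oplus> O(d)\<close> of \<open>f\<^sup>*Q\<close> means that all lines of the family lie in the plane \<open>l = 0\<close>,
  i.e. that \<open>\<psi>\<close> has the constant factor \<open>l\<close>. Conversely the two factors of \<open>\<psi> = l \<and> \<gamma>\<close>
  define the quotient.
\<close>

lemma quotient_split_taut_K_iff:
  assumes "\<psi> \<in> homs d" "basefree d \<psi>" "quad \<psi> = 0"
  shows "quotient_iso_split (\<lambda>s t. taut_K (hom_eval d \<psi> s t)) 0 d \<longleftrightarrow>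
    (\<exists>l. l \<noteq> 0 \<and> contract (star \<psi>) (const_vec l) = 0)"
proof
  assume "quotient_iso_split (\<lambda>s t. taut_K (hom_eval d \<psi> s t)) 0 d"
  then obtain l where l: "l \<noteq> 0"
      "\<And>s t. (s, t) \<noteq> (0, 0) \<Longrightarrow> taut_K (hom_eval d \<psi> s t) \<subseteq> {v. dot l v = 0}"
    using quotient_iso_split_functional by blast
  have "contract (star (at_point \<psi> x)) l = 0" for x
  proof (rule ccontr)
    assume "contract (star (at_point \<psi> x)) l \<noteq> 0"
    then obtain w where w: "dot (contract (star (at_point \<psi> x)) l) w \<noteq> 0" using ex_dot_nonzero by blast
    \<comment> \<open>On the quadric, \<open>contract (star \<eta>)\<close> takes values in the kernel of \<open>\<eta>\<close>.\<close>
    have "quad (at_point \<psi> x) = 0" using assms(3) quad_zero_iff_points by blast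
    then have "contract (star (at_point \<psi> x)) w \<in> taut_K (hom_eval d \<psi> x 1)"
      using hom_eval_finite[OF assms(1), of 1 x] by (simp add: taut_K_eq contract_contract_star)
    then have "dot l (contract (star (at_point \<psi> x)) w) = 0" using l(2)[of x 1] by auto
    then show False using w dot_contract_skew[of "star (at_point \<psi> x)" l w] by (simp add: dot_commute)
  qed
  then show "\<exists>l. l \<noteq> 0 \<and> contract (star \<psi>) (const_vec l) = 0"
    using l(1) contract_star_const_points by blast
next
  assume "\<exists>l. l \<noteq> 0 \<and> contract (star \<psi>) (const_vec l) = 0"
  then obtain l \<gamma> where l: "l \<noteq> 0" "\<gamma> \<in> homs d" "\<psi> = wdg (const_vec l) \<gamma>"
    using wedge_const_form assms(1) by metis
  show "quotient_iso_split (\<lambda>s t. taut_K (hom_eval d \<psi> s t)) 0 d"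
  proof (rule quotient_iso_splitI[OF l(2)])
    fix s t :: complex assume st: "(s, t) \<noteq> (0, 0)"
    have h: "hom_eval d \<psi> s t = wdg l (hom_eval d \<gamma> s t)" unfolding l(3) by (rule hom_eval_wdg_const[OF l(2)])
    then have n: "wdg l (hom_eval d \<gamma> s t) \<noteq> 0" using basefree_hom_eval[OF assms(1,2) st] by simp
    then show "wdg l (hom_eval d \<gamma> s t) \<noteq> 0 \<and>
        taut_K (hom_eval d \<psi> s t) = {v. dot l v = 0 \<and> dot (hom_eval d \<gamma> s t) v = 0}"
      unfolding h taut_K_eq contract_wdg_eq_0_iff[OF n] by simp
  qed
qed

text \<open>
  The dual case: all lines of the family pass through the point \<open>l\<close>, which is a constant factor of
  \<open>star \<psi>\<close>.
\<close>

lemma quotient_split_annihilator_iff: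
  assumes "\<psi> \<in> homs d" "basefree d \<psi>" "quad \<psi> = 0"
  shows "quotient_iso_split (\<lambda>s t. annihilator (taut_K (hom_eval d \<psi> s t))) 0 d \<longleftrightarrow>
    (\<exists>l. l \<noteq> 0 \<and> contract \<psi> (const_vec l) = 0)"
proof
  assume "quotient_iso_split (\<lambda>s t. annihilator (taut_K (hom_eval d \<psi> s t))) 0 d"
  then obtain l where l: "l \<noteq> 0"
      "\<And>s t. (s, t) \<noteq> (0, 0) \<Longrightarrow> annihilator (taut_K (hom_eval d \<psi> s t)) \<subseteq> {v. dot l v = 0}"
    using quotient_iso_split_functional by blast
  have "contract (at_point \<psi> x) l = 0" for x
  proof (rule ccontr)
    assume "contract (at_point \<psi> x) l \<noteq> 0"
    then obtain w where w: "dot (contract (at_point \<psi> x) l) w \<noteq> 0" using ex_dot_nonzero by blast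
    have "dot (contract (at_point \<psi> x) w) u = 0" if "contract (at_point \<psi> x) u = 0" for u
      using that dot_contract_skew[of "at_point \<psi> x" w u] by simp
    then have "contract (at_point \<psi> x) w \<in> annihilator (taut_K (hom_eval d \<psi> x 1))"
      using hom_eval_finite[OF assms(1), of 1 x] by (simp add: taut_K_eq annihilator_def pairing_eq_dot)
    then have "dot l (contract (at_point \<psi> x) w) = 0" using l(2)[of x 1] by auto
    then show False using w dot_contract_skew[of "at_point \<psi> x" l w] by (simp add: dot_commute)
  qed
  then show "\<exists>l. l \<noteq> 0 \<and> contract \<psi> (const_vec l) = 0"
    using l(1) contract_const_points by blast
next
  assume "\<exists>l. l \<noteq> 0 \<and> contract \<psi> (const_vec l) = 0"
  then obtain l where l1: "l \<noteq> 0" "contract (star (star \<psi>)) (const_vec l) = 0" by auto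
  obtain \<gamma> where l: "\<gamma> \<in> homs d" "star \<psi> = wdg (const_vec l) \<gamma>"
    using wedge_const_form[OF l1 homs_star[OF assms(1)]] by blast
  show "quotient_iso_split (\<lambda>s t. annihilator (taut_K (hom_eval d \<psi> s t))) 0 d"
  proof (rule quotient_iso_splitI[OF l(1)])
    fix s t :: complex assume st: "(s, t) \<noteq> (0, 0)"
    have "star (hom_eval d \<psi> s t) = wdg l (hom_eval d \<gamma> s t)"
      unfolding hom_eval_star[OF assms(1), symmetric] l(2) by (rule hom_eval_wdg_const[OF l(1)])
    then have h: "hom_eval d \<psi> s t = star (wdg l (hom_eval d \<gamma> s t))" by (metis star_star)
    then have n: "wdg l (hom_eval d \<gamma> s t) \<noteq> 0" using basefree_hom_eval[OF assms(1,2) st] by auto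
    then show "wdg l (hom_eval d \<gamma> s t) \<noteq> 0 \<and>
        annihilator (taut_K (hom_eval d \<psi> s t)) = {v. dot l v = 0 \<and> dot (hom_eval d \<gamma> s t) v = 0}"
      unfolding h annihilator_taut_K[OF n] by simp
  qed
qed

lemma R0_eq:
  "R0 d = {pt (hom_coords \<psi>) | \<psi>. \<psi> \<in> homs d \<and> basefree d \<psi> \<and> quad \<psi> = 0 \<and>
             (\<exists>l. l \<noteq> 0 \<and> contract (star \<psi>) (const_vec l) = 0)}"
  unfolding R0_def Mor_iff using quotient_split_taut_K_iff by blast

lemma R0'_eq:
  "R0' d = {pt (hom_coords \<psi>) | \<psi>. \<psi> \<in> homs d \<and> basefree d \<psi> \<and> quad \<psi> = 0 \<and>
             (\<exists>l. l \<noteq> 0 \<and> contract \<psi> (const_vec l) = 0)}"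
  unfolding R0'_def Mor_iff using quotient_split_annihilator_iff by blast

section \<open>Closed conditions on tuples of forms\<close>

lemma supported_hom_coords: "supported (hom_index n) (hom_coords \<psi>) \<longleftrightarrow> \<psi> \<in> homs n"
proof
  assume "supported (hom_index n) (hom_coords \<psi>)"
  then have "coeff (\<psi> $ k) i = 0" if "n < i" for k i
    using that by (auto simp: supported_def hom_index_def hom_coords_def)
  then show "\<psi> \<in> homs n" unfolding homs_iff by (meson degree_le)
next
  assume "\<psi> \<in> homs n"
  then show "supported (hom_index n) (hom_coords \<psi>)"
    by (auto simp: supported_def hom_index_def hom_coords_def homs_iff intro!: coeff_eq_0 intro: le_less_trans)
qed

lemma hom_coords_inj: "hom_coords \<psi> = hom_coords \<phi> \<longleftrightarrow> \<psi> = \<phi>"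
proof
  assume "hom_coords \<psi> = hom_coords \<phi>"
  then have "coeff (\<psi> $ k) i = coeff (\<phi> $ k) i" for k i by (metis case_prod_conv hom_coords_def)
  then show "\<psi> = \<phi>" by (simp add: vec_eq_iff poly_eq_iff)
qed simp

lemma hom_coords_zero_iff: "hom_coords \<psi> = (\<lambda>_. 0) \<longleftrightarrow> \<psi> = 0"
  using hom_coords_inj[of \<psi> 0] by (simp add: hom_coords_def fun_eq_iff case_prod_beta)

lemma hom_coords_scale: "hom_coords ([:c:] *s \<psi>) = (\<lambda>i. c * hom_coords \<psi> i)"
  by (auto simp: hom_coords_def fun_eq_iff)

lemma hom_coords_line: "hom_coords (\<psi> + [:c:] *s \<phi>) = (\<lambda>i. hom_coords \<psi> i + c * hom_coords \<phi> i)"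
  by (auto simp: hom_coords_def fun_eq_iff)

lemma hom_coords_surj:
  fixes u :: "'k::finite \<times> nat \<Rightarrow> complex"
  assumes "supported (hom_index n) u"
  shows "\<exists>\<psi>\<in>homs n. u = hom_coords \<psi>"
proof -
  define \<psi> :: "complex poly ^ 'k" where "\<psi> = (\<chi> k. \<Sum>i\<le>n. monom (u (k, i)) i)"
  have "u (k, i) = coeff (\<psi> $ k) i" for k i
    using assms by (auto simp: \<psi>_def coeff_sum supported_def hom_index_def if_distrib cong: if_cong)
  then have "u = hom_coords \<psi>" by (auto simp: hom_coords_def fun_eq_iff)
  moreover from this have "\<psi> \<in> homs n" using assms supported_hom_coords by metis
  ultimately show ?thesis by blast
qed

lemma pt_hom_coords_eq_iff:
  "pt (hom_coords \<psi>) = pt (hom_coords \<phi>) \<longleftrightarrow> (\<exists>c. c \<noteq> 0 \<and> \<phi> = [:c:] *s \<psi>)"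
  unfolding pt_eq_iff hom_coords_scale[symmetric] hom_coords_inj ..

lemma pt_hom_coords_proj_space: "pt (hom_coords \<psi>) \<in> proj_space (hom_index n) \<longleftrightarrow> \<psi> \<noteq> 0 \<and> \<psi> \<in> homs n"
  by (simp add: pt_mem_proj_space supported_hom_coords hom_coords_zero_iff)

text \<open>
  Closed conditions on the coordinates of a tuple, stated for the tuple itself. Coordinate vectors
  supported in \<open>hom_index d\<close> correspond bijectively to tuples of degree at most \<open>d\<close>.
\<close>

definition closed_hom :: "nat \<Rightarrow> (complex poly ^ 'k::finite \<Rightarrow> bool) \<Rightarrow> bool" where
  "closed_hom d P \<longleftrightarrow> closed_cond (hom_index d) (\<lambda>u. \<exists>\<psi>. u = hom_coords \<psi> \<and> P \<psi>)"

lemma closed_homI: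
  fixes P :: "complex poly ^ 'k::finite \<Rightarrow> bool"
  assumes "\<And>\<psi>. \<psi> \<in> homs d \<Longrightarrow> \<not> P \<psi> \<Longrightarrow>
    \<exists>n f. homog_poly n f \<and> f (hom_coords \<psi>) \<noteq> 0 \<and> (\<forall>\<phi>. \<phi> \<in> homs d \<and> P \<phi> \<longrightarrow> f (hom_coords \<phi>) = 0)"
  shows "closed_hom d P"
  unfolding closed_hom_def closed_cond_def
proof (intro allI impI, elim conjE)
  fix u :: "'k \<times> nat \<Rightarrow> complex"
  assume u: "supported (hom_index d) u" "\<not> (\<exists>\<psi>. u = hom_coords \<psi> \<and> P \<psi>)"
  obtain \<psi> where \<psi>: "\<psi> \<in> homs d" "u = hom_coords \<psi>" using hom_coords_surj[OF u(1)] by blast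
  then have "\<not> P \<psi>" using u(2) by blast
  from assms[OF \<psi>(1) this]
  obtain n f where f: "homog_poly n f" "f (hom_coords \<psi>) \<noteq> 0"
     "\<forall>\<phi>. \<phi> \<in> homs d \<and> P \<phi> \<longrightarrow> f (hom_coords \<phi>) = 0" by (elim exE conjE)
  then show "\<exists>n f. homog_poly n f \<and> f u \<noteq> 0 \<and>
      (\<forall>w. supported (hom_index d) w \<and> (\<exists>\<psi>. w = hom_coords \<psi> \<and> P \<psi>) \<longrightarrow> f w = 0)"
    using \<psi> by (intro exI[of _ n] exI[of _ f]) (auto simp: supported_hom_coords)
qed

lemma closed_homD:
  assumes "closed_hom d P" "\<psi> \<in> homs d" "\<not> P \<psi>"
  shows "\<exists>n f. homog_poly n f \<and> f (hom_coords \<psi>) \<noteq> 0 \<and> (\<forall>\<phi>. \<phi> \<in> homs d \<and> P \<phi> \<longrightarrow> f (hom_coords \<phi>) = 0)"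
proof -
  have "supported (hom_index d) (hom_coords \<psi>) \<and> \<not> (\<exists>\<psi>'. hom_coords \<psi> = hom_coords \<psi>' \<and> P \<psi>')"
    using assms(2,3) by (simp add: supported_hom_coords hom_coords_inj)
  from assms(1)[unfolded closed_hom_def closed_cond_def, rule_format, OF this]
  obtain n f where f: "homog_poly n f" "f (hom_coords \<psi>) \<noteq> 0"
    "\<forall>w. supported (hom_index d) w \<and> (\<exists>\<psi>. w = hom_coords \<psi> \<and> P \<psi>) \<longrightarrow> f w = 0"
    by (elim exE conjE)
  have "f (hom_coords \<phi>) = 0" if "\<phi> \<in> homs d" "P \<phi>" for \<phi>
    using f(3)[rule_format, of "hom_coords \<phi>"] that by (auto simp: supported_hom_coords hom_coords_inj)
  then show ?thesis using f(1,2) by (intro exI[of _ n] exI[of _ f]) simp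
qed

lemma closed_hom_cong:
  assumes "\<And>\<psi>. \<psi> \<in> homs d \<Longrightarrow> P \<psi> \<longleftrightarrow> Q \<psi>" "closed_hom d Q"
  shows "closed_hom d P"
proof (rule closed_homI)
  fix \<psi> assume "\<psi> \<in> homs d" "\<not> P \<psi>"
  then have "\<not> Q \<psi>" using assms(1) by blast
  from closed_homD[OF assms(2) \<open>\<psi> \<in> homs d\<close> this]
  obtain n f where "homog_poly n f" "f (hom_coords \<psi>) \<noteq> 0"
      "\<forall>\<phi>. \<phi> \<in> homs d \<and> Q \<phi> \<longrightarrow> f (hom_coords \<phi>) = 0" by (elim exE conjE)
  then show "\<exists>n f. homog_poly n f \<and> f (hom_coords \<psi>) \<noteq> 0 \<and>
      (\<forall>\<phi>. \<phi> \<in> homs d \<and> P \<phi> \<longrightarrow> f (hom_coords \<phi>) = 0)"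
    using assms(1) by (intro exI[of _ n] exI[of _ f]) auto
qed

lemma closed_hom_line:
  assumes "closed_hom d P" "\<psi> \<in> homs d" "\<phi> \<in> homs d" "\<not> P (\<psi> + [:\<epsilon>0:] *s \<phi>)"
  shows "finite {\<epsilon>. P (\<psi> + [:\<epsilon>:] *s \<phi>)}"
proof -
  let ?P = "\<lambda>u. \<exists>\<psi>. u = hom_coords \<psi> \<and> P \<psi>"
  have eq: "?P (\<lambda>i. hom_coords \<psi> i + \<epsilon> * hom_coords \<phi> i) \<longleftrightarrow> P (\<psi> + [:\<epsilon>:] *s \<phi>)" for \<epsilon>
    unfolding hom_coords_line[symmetric] by (auto simp: hom_coords_inj)
  have s: "supported (hom_index d) (hom_coords \<psi>)" "supported (hom_index d) (hom_coords \<phi>)"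
    using assms(2,3) by (simp_all add: supported_hom_coords)
  have n: "\<not> ?P (\<lambda>i. hom_coords \<psi> i + \<epsilon>0 * hom_coords \<phi> i)" unfolding eq by (rule assms(4))
  show ?thesis
    using closed_cond_line[OF assms(1)[unfolded closed_hom_def] s n] unfolding eq .
qed

lemma closed_hom_set:
  assumes "closed_hom d P"
  shows "zariski_closed (hom_index d) {pt (hom_coords \<psi>) | \<psi>. \<psi> \<in> homs d \<and> \<psi> \<noteq> 0 \<and> P \<psi>}"
proof -
  have "{pt (hom_coords \<psi>) | \<psi>. \<psi> \<in> homs d \<and> \<psi> \<noteq> 0 \<and> P \<psi>} =
      {pt u | u. u \<noteq> (\<lambda>_. 0) \<and> supported (hom_index d) u \<and> (\<exists>\<psi>. u = hom_coords \<psi> \<and> P \<psi>)}"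
  proof (intro set_eqI iffI)
    fix p assume "p \<in> {pt (hom_coords \<psi>) | \<psi>. \<psi> \<in> homs d \<and> \<psi> \<noteq> 0 \<and> P \<psi>}"
    then obtain \<psi> where "p = pt (hom_coords \<psi>)" "\<psi> \<in> homs d" "\<psi> \<noteq> 0" "P \<psi>" by (elim CollectE exE conjE)
    then show "p \<in> {pt u | u. u \<noteq> (\<lambda>_. 0) \<and> supported (hom_index d) u \<and> (\<exists>\<psi>. u = hom_coords \<psi> \<and> P \<psi>)}"
      by (intro CollectI exI[of _ "hom_coords \<psi>"]) (auto simp: supported_hom_coords hom_coords_zero_iff)
  next
    fix p assume "p \<in> {pt u | u. u \<noteq> (\<lambda>_. 0) \<and> supported (hom_index d) u \<and> (\<exists>\<psi>. u = hom_coords \<psi> \<and> P \<psi>)}"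
    then obtain \<psi> where "p = pt (hom_coords \<psi>)" "hom_coords \<psi> \<noteq> (\<lambda>_. 0)" "supported (hom_index d) (hom_coords \<psi>)" "P \<psi>"
      by (elim CollectE exE conjE) simp
    then show "p \<in> {pt (hom_coords \<psi>) | \<psi>. \<psi> \<in> homs d \<and> \<psi> \<noteq> 0 \<and> P \<psi>}"
      by (intro CollectI exI[of _ "\<psi>"]) (auto simp: supported_hom_coords hom_coords_zero_iff)
  qed
  then show ?thesis using closed_cond_closed[OF assms[unfolded closed_hom_def]] by (simp only:)
qed

lemma closure_line_hom:
  assumes "\<psi> \<in> homs d" "\<psi> \<noteq> 0" "infinite {\<epsilon>. pt (hom_coords (\<psi> + [:\<epsilon>:] *s \<phi>)) \<in> A}"
  shows "pt (hom_coords \<psi>) \<in> zariski_closure (hom_index d) A"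
  using assms by (intro closure_line[of _ _ "hom_coords \<phi>"])
    (simp_all add: pt_hom_coords_proj_space hom_coords_line)

lemma homog_at_point: "homog_poly 1 (\<lambda>u. \<Sum>i\<le>d. x ^ i * u (k, i))"
  by (intro homog_sum homog_cmult homog_poly.coord)

lemma at_point_coords:
  "\<psi> \<in> homs d \<Longrightarrow> (\<Sum>i\<le>d. x ^ i * hom_coords \<psi> (k, i)) = at_point \<psi> x $ k"
  unfolding at_point_def hom_coords_def
  by (simp add: poly_altdef homs_iff mult.commute) (intro sum.mono_neutral_right, auto simp: coeff_eq_0)

lemma homog_polar:
  "homog_poly 2 (\<lambda>u. polar (\<chi> k. \<Sum>i\<le>d. x ^ i * u (k, i)) (\<chi> k. \<Sum>i\<le>d. y ^ i * u (k, i)))"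
  unfolding polar_def vec_lambda_beta
  by (intro homog_diff homog_poly.add homog_mult'[OF homog_at_point homog_at_point]) auto

lemma homog_polar_value:
  assumes "\<psi> \<in> homs d"
  shows "polar (\<chi> k. \<Sum>i\<le>d. x ^ i * hom_coords \<psi> (k, i)) (\<chi> k. \<Sum>i\<le>d. y ^ i * hom_coords \<psi> (k, i)) =
    polar (at_point \<psi> x) (at_point \<psi> y)"
  using assms by (simp add: at_point_coords)

lemma closed_hom_isotropic: "closed_hom d isotropic_span"
proof (rule closed_homI)
  fix \<psi> :: "complex poly ^ 6" assume \<psi>: "\<psi> \<in> homs d" "\<not> isotropic_span \<psi>"
  then obtain x y where xy: "polar (at_point \<psi> x) (at_point \<psi> y) \<noteq> 0" by (auto simp: isotropic_span_def)
  let ?f = "\<lambda>u. polar (\<chi> k. \<Sum>i\<le>d. x ^ i * u (k, i)) (\<chi> k. \<Sum>i\<le>d. y ^ i * u (k, i))"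
  show "\<exists>n f. homog_poly n f \<and> f (hom_coords \<psi>) \<noteq> 0 \<and>
      (\<forall>\<phi>. \<phi> \<in> homs d \<and> isotropic_span \<phi> \<longrightarrow> f (hom_coords \<phi>) = 0)"
    using xy \<psi>(1) homog_polar[of x d y]
    by (intro exI[of _ 2] exI[of _ ?f]) (auto simp: homog_polar_value isotropic_span_def)
qed

lemma closed_hom_quad: "closed_hom d (\<lambda>\<psi>. quad \<psi> = 0)"
proof (rule closed_homI)
  fix \<psi> :: "complex poly ^ 6" assume \<psi>: "\<psi> \<in> homs d" "quad \<psi> \<noteq> 0"
  then obtain x where x: "quad (at_point \<psi> x) \<noteq> 0" using quad_zero_iff_points by blast
  let ?f = "\<lambda>u. polar (\<chi> k. \<Sum>i\<le>d. x ^ i * u (k, i)) (\<chi> k. \<Sum>i\<le>d. x ^ i * u (k, i))"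
  have "?f (hom_coords \<phi>) = 2 * quad (at_point \<phi> x)" if "\<phi> \<in> homs d" for \<phi>
    unfolding homog_polar_value[OF that] by (rule polar_self)
  then show "\<exists>n f. homog_poly n f \<and> f (hom_coords \<psi>) \<noteq> 0 \<and>
      (\<forall>\<phi>. \<phi> \<in> homs d \<and> quad \<phi> = 0 \<longrightarrow> f (hom_coords \<phi>) = 0)"
    using x \<psi>(1) homog_polar[of x d x]
    by (intro exI[of _ 2] exI[of _ ?f]) (simp add: quad_zero_iff_points)
qed

lemma coeff_mult_bounded:
  assumes "degree p \<le> m"
  shows "coeff (p * r :: complex poly) n = (\<Sum>i\<le>m. if i \<le> n then coeff p i * coeff r (n - i) else 0)"
proof -
  have "coeff (p * r) n = (\<Sum>i\<in>{..m} \<inter> {..n}. coeff p i * coeff r (n - i))"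
    unfolding coeff_mult using assms by (intro sum.mono_neutral_right) (auto simp: coeff_eq_0)
  also have "\<dots> = (\<Sum>i\<le>m. if i \<le> n then coeff p i * coeff r (n - i) else 0)"
    by (subst sum.inter_restrict) simp_all
  finally show ?thesis .
qed

text \<open>
  The linear equations \<open>\<zeta>\<^sub>k \<phi>\<^sub>l = \<zeta>\<^sub>l \<phi>\<^sub>k\<close> in the coefficients of \<open>\<zeta>\<close>, one for each \<open>k\<close>, \<open>l\<close> and each
  power \<open>n\<close> of the variable. The parameter \<open>u\<close> is the coordinate vector of \<open>\<phi>\<close>.
\<close>

definition parallel_system :: "'k \<times> 'k \<times> nat \<Rightarrow> 'k \<times> nat \<Rightarrow> ('k \<times> nat \<Rightarrow> complex) \<Rightarrow> complex" where
  "parallel_system = (\<lambda>(k, l, n) (j, i) u.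
     (if j = k \<and> i \<le> n then u (l, n - i) else 0) - (if j = l \<and> i \<le> n then u (k, n - i) else 0))"

lemma homog_parallel_system: "homog_poly 1 (parallel_system r v)"
proof -
  obtain k l n j i where rv: "r = (k, l, n)" "v = (j, i)" by (metis prod_cases3 surj_pair)
  show ?thesis unfolding rv parallel_system_def case_prod_conv
    by (intro homog_diff homog_if homog_zero homog_poly.coord)
qed

lemma parallel_system_sum:
  fixes \<zeta> :: "complex poly ^ 'k::finite"
  assumes "\<zeta> \<in> homs m"
  shows "(\<Sum>v\<in>hom_index m. parallel_system (k, l, n) v (hom_coords \<phi>) * hom_coords \<zeta> v) =
     coeff (\<zeta> $ k * \<phi> $ l - \<zeta> $ l * \<phi> $ k) n"
proof -
  have one: "(\<Sum>j\<in>UNIV. \<Sum>i\<le>m. (if j = a \<and> i \<le> n then coeff (\<phi> $ b) (n - i) else 0) * coeff (\<zeta> $ j) i) =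
      coeff (\<zeta> $ a * \<phi> $ b) n" for a b :: 'k
  proof -
    have "(\<Sum>j\<in>UNIV. \<Sum>i\<le>m. (if j = a \<and> i \<le> n then coeff (\<phi> $ b) (n - i) else 0) * coeff (\<zeta> $ j) i) =
      (\<Sum>j\<in>UNIV. if j = a then (\<Sum>i\<le>m. (if i \<le> n then coeff (\<zeta> $ a) i * coeff (\<phi> $ b) (n - i) else 0)) else 0)"
      by (intro sum.cong refl) (auto intro!: sum.cong sum.neutral)
    also have "\<dots> = coeff (\<zeta> $ a * \<phi> $ b) n"
      using assms by (simp add: coeff_mult_bounded[of _ m] homs_iff)
    finally show ?thesis .
  qed
  show ?thesis
    unfolding hom_index_def sum.cartesian_product' parallel_system_def
    by (simp add: hom_coords_def left_diff_distrib sum_subtractf one cong: if_cong)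
qed

lemma solves_parallel_system:
  assumes "\<zeta> \<in> homs m"
  shows "solves (hom_index m) parallel_system (hom_coords \<phi>) (hom_coords \<zeta>) \<longleftrightarrow> parallel \<zeta> \<phi>"
proof -
  have "solves (hom_index m) parallel_system (hom_coords \<phi>) (hom_coords \<zeta>) \<longleftrightarrow>
      (\<forall>k l n. coeff (\<zeta> $ k * \<phi> $ l - \<zeta> $ l * \<phi> $ k) n = 0)"
    unfolding solves_def by (simp add: split_paired_all parallel_system_sum[OF assms])
  also have "\<dots> \<longleftrightarrow> parallel \<zeta> \<phi>" by (auto simp: parallel_def poly_eq_iff)
  finally show ?thesis .
qed

text \<open>
  Elimination theory for common factors: \<open>has_parallel m \<phi>\<close> says that the tuple \<open>\<phi>\<close> has the same
  direction as a tuple of degree \<open>m\<close>, i.e. that after removal of the base points its degree is at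
  most \<open>m\<close>. It asks for a nonzero solution of a linear system, so it is closed.
\<close>

definition has_parallel :: "nat \<Rightarrow> complex poly ^ 'k::finite \<Rightarrow> bool" where
  "has_parallel m \<phi> \<longleftrightarrow> (\<exists>\<zeta>\<in>homs m. \<zeta> \<noteq> 0 \<and> parallel \<zeta> \<phi>)"

lemma finite_hom_index: "finite (hom_index m :: ('k::finite \<times> nat) set)"
  by (simp add: hom_index_def)

lemma solves_restrict: "solves I A v (\<lambda>u. if u \<in> I then x u else 0) \<longleftrightarrow> solves I A v x"
  unfolding solves_def by (intro all_cong1 arg_cong[of _ _ "\<lambda>s. s = 0"] sum.cong) auto

lemma closed_hom_has_parallel: "closed_hom d (has_parallel m :: complex poly ^ 'k::finite \<Rightarrow> bool)"
proof (rule closed_homI)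
  fix \<psi> :: "complex poly ^ 'k" assume \<psi>: "\<psi> \<in> homs d" "\<not> has_parallel m \<psi>"
  let ?I = "hom_index m :: ('k \<times> nat) set"
  have ker: "\<forall>u\<in>?I. x u = 0" if x: "solves ?I parallel_system (hom_coords \<psi>) x" for x
  proof -
    let ?x = "\<lambda>u. if u \<in> ?I then x u else 0"
    have "supported ?I ?x" by (simp add: supported_def)
    then obtain \<phi> where \<phi>: "\<phi> \<in> homs m" "?x = hom_coords \<phi>" using hom_coords_surj by blast
    have "solves ?I parallel_system (hom_coords \<psi>) (hom_coords \<phi>)"
      unfolding \<phi>(2)[symmetric] solves_restrict by (rule x)
    then have "\<phi> = 0" using \<psi>(2) \<phi>(1) by (auto simp: solves_parallel_system has_parallel_def)
    then have z: "?x = (\<lambda>_. 0)" unfolding \<phi>(2) by (simp add: hom_coords_zero_iff)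
    show ?thesis
    proof
      fix u assume "u \<in> ?I"
      then show "x u = 0" using fun_cong[OF z, of u] by simp
    qed
  qed
  have "\<exists>n f. homog_poly n f \<and> f (hom_coords \<psi>) \<noteq> 0 \<and>
      (\<forall>v x. solves ?I parallel_system v x \<and> (\<exists>u\<in>?I. x u \<noteq> 0) \<longrightarrow> f v = 0)"
    by (rule elimination_closed[OF finite_hom_index homog_parallel_system]) (rule ker)
  then obtain n f where f: "homog_poly n f" "f (hom_coords \<psi>) \<noteq> 0"
      "\<forall>v x. solves ?I parallel_system v x \<and> (\<exists>u\<in>?I. x u \<noteq> 0) \<longrightarrow> f v = 0"
    by (elim exE conjE)
  have "f (hom_coords \<phi>) = 0" if hp: "has_parallel m \<phi>" for \<phi>
  proof -
    obtain \<zeta> where \<zeta>: "\<zeta> \<in> homs m" "\<zeta> \<noteq> 0" "parallel \<zeta> \<phi>" using hp by (auto simp: has_parallel_def)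
    then have "\<exists>u. hom_coords \<zeta> u \<noteq> 0" using hom_coords_zero_iff[of \<zeta>] unfolding fun_eq_iff by blast
    then obtain u where u: "hom_coords \<zeta> u \<noteq> 0" by blast
    have "supported ?I (hom_coords \<zeta>)" using \<zeta>(1) by (simp add: supported_hom_coords)
    then have "u \<in> ?I" using u unfolding supported_def by blast
    moreover have "solves ?I parallel_system (hom_coords \<phi>) (hom_coords \<zeta>)"
      using solves_parallel_system[OF \<zeta>(1)] \<zeta>(3) by blast
    ultimately show ?thesis using f(3)[rule_format, of "hom_coords \<phi>" "hom_coords \<zeta>"] u by blast
  qed
  then show "\<exists>n f. homog_poly n f \<and> f (hom_coords \<psi>) \<noteq> 0 \<and>
      (\<forall>\<phi>. \<phi> \<in> homs d \<and> has_parallel m \<phi> \<longrightarrow> f (hom_coords \<phi>) = 0)"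
    using f by (intro exI[of _ n] exI[of _ f]) simp
qed

lemma has_parallel_iff:
  assumes "basefree e \<psi>" "\<psi> \<in> homs e" "\<xi> \<noteq> 0"
  shows "has_parallel m (\<xi> *s \<psi>) \<longleftrightarrow> e \<le> m"
proof
  assume "has_parallel m (\<xi> *s \<psi>)"
  then obtain \<zeta> where \<zeta>: "\<zeta> \<in> homs m" "\<zeta> \<noteq> 0" "parallel \<zeta> (\<xi> *s \<psi>)" by (auto simp: has_parallel_def)
  then have "parallel \<zeta> \<psi>"
    using assms(3) by (simp add: parallel_def mult.left_commute)
  then show "e \<le> m" using parallel_basefree[OF assms(1,2) _ \<zeta>(1,2)] by auto
next
  assume "e \<le> m"
  then have "\<psi> \<in> homs m" using assms(2) homs_mono by blast
  moreover have "parallel \<psi> (\<xi> *s \<psi>)" by (simp add: parallel_def ac_simps)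
  ultimately show "has_parallel m (\<xi> *s \<psi>)"
    unfolding has_parallel_def using basefree_nonzero[OF assms(1)] by blast
qed

lemma basefree_scale: "c \<noteq> 0 \<Longrightarrow> basefree e \<psi> \<Longrightarrow> basefree e ([:c:] *s \<psi>)"
  by (simp add: basefree_def)

text \<open>
  When nothing is left to be divided out, the factor is a constant.
\<close>

lemma factor_top:
  assumes "\<xi> \<noteq> 0" "degree \<xi> \<le> d - e" "basefree e \<psi>" "e = d"
  shows "\<exists>c. c \<noteq> 0 \<and> \<xi> = [:c:] \<and> basefree d (\<xi> *s \<psi>)"
proof -
  have "degree \<xi> = 0" using assms by simp
  then obtain c where "\<xi> = [:c:]" by (metis degree_eq_zeroE)
  then show ?thesis using assms basefree_scale[of c d \<psi>] by auto
qed

text \<open>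
  A base point lowers the degree of the base-point-free part by at least one. Freeness of base points
  is thus an open condition.
\<close>

lemma basefree_iff_parallel:
  assumes "\<phi> \<in> homs d" "1 \<le> d"
  shows "basefree d \<phi> \<longleftrightarrow> \<not> has_parallel (d - 1) \<phi>"
proof (cases "\<phi> = 0")
  case True
  have "parallel (const_vec (axis undefined 1)) \<phi>" by (simp add: parallel_def True)
  moreover have "const_vec (axis undefined 1) \<noteq> (0 :: complex poly ^ 'a)"
    by (auto simp: const_vec_def vec_eq_iff axis_def)
  ultimately show ?thesis using True basefree_nonzero homs_const unfolding has_parallel_def by blast
next
  case False
  then obtain e \<xi> \<psi> where *: "e \<le> d" "\<xi> \<noteq> 0" "degree \<xi> \<le> d - e" "\<psi> \<in> homs e" "basefree e \<psi>" "\<phi> = \<xi> *s \<psi>"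
    using factor_basefree[OF False assms(1)] by blast
  show ?thesis
  proof
    assume "basefree d \<phi>"
    then show "\<not> has_parallel (d - 1) \<phi>" using has_parallel_iff[of d \<phi> 1 "d - 1"] assms by auto
  next
    assume "\<not> has_parallel (d - 1) \<phi>"
    then have "e = d" using has_parallel_iff[OF *(5,4,2), of "d - 1"] *(1,6) by simp
    then show "basefree d \<phi>" using factor_top *(2,3,5,6) by blast
  qed
qed

lemma closed_hom_not_basefree:
  assumes "1 \<le> d"
  shows "closed_hom d (\<lambda>\<phi> :: complex poly ^ 'k::finite. \<not> basefree d \<phi>)"
  by (rule closed_hom_cong[OF _ closed_hom_has_parallel[of d "d - 1"]]) (use basefree_iff_parallel[OF _ assms] in blast)

lemma basefree_line:
  assumes "1 \<le> d" "\<psi> \<in> homs d" "\<phi> \<in> homs d" "basefree d (\<psi> + [:\<epsilon>0:] *s \<phi>)"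
  shows "finite {\<epsilon>. \<not> basefree d (\<psi> + [:\<epsilon>:] *s \<phi>)}"
  using closed_hom_line[OF closed_hom_not_basefree[OF assms(1)] assms(2,3), of \<epsilon>0] assms(4) by simp

lemma isotropic_line:
  assumes "\<psi> \<in> homs d" "\<phi> \<in> homs d" "\<not> isotropic_span (\<psi> + [:\<epsilon>0:] *s \<phi>)"
  shows "finite {\<epsilon>. isotropic_span (\<psi> + [:\<epsilon>:] *s \<phi>)}"
  using closed_hom_line[OF closed_hom_isotropic assms] .

section \<open>Deforming an isotropic tuple to a morphism\<close>

lemma scale_inverse: "c \<noteq> 0 \<Longrightarrow> [:1 / c:] *s ([:c:] *s \<psi>) = (\<psi> :: complex poly ^ 'k)"
  by (simp add: vec_eq_iff)

lemma quad_mult: "quad \<psi> = 0 \<Longrightarrow> quad (p *s \<psi>) = 0"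
  by (simp add: quad_scale)

lemma isotropic_span_mult: "isotropic_span \<psi> \<Longrightarrow> isotropic_span (p *s \<psi>)"
proof -
  have "polar (a *s \<eta>) (b *s \<zeta>) = a * b * polar \<eta> \<zeta>" for a b :: complex and \<eta> \<zeta>
    by (simp add: polar_def algebra_simps)
  then show "isotropic_span \<psi> \<Longrightarrow> isotropic_span (p *s \<psi>)" by (simp add: isotropic_span_def)
qed

lemma R_iff:
  "pt (hom_coords \<phi>) \<in> R d \<longleftrightarrow> \<phi> \<in> homs d \<and> basefree d \<phi> \<and> quad \<phi> = 0 \<and> \<not> isotropic_span \<phi>"
proof
  assume "pt (hom_coords \<phi>) \<in> R d"
  then obtain \<psi> where \<psi>: "\<psi> \<in> homs d" "basefree d \<psi>" "quad \<psi> = 0" "\<not> isotropic_span \<psi>"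
      "pt (hom_coords \<psi>) = pt (hom_coords \<phi>)" unfolding R_eq by auto
  then obtain c where c: "c \<noteq> 0" "\<phi> = [:c:] *s \<psi>" using pt_hom_coords_eq_iff by blast
  moreover have "\<not> isotropic_span \<phi>"
    using isotropic_span_mult[of \<phi> "[:1 / c:]"] \<psi>(4) scale_inverse[OF c(1), of \<psi>] c(2) by auto
  ultimately show "\<phi> \<in> homs d \<and> basefree d \<phi> \<and> quad \<phi> = 0 \<and> \<not> isotropic_span \<phi>"
    using \<psi> homs_scale quad_mult basefree_scale by blast
qed (auto simp: R_eq)

text \<open>
  A point of the moment curve off finitely many hyperplanes.
\<close>

lemma ex_vector_avoiding:
  fixes S :: "(complex ^ 4) set"
  assumes "finite S" "0 \<notin> S"
  shows "\<exists>v. \<forall>w\<in>S. dot v w \<noteq> 0"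
proof -
  define p where "p w = [:w $ 1, w $ 2, w $ 3, w $ 4:]" for w :: "complex ^ 4"
  have "finite {z. poly (p w) z = 0}" if "w \<in> S" for w
  proof -
    have "w \<noteq> 0" using that assms(2) by auto
    then have "p w \<noteq> 0" by (auto simp: p_def vec_eq_iff forall_4)
    then show ?thesis by (rule poly_roots_finite)
  qed
  then have "finite (\<Union>w\<in>S. {z. poly (p w) z = 0})" using assms(1) by blast
  then obtain z where "z \<notin> (\<Union>w\<in>S. {z. poly (p w) z = 0})"
    using ex_new_if_finite[OF infinite_UNIV_char_0[where 'a = complex]] by blast
  then have z: "poly (p w) z \<noteq> 0" if "w \<in> S" for w using that by blast
  have "dot (vector [1, z, z ^ 2, z ^ 3]) w = poly (p w) z" for w
    by (simp add: p_def dot_def sum_4 algebra_simps power2_eq_square power3_eq_cube)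
  then show ?thesis using z by metis
qed

text \<open>
  Geometrically, a general line in three-space misses the curve traced by \<open>\<beta>\<close>. Two linear forms
  \<open>v1\<close>, \<open>v2\<close> without a common zero on the curve cut out such a line, and \<open>\<gamma> = k + x\<^sup>a l\<close> takes
  nonzero values in it, for a basis \<open>k\<close>, \<open>l\<close>. Its values are thus never proportional to those of \<open>\<beta>\<close>.
\<close>

lemma ex_basefree_wedge:
  assumes "\<beta> \<in> homs b" "basefree b \<beta>"
  shows "\<exists>\<gamma>\<in>homs a. basefree (b + a) (wdg \<beta> \<gamma>)"
proof -
  have top: "coeff_vec \<beta> b \<noteq> 0" and pts: "\<And>x. at_point \<beta> x \<noteq> 0" using assms(2) by (auto simp: basefree_def)
  obtain v1 where v1: "dot v1 (coeff_vec \<beta> b) \<noteq> 0" using ex_dot_nonzero[OF top] by (auto simp: dot_commute)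
  define p where "p = dot (const_vec v1) \<beta>"
  have "coeff p b = dot v1 (coeff_vec \<beta> b)"
    by (simp add: p_def dot_def const_vec_def coeff_vec_def coeff_sum)
  then have "p \<noteq> 0" using v1 by auto
  have px: "poly p x = dot v1 (at_point \<beta> x)" for x
    by (simp add: p_def dot_def const_vec_def at_point_def poly_sum mult.commute)
  \<comment> \<open>The vector \<open>n\<close> makes \<open>v2\<close> independent of \<open>v1\<close>: it is killed by \<open>v1\<close>, but not by \<open>v2\<close>.\<close>
  obtain n where n: "n \<noteq> 0" "dot v1 n = 0"
  proof (cases "v1 $ 1 = 0 \<and> v1 $ 2 = 0")
    case True
    show ?thesis by (rule that[of "vector [1, 0, 0, 0]"]) (use True in \<open>auto simp: ext_simps\<close>)
  next
    case False
    show ?thesis by (rule that[of "vector [- v1 $ 2, v1 $ 1, 0, 0]"]) (use False in \<open>auto simp: ext_simps\<close>)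
  qed
  define S where "S = insert n (at_point \<beta> ` {x. poly p x = 0})"
  have S1: "finite S" unfolding S_def using poly_roots_finite[OF \<open>p \<noteq> 0\<close>] by simp
  have S2: "0 \<notin> S"
  proof
    assume "0 \<in> S"
    then obtain x where "0 = at_point \<beta> x" using n(1) unfolding S_def by blast
    then show False using pts[of x] by simp
  qed
  from ex_vector_avoiding[OF S1 S2] obtain v2 where v2: "\<forall>w\<in>S. dot v2 w \<noteq> 0" by (elim exE)
  have cover: "dot v1 (at_point \<beta> x) \<noteq> 0 \<or> dot v2 (at_point \<beta> x) \<noteq> 0" for x
    using v2 px by (auto simp: S_def)
  have "v1 \<noteq> 0" using v1 by auto
  have w: "wdg v1 v2 \<noteq> 0"
  proof
    assume "wdg v1 v2 = 0"
    then obtain c where "v2 = c *s v1" using wdg_eq_0_iff[OF \<open>v1 \<noteq> 0\<close>] by blast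
    then have "dot v2 n = 0" using n(2) by (simp add: dot_scale dot_commute[of _ n])
    then show False using v2 by (simp add: S_def)
  qed
  obtain k l where kl: "star (wdg v1 v2) = wdg k l"
    using quad_zero_decomposable[of "star (wdg v1 v2)"] w by auto
  then have kl0: "wdg k l \<noteq> 0" using w by (metis star_eq_0_iff)
  have z: "dot k v1 = 0" "dot l v1 = 0" "dot k v2 = 0" "dot l v2 = 0"
    using contract_star_wdg[of v1 v2] contract_wdg_eq_0_iff[OF kl0] unfolding kl by auto
  have indep: "a *s k + c *s l \<noteq> 0" if "a \<noteq> 0 \<or> c \<noteq> 0" for a c
  proof
    assume 0: "a *s k + c *s l = 0"
    have "wdg k (a *s k + c *s l) = c *s wdg k l" "wdg l (a *s k + c *s l) = - a *s wdg k l"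
      by (simp_all add: ext_simps algebra_simps)
    then show False using kl0 that unfolding 0 by auto
  qed
  have ok: "wdg u (a *s k + c *s l) \<noteq> 0" if u: "dot v1 u \<noteq> 0 \<or> dot v2 u \<noteq> 0" and ac: "a \<noteq> 0 \<or> c \<noteq> 0" for u a c
  proof
    let ?g = "a *s k + c *s l"
    assume "wdg u ?g = 0"
    then have "wdg ?g u = 0" by (simp add: wdg_skew[of ?g u])
    then obtain e where e: "u = e *s ?g" using wdg_eq_0_iff[OF indep[OF ac]] by blast
    have "dot v (a *s k + c *s l) = a * dot k v + c * dot l v" for v
      by (simp add: dot_def sum_4 algebra_simps)
    then have "dot v1 u = 0" "dot v2 u = 0" unfolding e dot_scale using z by simp_all
    then show False using u by simp
  qed
  define \<gamma> where "\<gamma> = const_vec k + monom 1 a *s const_vec l"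
  have \<gamma>: "\<gamma> \<in> homs a" unfolding \<gamma>_def
    using homs_mult[OF homs_const[of l 0], of "monom 1 a" a] by (intro homs_add homs_const) (simp add: degree_monom_le)
  have at: "at_point \<gamma> x = 1 *s k + (x ^ a) *s l" for x by (simp add: \<gamma>_def poly_monom)
  have cv: "\<exists>e. coeff_vec \<gamma> a = e *s k + 1 *s l"
  proof (cases "a = 0")
    case True
    then have "coeff_vec \<gamma> a = 1 *s k + 1 *s l"
      by (simp add: \<gamma>_def coeff_vec_def const_vec_def vec_eq_iff coeff_mult)
    then show ?thesis by blast
  next
    case False
    then have "coeff_vec \<gamma> a = 0 *s k + 1 *s l"
      by (cases a) (simp_all add: \<gamma>_def coeff_vec_def const_vec_def vec_eq_iff)
    then show ?thesis by blast
  qed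
  have "at_point (wdg \<beta> \<gamma>) x \<noteq> 0" for x
    unfolding at_point_wdg at by (rule ok[OF cover]) simp
  moreover have "coeff_vec (wdg \<beta> \<gamma>) (b + a) \<noteq> 0"
  proof -
    obtain e where e: "coeff_vec \<gamma> a = e *s k + 1 *s l" using cv by blast
    show ?thesis unfolding coeff_vec_wdg[OF assms(1) \<gamma>] e by (rule ok) (use v1 in auto)
  qed
  ultimately have "basefree (b + a) (wdg \<beta> \<gamma>)" by (simp add: basefree_def)
  then show ?thesis using \<gamma> by blast
qed

text \<open>
  A curve of positive degree without base points is not constant: its entries would be multiples
  of one polynomial of degree \<open>b\<close>, and a root of that polynomial would be a base point.
\<close>

lemma ex_independent_values:
  fixes \<beta> :: "complex poly ^ 4"
  assumes "\<beta> \<in> homs b" "basefree b \<beta>" "1 \<le> b"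
  shows "\<exists>x y. wdg (at_point \<beta> x) (at_point \<beta> y) \<noteq> 0"
proof (rule ccontr)
  assume dep: "\<not> ?thesis"
  define c where "c = at_point \<beta> 0"
  have "c \<noteq> 0" using assms(2) by (simp add: c_def basefree_def)
  have mult: "\<exists>e. at_point \<beta> y = e *s c" for y
    using dep wdg_eq_0_iff[OF \<open>c \<noteq> 0\<close>] unfolding c_def by blast
  obtain i where i: "c $ i \<noteq> 0" using \<open>c \<noteq> 0\<close> by (auto simp: vec_eq_iff)
  obtain k where k: "coeff (\<beta> $ k) b \<noteq> 0" using assms(2) by (auto simp: basefree_def coeff_vec_def vec_eq_iff)
  have "smult (c $ i) (\<beta> $ k) = smult (c $ k) (\<beta> $ i)"
  proof (rule poly_eqI_points)
    fix x
    obtain e where "at_point \<beta> x = e *s c" using mult by blast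
    then have "poly (\<beta> $ j) x = e * c $ j" for j by (simp add: at_point_def vec_eq_iff)
    then show "poly (smult (c $ i) (\<beta> $ k)) x = poly (smult (c $ k) (\<beta> $ i)) x" by simp
  qed
  then have "c $ i * coeff (\<beta> $ k) b = c $ k * coeff (\<beta> $ i) b" by (metis coeff_smult)
  then have "coeff (\<beta> $ i) b \<noteq> 0" using i k by auto
  then have "degree (\<beta> $ i) \<noteq> 0" using assms(3) le_degree[of "\<beta> $ i" b] by auto
  then obtain x where x: "poly (\<beta> $ i) x = 0" by (metis fundamental_theorem_of_algebra constant_degree)
  obtain e where e: "at_point \<beta> x = e *s c" using mult by blast
  then have "e * c $ i = 0" using x by (simp add: at_point_def vec_eq_iff)
  then have "at_point \<beta> x = 0" using e i by simp
  then show False using assms(2) by (simp add: basefree_def)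
qed

lemma polar_nondegenerate:
  fixes \<zeta> :: "complex ^ 6"
  assumes "\<zeta> \<noteq> 0"
  shows "\<exists>p r. polar \<zeta> (wdg p r) \<noteq> 0"
proof -
  obtain p where "contract (star \<zeta>) p \<noteq> 0" using ex_contract_nonzero[of "star \<zeta>"] assms by auto
  then obtain r where r: "dot (contract (star \<zeta>) p) r \<noteq> 0" using ex_dot_nonzero by blast
  have "dot (star \<zeta>) \<eta> = polar \<zeta> \<eta>" for \<eta> by (simp add: ext_simps algebra_simps)
  then show ?thesis using r unfolding dot_contract by metis
qed

text \<open>
  Choose two points where \<open>\<beta>\<close> takes independent values, and let \<open>\<gamma>\<close> interpolate at these points
  values that complete them to a basis.
\<close>

lemma ex_not_isotropic_wedge:
  assumes "\<beta> \<in> homs b" "basefree b \<beta>" "1 \<le> b" "1 \<le> a"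
  shows "\<exists>\<gamma>\<in>homs a. \<not> isotropic_span (wdg \<beta> \<gamma>)"
proof -
  obtain x y where xy: "wdg (at_point \<beta> x) (at_point \<beta> y) \<noteq> 0"
    using ex_independent_values[OF assms(1-3)] by blast
  then have "x \<noteq> y" by auto
  obtain p r where pr: "polar (wdg (at_point \<beta> x) (at_point \<beta> y)) (wdg p r) \<noteq> 0"
    using polar_nondegenerate[OF xy] by blast
  define \<gamma> where "\<gamma> = [:- y, 1:] *s const_vec p + [:- x, 1:] *s const_vec r"
  have "\<gamma> \<in> homs (1 + 0)" unfolding \<gamma>_def by (intro homs_add homs_mult homs_const) simp_all
  then have \<gamma>: "\<gamma> \<in> homs a" using homs_mono assms(4) by (metis add.right_neutral)
  have at: "at_point \<gamma> x = (x - y) *s p" "at_point \<gamma> y = (y - x) *s r" by (simp_all add: \<gamma>_def)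
  have sc: "polar (s *s \<eta>) (t *s \<zeta>) = s * t * polar \<eta> \<zeta>" for s t :: complex and \<eta> \<zeta>
    by (simp add: polar_def algebra_simps)
  have "polar (at_point (wdg \<beta> \<gamma>) x) (at_point (wdg \<beta> \<gamma>) y) =
      (x - y) * (y - x) * polar (wdg (at_point \<beta> x) p) (wdg (at_point \<beta> y) r)"
    by (simp only: at_point_wdg at wdg_scale sc)
  also have "\<dots> \<noteq> 0" using pr \<open>x \<noteq> y\<close> polar_wdg_wdg[of "at_point \<beta> x" p "at_point \<beta> y" r] by simp
  finally show ?thesis using \<gamma> unfolding isotropic_span_def by blast
qed

lemma infinite_if_cofinite: "finite {\<epsilon>::complex. \<not> P \<epsilon>} \<Longrightarrow> infinite {\<epsilon>. P \<epsilon>}"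
proof
  assume "finite {\<epsilon>::complex. \<not> P \<epsilon>}" "finite {\<epsilon>. P \<epsilon>}"
  then have "finite ({\<epsilon>. \<not> P \<epsilon>} \<union> {\<epsilon>. P \<epsilon>})" by blast
  moreover have "{\<epsilon>. \<not> P \<epsilon>} \<union> {\<epsilon>. P \<epsilon>} = UNIV" by blast
  ultimately show False using infinite_UNIV_char_0[where 'a = complex] by simp
qed

lemma ex_if_cofinite: "finite {\<epsilon>::complex. \<not> P \<epsilon>} \<Longrightarrow> \<exists>\<epsilon>. P \<epsilon>"
proof -
  assume "finite {\<epsilon>::complex. \<not> P \<epsilon>}"
  then have "{\<epsilon>. P \<epsilon>} \<noteq> {}" using infinite_if_cofinite infinite_imp_nonempty by blast
  then show ?thesis by blast
qed

lemma finite_not_conj: "finite {\<epsilon>::complex. \<not> P \<epsilon>} \<Longrightarrow> finite {\<epsilon>. \<not> Q \<epsilon>} \<Longrightarrow> finite {\<epsilon>. \<not> (P \<epsilon> \<and> Q \<epsilon>)}"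
  by (rule finite_subset[of _ "{\<epsilon>. \<not> P \<epsilon>} \<union> {\<epsilon>. \<not> Q \<epsilon>}"]) auto

lemma wdg_line: "wdg \<beta> \<gamma> + [:\<epsilon>:] *s wdg \<beta> \<delta> = wdg \<beta> (\<gamma> + [:\<epsilon>:] *s \<delta>)"
  by (simp add: wdg_linear)

lemma line_end: "\<gamma> + [:1:] *s (\<gamma>' - \<gamma>) = (\<gamma>' :: complex poly ^ 'k)"
  by (simp add: vec_eq_iff one_pCons[symmetric])

lemma line_start: "\<gamma> + [:0:] *s \<delta> = (\<gamma> :: complex poly ^ 'k)"
  by (simp add: vec_eq_iff)

lemma wdg_homs: "\<beta> \<in> homs b \<Longrightarrow> \<gamma> \<in> homs a \<Longrightarrow> b + a = d \<Longrightarrow> wdg \<beta> \<gamma> \<in> homs d"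
  using homs_wdg by blast

lemma wdg_const_homs: "\<gamma> \<in> homs d \<Longrightarrow> wdg (const_vec l) \<gamma> \<in> homs d"
  using homs_wdg[OF homs_const[of l 0]] by simp

text \<open>
  Both freeness of base points and the condition \<open>G\<close> hold for almost all members of a line that
  has one such member. A line through a base-point-free member and a member with \<open>G\<close> contains
  a member \<open>\<gamma>3\<close> with both, and the line from \<open>\<gamma>\<close> to \<open>\<gamma>3\<close> is the required one.
\<close>

lemma generic_direction:
  assumes "\<beta> \<in> homs b" "basefree b \<beta>" "\<gamma> \<in> homs a" "b + a = d" "1 \<le> d"
    and G_open: "\<And>\<gamma> \<delta> \<epsilon>0. \<gamma> \<in> homs a \<Longrightarrow> \<delta> \<in> homs a \<Longrightarrow> G (\<gamma> + [:\<epsilon>0:] *s \<delta>) \<Longrightarrow>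
      finite {\<epsilon>. \<not> G (\<gamma> + [:\<epsilon>:] *s \<delta>)}"
    and G_ex: "\<gamma>2 \<in> homs a" "G \<gamma>2"
  shows "\<exists>\<delta>\<in>homs a. infinite {\<epsilon>. basefree d (wdg \<beta> (\<gamma> + [:\<epsilon>:] *s \<delta>)) \<and> G (\<gamma> + [:\<epsilon>:] *s \<delta>)}"
proof -
  have h: "wdg \<beta> \<delta> \<in> homs d" if "\<delta> \<in> homs a" for \<delta> using wdg_homs[OF assms(1) that assms(4)] .
  have both: "finite {\<epsilon>. \<not> (basefree d (wdg \<beta> (\<gamma> + [:\<epsilon>:] *s \<delta>)) \<and> G (\<gamma> + [:\<epsilon>:] *s \<delta>))}"
    if \<gamma>\<delta>: "\<gamma> \<in> homs a" "\<delta> \<in> homs a"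
      and bf: "basefree d (wdg \<beta> (\<gamma> + [:\<epsilon>1:] *s \<delta>))" and G: "G (\<gamma> + [:\<epsilon>2:] *s \<delta>)" for \<gamma> \<delta> \<epsilon>1 \<epsilon>2
    using basefree_line[OF assms(5) h[OF \<gamma>\<delta>(1)] h[OF \<gamma>\<delta>(2)], of \<epsilon>1] bf G_open[OF \<gamma>\<delta> G]
    unfolding wdg_line by (intro finite_not_conj)
  obtain \<gamma>1 where \<gamma>1: "\<gamma>1 \<in> homs a" "basefree d (wdg \<beta> \<gamma>1)"
    using ex_basefree_wedge[OF assms(1,2), of a] assms(4) by auto
  have d1: "\<gamma>2 - \<gamma>1 \<in> homs a" by (intro homs_diff G_ex(1) \<gamma>1(1))
  have "finite {\<epsilon>. \<not> (basefree d (wdg \<beta> (\<gamma>1 + [:\<epsilon>:] *s (\<gamma>2 - \<gamma>1))) \<and> G (\<gamma>1 + [:\<epsilon>:] *s (\<gamma>2 - \<gamma>1)))}"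
    by (rule both[OF \<gamma>1(1) d1, of 0 1]) (simp_all only: line_start line_end \<gamma>1(2) G_ex(2))
  from ex_if_cofinite[OF this] obtain \<epsilon>1 where
    "basefree d (wdg \<beta> (\<gamma>1 + [:\<epsilon>1:] *s (\<gamma>2 - \<gamma>1)))" "G (\<gamma>1 + [:\<epsilon>1:] *s (\<gamma>2 - \<gamma>1))"
    by blast
  then obtain \<gamma>3 where \<gamma>3: "\<gamma>3 \<in> homs a" "basefree d (wdg \<beta> \<gamma>3)" "G \<gamma>3"
    using homs_add[OF \<gamma>1(1) homs_scale[OF d1]] by blast
  have d3: "\<gamma>3 - \<gamma> \<in> homs a" by (intro homs_diff \<gamma>3(1) assms(3))
  have "finite {\<epsilon>. \<not> (basefree d (wdg \<beta> (\<gamma> + [:\<epsilon>:] *s (\<gamma>3 - \<gamma>))) \<and> G (\<gamma> + [:\<epsilon>:] *s (\<gamma>3 - \<gamma>)))}"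
    by (rule both[OF assms(3) d3, of 1 1]) (simp_all only: line_end \<gamma>3(2,3))
  from infinite_if_cofinite[OF this] show ?thesis using d3 by (intro bexI)
qed

text \<open>
  For \<open>b \<ge> 1\<close> the second factor can be moved so that base points disappear and the image leaves all
  isotropic planes.
\<close>

lemma wedge_in_closure_R:
  assumes "\<beta> \<in> homs b" "basefree b \<beta>" "\<gamma> \<in> homs a" "1 \<le> b" "1 \<le> a" "b + a = d" "wdg \<beta> \<gamma> \<noteq> 0"
  shows "pt (hom_coords (wdg \<beta> \<gamma>)) \<in> zariski_closure (hom_index d) (R d)"
proof -
  have d: "1 \<le> d" using assms by simp
  have h: "wdg \<beta> \<delta> \<in> homs d" if "\<delta> \<in> homs a" for \<delta> using wdg_homs[OF assms(1) that assms(6)] .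
  obtain \<gamma>2 where \<gamma>2: "\<gamma>2 \<in> homs a" "\<not> isotropic_span (wdg \<beta> \<gamma>2)"
    using ex_not_isotropic_wedge[OF assms(1,2,4,5)] by blast
  have "\<exists>\<delta>\<in>homs a. infinite {\<epsilon>. basefree d (wdg \<beta> (\<gamma> + [:\<epsilon>:] *s \<delta>)) \<and>
      \<not> isotropic_span (wdg \<beta> (\<gamma> + [:\<epsilon>:] *s \<delta>))}"
  proof (rule generic_direction[OF assms(1-3,6) d, where G = "\<lambda>\<gamma>. \<not> isotropic_span (wdg \<beta> \<gamma>)"])
    fix \<gamma> \<delta> \<epsilon>0
    assume "\<gamma> \<in> homs a" "\<delta> \<in> homs a" "\<not> isotropic_span (wdg \<beta> (\<gamma> + [:\<epsilon>0:] *s \<delta>))"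
    then show "finite {\<epsilon>. \<not> \<not> isotropic_span (wdg \<beta> (\<gamma> + [:\<epsilon>:] *s \<delta>))}"
      using isotropic_line[OF h h, of \<gamma> \<delta> \<epsilon>0] unfolding wdg_line not_not by blast
  qed (rule \<gamma>2)+
  then obtain \<delta> where \<delta>: "\<delta> \<in> homs a"
    "infinite {\<epsilon>. basefree d (wdg \<beta> (\<gamma> + [:\<epsilon>:] *s \<delta>)) \<and> \<not> isotropic_span (wdg \<beta> (\<gamma> + [:\<epsilon>:] *s \<delta>))}"
    by (elim bexE)
  have "pt (hom_coords (wdg \<beta> \<gamma> + [:\<epsilon>:] *s wdg \<beta> \<delta>)) \<in> R d \<longleftrightarrow>
      basefree d (wdg \<beta> (\<gamma> + [:\<epsilon>:] *s \<delta>)) \<and> \<not> isotropic_span (wdg \<beta> (\<gamma> + [:\<epsilon>:] *s \<delta>))" for \<epsilon>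
    unfolding R_iff wdg_line using h[OF homs_add[OF assms(3) homs_scale[OF \<delta>(1)]]] by simp
  then have "infinite {\<epsilon>. pt (hom_coords (wdg \<beta> \<gamma> + [:\<epsilon>:] *s wdg \<beta> \<delta>)) \<in> R d}" using \<delta>(2) by simp
  then show ?thesis by (rule closure_line_hom[OF h[OF assms(3)] assms(7)])
qed

lemma coeff_polar_const: "coeff (polar (const_vec v) \<phi>) j = polar v (coeff_vec \<phi> j)"
  by (simp add: polar_def const_vec_def coeff_vec_def mult.commute)

text \<open>
  The polar form of \<open>\<phi>(x)\<close> and \<open>\<phi>(y)\<close> is a polynomial in \<open>x\<close> and \<open>y\<close>, so that its coefficients
  vanish with its values. Applied to the first and the last coefficient, this compares the values at
  zero and at infinity.
\<close>

lemma isotropic_span_coeffs: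
  assumes "isotropic_span \<phi>"
  shows "polar (coeff_vec \<phi> i) (coeff_vec \<phi> j) = 0"
proof -
  have a: "polar (at_point \<phi> y) (coeff_vec \<phi> j) = 0" for y
  proof -
    have "polar (const_vec (at_point \<phi> y)) \<phi> = 0"
      by (rule poly_eqI_points) (use assms in \<open>simp add: isotropic_span_def\<close>)
    then show ?thesis using coeff_polar_const[of "at_point \<phi> y" \<phi> j] by simp
  qed
  have "polar (const_vec (coeff_vec \<phi> j)) \<phi> = 0"
    by (rule poly_eqI_points) (use a in \<open>simp add: polar_commute[of "coeff_vec \<phi> j"]\<close>)
  then show ?thesis using coeff_polar_const[of "coeff_vec \<phi> j" \<phi> i] by (simp add: polar_commute)
qed

lemma coeff_vec_wdg_const: "coeff_vec (wdg (const_vec l) \<gamma>) i = wdg l (coeff_vec \<gamma> i)"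
  by (simp add: coeff_vec_def const_vec_def ext_simps mult.commute)

lemma basefree_const: "l \<noteq> 0 \<Longrightarrow> basefree 0 (const_vec l)"
proof -
  have "coeff_vec (const_vec l) 0 = l" by (simp add: coeff_vec_def const_vec_def)
  then show "l \<noteq> 0 \<Longrightarrow> basefree 0 (const_vec l)" by (simp add: basefree_def)
qed

lemma at_point_0: "at_point \<gamma> 0 = coeff_vec \<gamma> 0"
  by (simp add: at_point_def coeff_vec_def poly_0_coeff_0)

text \<open>
  With a constant factor \<open>l\<close> every \<open>l \<and> \<gamma>\<close> spans an isotropic subspace, so the splitting type
  has to change. Write \<open>\<gamma> = k + x \<delta>\<close>. For \<open>\<epsilon> \<noteq> 0\<close>, the tuple \<open>l \<and> \<gamma> + \<epsilon> k \<and> \<delta>\<close> is a scalar multiple of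
  \<open>(x l + \<epsilon> k) \<and> (l - \<epsilon> \<delta>)\<close>, with factors of degrees \<open>1\<close> and \<open>d - 1\<close>. The polar form of its values at
  \<open>0\<close> and at infinity is \<open>\<epsilon>\<close> times the determinant of \<open>\<gamma>\<^sub>0, \<gamma>\<^sub>1, l, \<gamma>\<^sub>d\<close>, which is the last hypothesis.
\<close>

lemma deform_off_plane:
  assumes "l \<noteq> 0" "\<gamma> \<in> homs d" "2 \<le> d" "basefree d (wdg (const_vec l) \<gamma>)"
    and det: "polar (wdg (coeff_vec \<gamma> 0) (coeff_vec \<gamma> 1)) (wdg l (coeff_vec \<gamma> d)) \<noteq> 0"
  shows "pt (hom_coords (wdg (const_vec l) \<gamma>)) \<in> zariski_closure (hom_index d) (R d)"
proof -
  have "at_point (\<gamma> - const_vec (coeff_vec \<gamma> 0)) 0 = 0"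
    by (simp only: at_point_simps at_point_0[of \<gamma>] diff_self)
  moreover have "\<gamma> - const_vec (coeff_vec \<gamma> 0) \<noteq> 0"
  proof
    assume "\<gamma> - const_vec (coeff_vec \<gamma> 0) = 0"
    then have "coeff_vec (\<gamma> - const_vec (coeff_vec \<gamma> 0)) 1 = 0" by simp
    moreover have "coeff_vec (const_vec (coeff_vec \<gamma> 0)) 1 = 0" by (simp add: coeff_vec_def const_vec_def vec_eq_iff)
    ultimately have "coeff_vec \<gamma> 1 = 0" by simp
    then show False using det by (simp add: polar_def)
  qed
  moreover have "\<gamma> - const_vec (coeff_vec \<gamma> 0) \<in> homs d" by (intro homs_diff assms(2) homs_const)
  ultimately obtain \<delta> where \<delta>0: "\<gamma> - const_vec (coeff_vec \<gamma> 0) = [:- 0, 1:] *s \<delta>" "\<delta> \<in> homs (d - 1)"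
    using divide_root by blast
  let ?k = "coeff_vec \<gamma> 0"
  have \<gamma>: "\<gamma> = const_vec ?k + [:0, 1:] *s \<delta>" using \<delta>0(1) by (simp add: diff_eq_eq add.commute)
  define \<zeta> where "\<zeta> = wdg (const_vec ?k) \<delta>"
  have h: "wdg (const_vec l) \<gamma> \<in> homs d" by (rule wdg_const_homs[OF assms(2)])
  have h': "\<zeta> \<in> homs d" unfolding \<zeta>_def
    using wdg_const_homs[OF homs_mono[OF \<delta>0(2)]] assms(3) by simp
  let ?l = "\<lambda>\<epsilon>. wdg (const_vec l) \<gamma> + [:\<epsilon>:] *s \<zeta>"
  have q0: "quad (?l \<epsilon>) = 0" for \<epsilon>
  proof -
    have "polar (wdg a (k + x *s m)) (e *s wdg k m) = 0" for a k m :: "complex poly ^ 4" and x e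
      by (simp add: ext_simps algebra_simps)
    then have "polar (wdg (const_vec l) \<gamma>) ([:\<epsilon>:] *s \<zeta>) = 0" unfolding \<zeta>_def by (subst \<gamma>)
    then show ?thesis by (simp add: quad_add quad_scale \<zeta>_def del: mult_pCons_left)
  qed
  have c\<delta>: "coeff_vec \<delta> 0 = coeff_vec \<gamma> 1"
  proof -
    have "coeff_vec \<gamma> 1 = coeff_vec (const_vec ?k) 1 + coeff_vec ([:0, 1:] *s \<delta>) 1" by (subst \<gamma>) simp
    then show ?thesis by (simp add: coeff_vec_def const_vec_def vec_eq_iff)
  qed
  have d\<delta>: "coeff_vec \<delta> d = 0"
  proof -
    have "degree (\<delta> $ k) < d" for k using \<delta>0(2)[unfolded homs_iff, rule_format, of k] assms(3) by linarith
    then show ?thesis by (simp add: coeff_vec_def vec_eq_iff coeff_eq_0)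
  qed
  have nI: "\<not> isotropic_span (?l \<epsilon>)" if "\<epsilon> \<noteq> 0" for \<epsilon>
  proof
    assume "isotropic_span (?l \<epsilon>)"
    then have "polar (coeff_vec (?l \<epsilon>) 0) (coeff_vec (?l \<epsilon>) d) = 0" by (rule isotropic_span_coeffs)
    moreover have "coeff_vec (?l \<epsilon>) 0 = wdg l ?k + \<epsilon> *s wdg ?k (coeff_vec \<gamma> 1)"
      by (simp add: \<zeta>_def coeff_vec_wdg_const c\<delta>)
    moreover have "coeff_vec (?l \<epsilon>) d = wdg l (coeff_vec \<gamma> d)"
      by (simp add: \<zeta>_def coeff_vec_wdg_const d\<delta>)
    moreover have "polar (wdg l ?k + \<epsilon> *s \<eta>) (wdg l m) = \<epsilon> * polar \<eta> (wdg l m)" for \<eta> m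
      by (simp add: ext_simps algebra_simps)
    ultimately show False using det that by simp
  qed
  have f1: "finite {\<epsilon>. \<not> basefree d (?l \<epsilon>)}"
    using assms(3) by (intro basefree_line[OF _ h h', of 0]) (simp_all add: line_start assms(4))
  have "{\<epsilon>. \<not> \<epsilon> \<noteq> 0} = {0 :: complex}" by auto
  then have f2: "finite {\<epsilon> :: complex. \<not> \<epsilon> \<noteq> 0}" by simp
  have "{\<epsilon>. basefree d (?l \<epsilon>) \<and> \<epsilon> \<noteq> 0} \<subseteq> {\<epsilon>. pt (hom_coords (?l \<epsilon>)) \<in> R d}"
    using R_iff q0 nI homs_add[OF h homs_scale[OF h']] by blast
  then have "infinite {\<epsilon>. pt (hom_coords (?l \<epsilon>)) \<in> R d}"
    using infinite_if_cofinite[OF finite_not_conj[OF f1 f2]] infinite_super by blast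
  then show ?thesis by (rule closure_line_hom[OF h basefree_nonzero[OF assms(4)]])
qed

text \<open>
  The conditions needed by the previous deformation hold for almost all \<open>\<gamma>\<close>, since they are open and
  each of them holds for some \<open>\<gamma>\<close>. Hence the closure is reached in two steps.
\<close>

lemma wedge_const_in_closure_R:
  assumes "l \<noteq> 0" "\<gamma> \<in> homs d" "2 \<le> d" "wdg (const_vec l) \<gamma> \<noteq> 0"
  shows "pt (hom_coords (wdg (const_vec l) \<gamma>)) \<in> zariski_closure (hom_index d) (R d)"
proof -
  define D where "D \<gamma> = polar (wdg (coeff_vec \<gamma> 0) (coeff_vec \<gamma> 1)) (wdg l (coeff_vec \<gamma> d))" for \<gamma> :: "complex poly ^ 4"
  define A where "A = {pt (hom_coords (wdg (const_vec l) \<gamma>)) | \<gamma>. \<gamma> \<in> homs d \<and> basefree d (wdg (const_vec l) \<gamma>) \<and> D \<gamma> \<noteq> 0}"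
  have A: "A \<subseteq> zariski_closure (hom_index d) (R d)"
    unfolding A_def D_def using deform_off_plane[OF assms(1) _ assms(3)] by blast
  have D_line: "finite {\<epsilon>. \<not> D (\<gamma> + [:\<epsilon>:] *s \<delta>) \<noteq> 0}" if "D (\<gamma> + [:\<epsilon>0:] *s \<delta>) \<noteq> 0" for \<gamma> \<delta> \<epsilon>0
  proof -
    \<comment> \<open>The determinant along the line is the value of one polynomial in \<open>\<epsilon>\<close>, written as the same expression in polynomial vectors.\<close>
    define c where "c i = const_vec (coeff_vec \<gamma> i) + [:0, 1:] *s const_vec (coeff_vec \<delta> i)" for i
    define P where "P = polar (wdg (c 0) (c 1)) (wdg (const_vec l) (c d))"
    have P: "poly P \<epsilon> = D (\<gamma> + [:\<epsilon>:] *s \<delta>)" for \<epsilon> by (simp add: P_def D_def c_def)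
    then have "P \<noteq> 0" using that by auto
    then show ?thesis using poly_roots_finite[of P] unfolding P by simp
  qed
  obtain \<gamma>2 where \<gamma>2: "\<gamma>2 \<in> homs d" "D \<gamma>2 \<noteq> 0"
  proof -
    obtain m where m: "wdg l m \<noteq> 0"
    proof -
      obtain i where i: "l $ i \<noteq> 0" using assms(1) by (auto simp: vec_eq_iff)
      obtain j :: 4 where j: "j \<noteq> i" by (metis (full_types) zero_neq_one)
      have "wdg l (axis j 1) \<noteq> 0"
      proof
        assume "wdg l (axis j 1) = 0"
        then obtain c where c: "axis j 1 = c *s l" using wdg_eq_0_iff[OF assms(1)] by blast
        have "c * l $ i = 0" "c * l $ j = 1"
          using arg_cong[OF c, of "\<lambda>v. v $ i"] arg_cong[OF c, of "\<lambda>v. v $ j"] j by (auto simp: axis_def)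
        then show False using i by auto
      qed
      then show ?thesis using that by blast
    qed
    obtain p r where pr: "polar (wdg l m) (wdg p r) \<noteq> 0" using polar_nondegenerate[OF m] by blast
    define \<gamma> where "\<gamma> = const_vec p + monom 1 1 *s const_vec r + monom 1 d *s const_vec m"
    have "monom 1 1 *s const_vec r \<in> homs (1 + 0)" "monom 1 d *s const_vec m \<in> homs (d + 0)"
      by (intro homs_mult homs_const; simp add: degree_monom_le)+
    then have "\<gamma> \<in> homs d" unfolding \<gamma>_def using assms(3)
      by (intro homs_add homs_const) (auto intro: homs_mono)
    moreover have "coeff_vec \<gamma> 0 = p" "coeff_vec \<gamma> 1 = r" "coeff_vec \<gamma> d = m"
      using assms(3) by (auto simp: \<gamma>_def coeff_vec_def const_vec_def vec_eq_iff coeff_pCons split: nat.splits)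
    then have "D \<gamma> \<noteq> 0" using pr by (simp add: D_def polar_commute)
    ultimately show ?thesis using that by blast
  qed
  have d: "0 + d = d" "1 \<le> d" using assms(3) by simp_all
  have "\<exists>\<delta>\<in>homs d. infinite {\<epsilon>. basefree d (wdg (const_vec l) (\<gamma> + [:\<epsilon>:] *s \<delta>)) \<and> D (\<gamma> + [:\<epsilon>:] *s \<delta>) \<noteq> 0}"
    by (rule generic_direction[OF homs_const basefree_const[OF assms(1)] assms(2) d, where G = "\<lambda>\<gamma>. D \<gamma> \<noteq> 0"])
      (erule D_line, (rule \<gamma>2)+)
  then obtain \<delta> where \<delta>: "\<delta> \<in> homs d"
    "infinite {\<epsilon>. basefree d (wdg (const_vec l) (\<gamma> + [:\<epsilon>:] *s \<delta>)) \<and> D (\<gamma> + [:\<epsilon>:] *s \<delta>) \<noteq> 0}"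
    by (elim bexE)
  have "{\<epsilon>. basefree d (wdg (const_vec l) (\<gamma> + [:\<epsilon>:] *s \<delta>)) \<and> D (\<gamma> + [:\<epsilon>:] *s \<delta>) \<noteq> 0} \<subseteq>
      {\<epsilon>. pt (hom_coords (wdg (const_vec l) \<gamma> + [:\<epsilon>:] *s wdg (const_vec l) \<delta>)) \<in> A}"
    unfolding A_def wdg_line using homs_add[OF assms(2) homs_scale[OF \<delta>(1)]] by blast
  then have "infinite {\<epsilon>. pt (hom_coords (wdg (const_vec l) \<gamma> + [:\<epsilon>:] *s wdg (const_vec l) \<delta>)) \<in> A}"
    using \<delta>(2) infinite_super by blast
  then have "pt (hom_coords (wdg (const_vec l) \<gamma>)) \<in> zariski_closure (hom_index d) A"
    by (rule closure_line_hom[OF wdg_const_homs[OF assms(2)] assms(4)])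
  then show ?thesis using closure_subset_closure[OF A] by blast
qed

lemma in_closure_R:
  assumes "\<phi> \<in> homs d" "\<phi> \<noteq> 0" "quad \<phi> = 0" "2 \<le> d"
  shows "pt (hom_coords \<phi>) \<in> zariski_closure (hom_index d) (R d)"
proof -
  obtain a b \<beta> \<gamma> where *: "a + b = d" "b \<le> a" "\<beta> \<in> homs b" "basefree b \<beta>" "\<gamma> \<in> homs a" "\<phi> = wdg \<beta> \<gamma>"
    using quad_zero_decompose[OF assms(2,1,3)] by blast
  show ?thesis
  proof (cases "b = 0")
    case True
    then have "\<beta> = const_vec (at_point \<beta> 0)" using *(3) homs_0_const by blast
    moreover have "at_point \<beta> 0 \<noteq> 0" using *(4) by (simp add: basefree_def)
    ultimately show ?thesis
      using wedge_const_in_closure_R[of "at_point \<beta> 0" \<gamma> d] * True assms(2,4) by simp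
  next
    case False
    then show ?thesis using wedge_in_closure_R[OF *(3,4,5), where d = d] * assms(2,4) by (simp add: add.commute)
  qed
qed

lemma closure_R:
  assumes "2 \<le> d"
  shows "zariski_closure (hom_index d) (R d) = {pt (hom_coords \<phi>) | \<phi>. \<phi> \<in> homs d \<and> \<phi> \<noteq> 0 \<and> quad \<phi> = 0}"
proof
  have "R d \<subseteq> {pt (hom_coords \<phi>) | \<phi>. \<phi> \<in> homs d \<and> \<phi> \<noteq> 0 \<and> quad \<phi> = 0}"
    unfolding R_eq using basefree_nonzero by blast
  then show "zariski_closure (hom_index d) (R d) \<subseteq> {pt (hom_coords \<phi>) | \<phi>. \<phi> \<in> homs d \<and> \<phi> \<noteq> 0 \<and> quad \<phi> = 0}"
    by (rule closure_minimal[OF closed_hom_set[OF closed_hom_quad]])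
  show "{pt (hom_coords \<phi>) | \<phi>. \<phi> \<in> homs d \<and> \<phi> \<noteq> 0 \<and> quad \<phi> = 0} \<subseteq> zariski_closure (hom_index d) (R d)"
    using in_closure_R assms by blast
qed

text \<open>
  The constant factor is kept, while the other factor moves in a general direction.
  The star involution carries this to the other family.
\<close>

lemma in_closure_R0:
  assumes "\<phi> \<in> homs d" "\<phi> \<noteq> 0" "l \<noteq> 0" "contract (star \<phi>) (const_vec l) = 0" "1 \<le> d"
  shows "pt (hom_coords \<phi>) \<in> zariski_closure (hom_index d) (R0 d)"
    and "pt (hom_coords (star \<phi>)) \<in> zariski_closure (hom_index d) (R0' d)"
proof -
  obtain \<gamma> where \<gamma>: "\<gamma> \<in> homs d" "\<phi> = wdg (const_vec l) \<gamma>" using wedge_const_form[OF assms(3,4,1)] by blast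
  have d: "0 + d = d" by simp
  have "\<exists>\<delta>\<in>homs d. infinite {\<epsilon>. basefree d (wdg (const_vec l) (\<gamma> + [:\<epsilon>:] *s \<delta>)) \<and> True}"
    by (rule generic_direction[OF homs_const basefree_const[OF assms(3)] \<gamma>(1) d assms(5), where G = "\<lambda>_. True"])
      (simp, rule \<gamma>(1), simp)
  then obtain \<delta> where \<delta>: "\<delta> \<in> homs d" "infinite {\<epsilon>. basefree d (wdg (const_vec l) (\<gamma> + [:\<epsilon>:] *s \<delta>))}"
    unfolding simp_thms by (elim bexE)
  let ?l = "\<lambda>\<epsilon>. \<phi> + [:\<epsilon>:] *s wdg (const_vec l) \<delta>"
  have lw: "?l \<epsilon> = wdg (const_vec l) (\<gamma> + [:\<epsilon>:] *s \<delta>)" for \<epsilon> unfolding \<gamma>(2) wdg_line ..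
  have inf: "infinite {\<epsilon>. basefree d (?l \<epsilon>)}" using \<delta>(2) unfolding lw .
  have hl: "?l \<epsilon> \<in> homs d" for \<epsilon> by (intro homs_add homs_scale assms(1) wdg_const_homs \<delta>(1))
  have ql: "quad (?l \<epsilon>) = 0" for \<epsilon> unfolding lw by simp
  have cl: "contract (star (?l \<epsilon>)) (const_vec l) = 0" for \<epsilon> unfolding lw by (rule contract_star_wdg)
  have "{\<epsilon>. basefree d (?l \<epsilon>)} \<subseteq> {\<epsilon>. pt (hom_coords (?l \<epsilon>)) \<in> R0 d}"
    unfolding R0_eq using hl ql cl assms(3) by blast
  then have "infinite {\<epsilon>. pt (hom_coords (?l \<epsilon>)) \<in> R0 d}" using inf infinite_super by blast
  then show "pt (hom_coords \<phi>) \<in> zariski_closure (hom_index d) (R0 d)"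
    by (rule closure_line_hom[OF assms(1,2)])
  have star_nonzero: "star \<phi> \<noteq> 0" using assms(2) by simp
  have sl: "star \<phi> + [:\<epsilon>:] *s star (wdg (const_vec l) \<delta>) = star (?l \<epsilon>)" for \<epsilon> by (simp add: star_linear)
  have bs: "basefree d (star (?l \<epsilon>))" if "basefree d (?l \<epsilon>)" for \<epsilon>
    using that unfolding basefree_def at_point_star coeff_vec_star star_eq_0_iff .
  have "{\<epsilon>. basefree d (?l \<epsilon>)} \<subseteq> {\<epsilon>. pt (hom_coords (star (?l \<epsilon>))) \<in> R0' d}"
    unfolding R0'_eq using hl[THEN homs_star] ql cl assms(3) bs quad_star by fastforce
  then have "infinite {\<epsilon>. pt (hom_coords (star (?l \<epsilon>))) \<in> R0' d}" using inf infinite_super by blast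
  then show "pt (hom_coords (star \<phi>)) \<in> zariski_closure (hom_index d) (R0' d)"
    unfolding sl[symmetric] by (rule closure_line_hom[OF homs_star[OF assms(1)] star_nonzero])
qed

lemma closure_R0_subset:
  "zariski_closure (hom_index d) (R0 d) \<union> zariski_closure (hom_index d) (R0' d) \<subseteq>
     {pt (hom_coords \<phi>) | \<phi>. \<phi> \<in> homs d \<and> \<phi> \<noteq> 0 \<and> quad \<phi> = 0 \<and> isotropic_span \<phi>}"
proof -
  let ?Z = "{pt (hom_coords \<phi>) | \<phi>. \<phi> \<in> homs d \<and> \<phi> \<noteq> 0 \<and> isotropic_span \<phi>}"
  have Z: "zariski_closed (hom_index d) ?Z" by (rule closed_hom_set[OF closed_hom_isotropic])
  have sub: "R0 d \<subseteq> ?Z" "R0' d \<subseteq> ?Z"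
    unfolding R0_eq R0'_eq using isotropic_span_if_contract basefree_nonzero by blast+
  have sub_Z: "zariski_closure (hom_index d) (R0 d) \<union> zariski_closure (hom_index d) (R0' d) \<subseteq> ?Z"
    by (intro Un_least closure_minimal[OF Z] sub)
  have q0: "quad \<phi> = 0" if "isotropic_span \<phi>" for \<phi>
    using that polar_self[of "at_point \<phi> x" for x] by (auto simp: quad_zero_iff_points isotropic_span_def)
  show ?thesis
  proof
    fix p assume "p \<in> zariski_closure (hom_index d) (R0 d) \<union> zariski_closure (hom_index d) (R0' d)"
    then have "p \<in> ?Z" using sub_Z by (rule subsetD[rotated])
    then obtain \<phi> where "p = pt (hom_coords \<phi>)" "\<phi> \<in> homs d" "\<phi> \<noteq> 0" "isotropic_span \<phi>"
      by (elim CollectE exE conjE)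
    then show "p \<in> {pt (hom_coords \<phi>) | \<phi>. \<phi> \<in> homs d \<and> \<phi> \<noteq> 0 \<and> quad \<phi> = 0 \<and> isotropic_span \<phi>}"
      by (intro CollectI exI[of _ \<phi>]) (simp add: q0)
  qed
qed

text \<open>
  A point of the closure is an isotropic tuple \<open>\<phi> = \<xi> \<psi>\<close> with \<open>\<psi>\<close> free of base points. If \<open>\<phi>\<close> spans an
  isotropic subspace, it is in the closure of \<open>R0\<close> or \<open>R0'\<close> by the classification of isotropic
  planes. Otherwise \<open>\<psi>\<close> is in \<open>R e\<close> and \<open>\<phi>\<close> is in a stratum.
\<close>

lemma boundary_of_R:
  assumes "2 \<le> d"
  shows "zariski_closure (hom_index d) (R d) - R d =
           (\<Union>d'\<in>{0..<d}. stratum d d') \<union>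
           (zariski_closure (hom_index d) (R0 d) \<union> zariski_closure (hom_index d) (R0' d))"
proof (intro equalityI subsetI)
  fix p assume "p \<in> zariski_closure (hom_index d) (R d) - R d"
  then obtain \<phi> where \<phi>: "p = pt (hom_coords \<phi>)" "\<phi> \<in> homs d" "\<phi> \<noteq> 0" "quad \<phi> = 0" "pt (hom_coords \<phi>) \<notin> R d"
    unfolding closure_R[OF assms] by blast
  show "p \<in> (\<Union>d'\<in>{0..<d}. stratum d d') \<union>
           (zariski_closure (hom_index d) (R0 d) \<union> zariski_closure (hom_index d) (R0' d))"
  proof (cases "isotropic_span \<phi>")
    case True
    have "1 \<le> d" using assms by simp
    consider l where "l \<noteq> 0" "contract (star \<phi>) (const_vec l) = 0"
      | l where "l \<noteq> 0" "contract (star (star \<phi>)) (const_vec l) = 0"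
      using isotropic_classification[OF \<phi>(3,4) True] by auto
    then show ?thesis
    proof cases
      case 1
      then show ?thesis using in_closure_R0(1)[OF \<phi>(2,3) 1 \<open>1 \<le> d\<close>] \<phi>(1) by blast
    next
      case 2
      then show ?thesis
        using in_closure_R0(2)[OF homs_star[OF \<phi>(2)] _ 2 \<open>1 \<le> d\<close>] \<phi>(1,3) by simp
    qed
  next
    case False
    obtain e \<xi> \<psi> where *: "e \<le> d" "\<xi> \<noteq> 0" "degree \<xi> \<le> d - e" "\<psi> \<in> homs e" "basefree e \<psi>" "\<phi> = \<xi> *s \<psi>"
      using factor_basefree[OF \<phi>(3,2)] by blast
    have "quad \<psi> = 0"
      using \<phi>(4) *(2) unfolding *(6) quad_scale by simp
    moreover have nI: "\<not> isotropic_span \<psi>" using False isotropic_span_mult *(6) by blast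
    ultimately have "pt (hom_coords \<psi>) \<in> R e" using * R_iff by blast
    moreover have "e < d"
    proof (rule ccontr)
      assume "\<not> e < d"
      then have "e = d" using *(1) by simp
      then have "basefree d \<phi>" using factor_top[OF *(2,3,5)] *(6) by blast
      then show False using \<phi> False R_iff by blast
    qed
    ultimately have "p \<in> stratum d e" unfolding stratum_def \<phi>(1) *(6) forms_def using *(2,3) by blast
    then show ?thesis using \<open>e < d\<close> by auto
  qed
next
  fix p assume "p \<in> (\<Union>d'\<in>{0..<d}. stratum d d') \<union>
           (zariski_closure (hom_index d) (R0 d) \<union> zariski_closure (hom_index d) (R0' d))"
  then consider e where "e < d" "p \<in> stratum d e"
    | "p \<in> zariski_closure (hom_index d) (R0 d) \<union> zariski_closure (hom_index d) (R0' d)" by auto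
  then show "p \<in> zariski_closure (hom_index d) (R d) - R d"
  proof cases
    case 1
    then obtain \<psi> \<xi> where *: "p = pt (hom_coords (\<xi> *s \<psi>))" "pt (hom_coords \<psi>) \<in> R e" "degree \<xi> \<le> d - e" "\<xi> \<noteq> 0"
      unfolding stratum_def forms_def by blast
    have \<psi>: "\<psi> \<in> homs e" "basefree e \<psi>" "quad \<psi> = 0" using *(2) R_iff by blast+
    have h: "\<xi> *s \<psi> \<in> homs d" using homs_mult[OF \<psi>(1) *(3)] 1(1) by simp
    have "\<xi> *s \<psi> \<noteq> 0" using *(4) basefree_nonzero[OF \<psi>(2)] by (simp add: scalar_mult_eq_0_iff)
    moreover have "\<not> basefree d (\<xi> *s \<psi>)"
      using basefree_iff_parallel[OF h] has_parallel_iff[OF \<psi>(2,1) *(4), of "d - 1"] 1(1) by auto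
    ultimately show ?thesis
      unfolding closure_R[OF assms] using R_iff h quad_mult[OF \<psi>(3)] *(1) by blast
  next
    case 2
    then have "p \<in> {pt (hom_coords \<phi>) | \<phi>. \<phi> \<in> homs d \<and> \<phi> \<noteq> 0 \<and> quad \<phi> = 0 \<and> isotropic_span \<phi>}"
      by (rule subsetD[OF closure_R0_subset])
    then obtain \<phi> where \<phi>: "p = pt (hom_coords \<phi>)" "\<phi> \<in> homs d" "\<phi> \<noteq> 0" "quad \<phi> = 0" "isotropic_span \<phi>"
      by (elim CollectE exE conjE)
    have "p \<in> zariski_closure (hom_index d) (R d)"
      unfolding closure_R[OF assms] using \<phi> by (intro CollectI exI[of _ \<phi>]) simp
    moreover have "p \<notin> R d" unfolding \<phi>(1) R_iff using \<phi>(5) by simp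
    ultimately show ?thesis by simp
  qed
qed

section \<open>Multiplication by a form is an isomorphism onto a stratum\<close>

text \<open>
  The Segre coordinates of a tuple and a form.
\<close>

definition tensor :: "complex poly ^ 'k::finite \<Rightarrow> complex poly \<Rightarrow> ('k \<times> nat) \<times> nat \<Rightarrow> complex" where
  "tensor \<psi> \<xi> = (\<lambda>(i, j). hom_coords \<psi> i * coeff \<xi> j)"

text \<open>
  Multiplication of a tuple by a form is bilinear, so it is a linear map on Segre coordinates.
\<close>

definition mult_map :: "nat \<Rightarrow> nat \<Rightarrow> (('k \<times> nat) \<times> nat \<Rightarrow> complex) \<Rightarrow> 'k \<times> nat \<Rightarrow> complex" where
  "mult_map e D x = (\<lambda>(k, n). \<Sum>i\<le>e. \<Sum>j\<le>D. if i + j = n then x ((k, i), j) else 0)"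

lemma segre_eq_tensor: "segre (hom_coords \<psi>) (coeff \<xi>) = pt (tensor \<psi> \<xi>)"
  by (simp add: segre_def tensor_def)

lemma homog_mult_map: "homog_poly 1 (\<lambda>x. mult_map e D x kn)"
  unfolding mult_map_def case_prod_beta
  by (intro homog_sum homog_if homog_zero homog_poly.coord)

lemma mult_map_scale: "mult_map e D (\<lambda>t. c * x t) = (\<lambda>kn. c * mult_map e D x kn)"
  by (auto simp: mult_map_def fun_eq_iff sum_distrib_left if_distrib intro!: sum.cong)

lemma mult_map_tensor:
  assumes "\<psi> \<in> homs e" "degree \<xi> \<le> D"
  shows "mult_map e D (tensor \<psi> \<xi>) = hom_coords (\<xi> *s \<psi>)"
proof -
  have "(\<Sum>i\<le>e. \<Sum>j\<le>D. if i + j = n then coeff (\<psi> $ k) i * coeff \<xi> j else 0) = coeff (\<xi> * \<psi> $ k) n" for k n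
  proof -
    have d: "degree (\<psi> $ k) \<le> e" using assms(1) by (simp add: homs_iff)
    have "(\<Sum>j\<le>D. if i + j = n then coeff (\<psi> $ k) i * coeff \<xi> j else 0) =
        (if i \<le> n then coeff (\<psi> $ k) i * coeff \<xi> (n - i) else 0)" for i
    proof (cases "i \<le> n")
      case True
      have "(\<Sum>j\<le>D. if i + j = n then coeff (\<psi> $ k) i * coeff \<xi> j else 0) =
          (\<Sum>j\<le>D. if j = n - i then coeff (\<psi> $ k) i * coeff \<xi> (n - i) else 0)"
        using True by (intro sum.cong) auto
      also have "\<dots> = coeff (\<psi> $ k) i * coeff \<xi> (n - i)"
        using assms(2) by (cases "n - i \<le> D") (simp_all add: sum.delta coeff_eq_0)
      finally show ?thesis using True by simp
    qed (auto intro: sum.neutral)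
    then show ?thesis using coeff_mult_bounded[OF d, of \<xi> n] by (simp add: mult.commute)
  qed
  then show ?thesis by (auto simp: mult_map_def tensor_def hom_coords_def fun_eq_iff)
qed

lemma image_pt: "(\<And>c x. F (\<lambda>t. c * x t) = (\<lambda>s. c * F x s)) \<Longrightarrow> F ` pt v = pt (F v)"
  unfolding pt_def setcompr_eq_image image_image by simp

text \<open>
  A constant isotropic tuple spans an isotropic line, so it lies in an isotropic plane.
\<close>

lemma R_zero: "R 0 = {}"
proof -
  have False if h: "\<phi> \<in> homs 0" "quad \<phi> = 0" "\<not> isotropic_span \<phi>" for \<phi>
  proof -
    obtain l where l: "\<phi> = const_vec l" using homs_0_const[OF h(1)] by blast
    have "quad (at_point \<phi> 0) = 0" using h(2) quad_zero_iff_points by blast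
    then have "polar l l = 0" by (simp add: l polar_self)
    then show False using h(3) by (simp add: isotropic_span_def l)
  qed
  then show ?thesis unfolding R_eq by blast
qed

text \<open>
  Two proportional tuples of the same degree, one of them without base points, have a constant
  ratio. This gives the injectivity of the multiplication map.
\<close>

lemma factor_unique:
  fixes \<psi> \<psi>' :: "complex poly ^ 'k::finite"
  assumes "basefree e \<psi>" "\<psi> \<in> homs e" "\<psi>' \<in> homs e" "\<psi>' \<noteq> 0" "\<xi>' \<noteq> 0"
    and eq: "\<xi>' *s \<psi>' = [:c:] *s (\<xi> *s \<psi>)"
  shows "\<exists>a. a \<noteq> 0 \<and> \<psi>' = [:a:] *s \<psi> \<and> \<xi>' = smult (c / a) \<xi>"
proof -
  have eqk: "\<xi>' * \<psi>' $ k = smult c (\<xi> * \<psi> $ k)" for k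
    using arg_cong[OF eq, of "\<lambda>v. v $ k"] by simp
  have "\<xi>' * (\<psi>' $ k * \<psi> $ l) = \<xi>' * (\<psi>' $ l * \<psi> $ k)" for k l
    using eqk[of k] eqk[of l] by (simp add: mult.assoc[symmetric]) (simp add: ac_simps)
  then have "parallel \<psi>' \<psi>" using assms(5) by (simp add: parallel_def)
  then obtain a where a: "a \<noteq> 0" "\<psi>' = a *s \<psi>" "degree a + e \<le> e"
    using parallel_basefree[OF assms(1,2) _ assms(3,4)] by blast
  then obtain b where b: "a = [:b:]" by (metis add_le_same_cancel2 degree_eq_zeroE le_zero_eq)
  then have b0: "b \<noteq> 0" using a(1) by auto
  obtain k where k: "\<psi> $ k \<noteq> 0" using basefree_nonzero[OF assms(1)] by (auto simp: vec_eq_iff)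
  have "smult b \<xi>' * \<psi> $ k = smult c \<xi> * \<psi> $ k"
    using eqk[of k] unfolding a(2) b by simp
  then have e: "smult b \<xi>' = smult c \<xi>" using k by (metis mult_cancel_right)
  have "\<xi>' = smult (1 / b) (smult b \<xi>')" using b0 by simp
  also have "\<dots> = smult (c / b) \<xi>" unfolding e by simp
  finally show ?thesis using a(2) b b0 by blast
qed

lemma tensor_scale: "tensor ([:a:] *s \<psi>) (smult b \<xi>) = (\<lambda>t. (a * b) * tensor \<psi> \<xi> t)"
  by (auto simp: tensor_def hom_coords_scale fun_eq_iff)

lemma tensor_zero_iff: "tensor \<psi> \<xi> = (\<lambda>_. 0) \<longleftrightarrow> \<psi> = 0 \<or> \<xi> = 0"
proof
  assume t: "tensor \<psi> \<xi> = (\<lambda>_. 0)"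
  have z: "hom_coords \<psi> i * coeff \<xi> j = 0" for i j using fun_cong[OF t, of "(i, j)"] by (simp add: tensor_def)
  show "\<psi> = 0 \<or> \<xi> = 0"
  proof (cases "\<xi> = 0")
    case False
    then have "coeff \<xi> (degree \<xi>) \<noteq> 0" by simp
    then have "hom_coords \<psi> i = 0" for i using z[of i "degree \<xi>"] by simp
    then have "hom_coords \<psi> = (\<lambda>_. 0)" by (simp add: fun_eq_iff)
    then show ?thesis by (simp add: hom_coords_zero_iff)
  qed simp
next
  assume "\<psi> = 0 \<or> \<xi> = 0"
  then show "tensor \<psi> \<xi> = (\<lambda>_. 0)" by (auto simp: tensor_def hom_coords_def fun_eq_iff)
qed

lemma tensor_supported:
  fixes \<psi> :: "complex poly ^ 'k::finite"
  assumes "\<psi> \<in> homs e" "degree \<xi> \<le> D"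
  shows "supported (hom_index e \<times> {..D}) (tensor \<psi> \<xi>)"
  unfolding supported_def
proof (intro allI impI)
  fix t :: "('k \<times> nat) \<times> nat"
  assume t: "t \<notin> hom_index e \<times> {..D}"
  obtain i j where ij: "t = (i, j)" by (cases t)
  have s: "supported (hom_index e) (hom_coords \<psi>)" using assms(1) by (simp add: supported_hom_coords)
  have "i \<notin> hom_index e \<or> D < j" using t ij by auto
  then have "hom_coords \<psi> i = 0 \<or> coeff \<xi> j = 0"
    using s[unfolded supported_def, rule_format, of i] assms(2) by (auto intro: coeff_eq_0)
  then show "tensor \<psi> \<xi> t = 0" by (auto simp: tensor_def ij)
qed

lemma variety_prod_eq:
  "variety_prod (R e) (proj_forms D) =
     {pt (tensor \<psi> \<xi>) | \<psi> \<xi>. pt (hom_coords \<psi>) \<in> R e \<and> degree \<xi> \<le> D \<and> \<xi> \<noteq> 0}"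
proof (intro set_eqI iffI)
  fix p assume "p \<in> variety_prod (R e) (proj_forms D)"
  then obtain v w where vw: "p = segre v w" "pt v \<in> R e" "pt w \<in> proj_forms D"
    unfolding variety_prod_def by (elim CollectE exE conjE)
  from vw(2) obtain \<psi>0 where \<psi>0: "pt v = pt (hom_coords \<psi>0)" unfolding R_eq by (elim CollectE exE conjE)
  from \<psi>0[symmetric] obtain c where "v = (\<lambda>i. c * hom_coords \<psi>0 i)" unfolding pt_eq_iff by (elim exE conjE)
  then have v: "v = hom_coords ([:c:] *s \<psi>0)" by (simp add: hom_coords_scale)
  from vw(3) obtain \<xi>0 where \<xi>0: "pt w = pt (coeff \<xi>0)" "\<xi>0 \<in> forms D" "\<xi>0 \<noteq> 0"
    unfolding proj_forms_def by (elim CollectE exE conjE)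
  from \<xi>0(1)[symmetric] obtain b where b: "b \<noteq> 0" "w = (\<lambda>i. b * coeff \<xi>0 i)" unfolding pt_eq_iff by (elim exE conjE)
  then have w: "w = coeff (smult b \<xi>0)" by (simp add: fun_eq_iff)
  have "degree (smult b \<xi>0) \<le> D" "smult b \<xi>0 \<noteq> 0" using \<xi>0 b by (simp_all add: forms_def)
  then show "p \<in> {pt (tensor \<psi> \<xi>) | \<psi> \<xi>. pt (hom_coords \<psi>) \<in> R e \<and> degree \<xi> \<le> D \<and> \<xi> \<noteq> 0}"
    using vw(1,2) v w segre_eq_tensor by blast
next
  fix p :: "((6 \<times> nat) \<times> nat \<Rightarrow> complex) set"
  assume "p \<in> {pt (tensor \<psi> \<xi>) | \<psi> \<xi>. pt (hom_coords \<psi>) \<in> R e \<and> degree \<xi> \<le> D \<and> \<xi> \<noteq> 0}"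
  then obtain \<psi> \<xi> where *: "p = pt (tensor \<psi> \<xi>)" "pt (hom_coords \<psi>) \<in> R e" "degree \<xi> \<le> D" "\<xi> \<noteq> 0"
    by (elim CollectE exE conjE)
  have "pt (coeff \<xi>) \<in> proj_forms D" unfolding proj_forms_def forms_def using *(3,4) by blast
  then show "p \<in> variety_prod (R e) (proj_forms D)"
    unfolding variety_prod_def using *(1,2)
    by (intro CollectI exI[of _ "hom_coords \<psi>"] exI[of _ "coeff \<xi>"]) (simp add: segre_eq_tensor)
qed

definition mult_point :: "nat \<Rightarrow> nat \<Rightarrow> ((6 \<times> nat) \<times> nat \<Rightarrow> complex) set \<Rightarrow> (6 \<times> nat \<Rightarrow> complex) set" where
  "mult_point e D p = mult_map e D ` p"

lemma mult_point_pt: "mult_point e D (pt x) = pt (mult_map e D x)"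
  unfolding mult_point_def by (rule image_pt) (rule mult_map_scale)

lemma mult_point_tensor:
  assumes "pt (hom_coords \<psi>) \<in> R e" "degree \<xi> \<le> D"
  shows "mult_point e D (pt (tensor \<psi> \<xi>)) = pt (hom_coords (\<xi> *s \<psi>))"
proof -
  have "\<psi> \<in> homs e" using assms(1) R_iff by blast
  then show ?thesis by (simp add: mult_point_pt mult_map_tensor assms(2))
qed

lemma stratum_eq:
  "stratum d e = {pt (hom_coords (\<xi> *s \<psi>)) | \<psi> \<xi>. pt (hom_coords \<psi>) \<in> R e \<and> degree \<xi> \<le> d - e \<and> \<xi> \<noteq> 0}"
  unfolding stratum_def forms_def by simp

lemma bij_mult_point:
  "bij_betw (mult_point e (d - e)) (variety_prod (R e) (proj_forms (d - e))) (stratum d e)"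
proof (rule bij_betw_imageI)
  show "inj_on (mult_point e (d - e)) (variety_prod (R e) (proj_forms (d - e)))"
  proof (rule inj_onI)
    fix p p'
    assume "p \<in> variety_prod (R e) (proj_forms (d - e))" "p' \<in> variety_prod (R e) (proj_forms (d - e))"
      and same: "mult_point e (d - e) p = mult_point e (d - e) p'"
    then obtain \<psi> \<xi> \<psi>' \<xi>' where *: "p = pt (tensor \<psi> \<xi>)" "pt (hom_coords \<psi>) \<in> R e" "degree \<xi> \<le> d - e" "\<xi> \<noteq> 0"
      and o2: "p' = pt (tensor \<psi>' \<xi>')" "pt (hom_coords \<psi>') \<in> R e" "degree \<xi>' \<le> d - e" "\<xi>' \<noteq> 0"
      unfolding variety_prod_eq by (elim CollectE exE conjE)
    have "pt (hom_coords (\<xi> *s \<psi>)) = pt (hom_coords (\<xi>' *s \<psi>'))"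
      using same mult_point_tensor[OF *(2,3)] mult_point_tensor[OF o2(2,3)] *(1) o2(1) by simp
    then obtain c where c: "c \<noteq> 0" "\<xi>' *s \<psi>' = [:c:] *s (\<xi> *s \<psi>)"
      unfolding pt_hom_coords_eq_iff by (elim exE conjE)
    have \<psi>: "basefree e \<psi>" "\<psi> \<in> homs e" "\<psi>' \<in> homs e" "\<psi>' \<noteq> 0"
      using *(2) o2(2) R_iff basefree_nonzero by blast+
    obtain a where a: "a \<noteq> 0" "\<psi>' = [:a:] *s \<psi>" "\<xi>' = smult (c / a) \<xi>"
      using factor_unique[OF \<psi> o2(4) c(2)] by blast
    then have "tensor \<psi>' \<xi>' = (\<lambda>t. c * tensor \<psi> \<xi> t)" using tensor_scale[of a \<psi> "c / a" \<xi>] by simp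
    then show "p = p'" using *(1) o2(1) by (simp add: pt_scale[OF c(1)])
  qed
  show "mult_point e (d - e) ` variety_prod (R e) (proj_forms (d - e)) = stratum d e"
  proof (intro set_eqI iffI)
    fix p assume "p \<in> mult_point e (d - e) ` variety_prod (R e) (proj_forms (d - e))"
    then obtain \<psi> \<xi> where *: "p = mult_point e (d - e) (pt (tensor \<psi> \<xi>))" "pt (hom_coords \<psi>) \<in> R e"
        "degree \<xi> \<le> d - e" "\<xi> \<noteq> 0"
      unfolding variety_prod_eq by blast
    then show "p \<in> stratum d e"
      unfolding stratum_eq using mult_point_tensor[OF *(2,3)] by (intro CollectI exI conjI) auto
  next
    fix p assume "p \<in> stratum d e"
    then obtain \<psi> \<xi> where *: "p = pt (hom_coords (\<xi> *s \<psi>))" "pt (hom_coords \<psi>) \<in> R e" "degree \<xi> \<le> d - e" "\<xi> \<noteq> 0"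
      unfolding stratum_eq by (elim CollectE exE conjE)
    show "p \<in> mult_point e (d - e) ` variety_prod (R e) (proj_forms (d - e))"
    proof (rule image_eqI)
      show "p = mult_point e (d - e) (pt (tensor \<psi> \<xi>))" using mult_point_tensor[OF *(2,3)] *(1) by simp
      show "pt (tensor \<psi> \<xi>) \<in> variety_prod (R e) (proj_forms (d - e))"
        unfolding variety_prod_eq using *(2-4) by blast
    qed
  qed
qed

lemma regular_mult_point: "regular_map (variety_prod (R e) (proj_forms D)) (mult_point e D)"
  unfolding regular_map_def
proof
  fix p assume "p \<in> variety_prod (R e) (proj_forms D)"
  then obtain \<psi> \<xi> where *: "p = pt (tensor \<psi> \<xi>)" "pt (hom_coords \<psi>) \<in> R e" "degree \<xi> \<le> D" "\<xi> \<noteq> 0"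
    unfolding variety_prod_eq by (elim CollectE exE conjE)
  have \<psi>: "\<psi> \<in> homs e" "\<psi> \<noteq> 0" using *(2) R_iff basefree_nonzero by blast+
  then have "\<xi> *s \<psi> \<noteq> 0" using *(4) by (simp add: scalar_mult_eq_0_iff)
  then have nz: "hom_coords (\<xi> *s \<psi>) \<noteq> (\<lambda>_. 0)" by (simp add: hom_coords_zero_iff)
  have "mult_map e D v \<noteq> (\<lambda>_. 0)" if "v \<in> p" for v
  proof -
    from that obtain c where c: "c \<noteq> 0" "v = (\<lambda>t. c * tensor \<psi> \<xi> t)" unfolding *(1) mem_pt by (elim exE conjE)
    have "mult_map e D v = (\<lambda>s. c * hom_coords (\<xi> *s \<psi>) s)"
      unfolding c(2) mult_map_scale mult_map_tensor[OF \<psi>(1) *(3)] ..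
    then show ?thesis using nz c(1) by (auto simp: fun_eq_iff)
  qed
  then show "\<exists>n G. (\<forall>j. homog_poly n (\<lambda>v. G v j)) \<and> (\<forall>v\<in>p. G v \<noteq> (\<lambda>_. 0)) \<and>
      (\<forall>v. pt v \<in> variety_prod (R e) (proj_forms D) \<and> G v \<noteq> (\<lambda>_. 0) \<longrightarrow> mult_point e D (pt v) = pt (G v))"
    using homog_mult_map mult_point_pt
    by (intro exI[of _ 1] exI[of _ "mult_map e D"] conjI allI ballI impI) auto
qed

subsection \<open>Quasi-projectivity\<close>

lemma closed_hom_conj:
  assumes "closed_hom d P" "closed_hom d Q"
  shows "closed_hom d (\<lambda>\<phi>. P \<phi> \<and> Q \<phi>)"
proof -
  have "(\<exists>\<phi>. u = hom_coords \<phi> \<and> P \<phi> \<and> Q \<phi>) \<longleftrightarrow> (\<exists>\<phi>. u = hom_coords \<phi> \<and> P \<phi>) \<and> (\<exists>\<phi>. u = hom_coords \<phi> \<and> Q \<phi>)" for u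
    by (auto simp: hom_coords_inj)
  then show ?thesis using closed_cond_conj assms unfolding closed_hom_def by simp
qed

lemma closed_hom_disj:
  assumes "closed_hom d P" "closed_hom d Q"
  shows "closed_hom d (\<lambda>\<phi>. P \<phi> \<or> Q \<phi>)"
proof -
  have "(\<exists>\<phi>. u = hom_coords \<phi> \<and> (P \<phi> \<or> Q \<phi>)) \<longleftrightarrow> (\<exists>\<phi>. u = hom_coords \<phi> \<and> P \<phi>) \<or> (\<exists>\<phi>. u = hom_coords \<phi> \<and> Q \<phi>)" for u
    by auto
  then show ?thesis using closed_cond_disj assms unfolding closed_hom_def by simp
qed

lemma quasi_projective_empty: "quasi_projective {}"
  by (rule quasi_projectiveI[of "{}" "\<lambda>_. True" "\<lambda>_. True"]) (auto simp: closed_cond_def)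

lemma has_parallel_scale: "c \<noteq> 0 \<Longrightarrow> has_parallel m ([:c:] *s \<phi>) \<longleftrightarrow> has_parallel m \<phi>"
proof -
  have "has_parallel m ([:c:] *s \<phi>)" if "has_parallel m \<phi>" for c \<phi>
    using that by (auto simp: has_parallel_def parallel_def)
  then show "c \<noteq> 0 \<Longrightarrow> has_parallel m ([:c:] *s \<phi>) \<longleftrightarrow> has_parallel m \<phi>"
    by (metis scale_inverse)
qed

lemma isotropic_span_scale: "c \<noteq> 0 \<Longrightarrow> isotropic_span ([:c:] *s \<phi>) \<longleftrightarrow> isotropic_span \<phi>"
  using isotropic_span_mult scale_inverse by metis

text \<open>
  The polar form of \<open>\<psi>(x)\<close> and \<open>\<psi>(y)\<close> vanishes where \<open>\<xi>(x)\<close> and \<open>\<xi>(y)\<close> do not; it is a polynomial in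
  each of \<open>x\<close> and \<open>y\<close>, so it vanishes everywhere.
\<close>

lemma isotropic_span_cancel:
  assumes "\<xi> \<noteq> 0" "isotropic_span (\<xi> *s \<psi>)"
  shows "isotropic_span \<psi>"
proof -
  have scale: "polar (a *s \<eta>) (b *s \<zeta>) = a * b * polar \<eta> \<zeta>" for a b :: complex and \<eta> \<zeta>
    by (simp add: polar_def algebra_simps)
  have z: "poly \<xi> x * poly \<xi> y * polar (at_point \<psi> x) (at_point \<psi> y) = 0" for x y
    using assms(2)[unfolded isotropic_span_def, rule_format, of x y] by (simp add: scale)
  have nonroot: "polar (at_point \<psi> x) (at_point \<psi> y) = 0" if "poly \<xi> x \<noteq> 0" for x y
  proof -
    have "\<xi> * polar (const_vec (at_point \<psi> x)) \<psi> = 0"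
      by (rule poly_eqI_points) (use z[of x] that in auto)
    then have "polar (const_vec (at_point \<psi> x)) \<psi> = 0" using assms(1) by simp
    then show ?thesis by (metis poly_0 poly_polar at_point_simps(4))
  qed
  have "polar (at_point \<psi> x) (at_point \<psi> y) = 0" for x y
  proof -
    have "\<xi> * polar (const_vec (at_point \<psi> y)) \<psi> = 0"
    proof (rule poly_eqI_points)
      fix u
      show "poly (\<xi> * polar (const_vec (at_point \<psi> y)) \<psi>) u = poly 0 u"
        using nonroot[of u y] by (auto simp: polar_commute)
    qed
    then have "polar (const_vec (at_point \<psi> y)) \<psi> = 0" using assms(1) by simp
    then show ?thesis by (metis poly_0 poly_polar at_point_simps(4) polar_commute)
  qed
  then show ?thesis by (simp add: isotropic_span_def)
qed

text \<open>
  The stratum consists of the isotropic tuples whose degree after removal of base points is exactly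
  \<open>e\<close> and that do not span an isotropic subspace. This displays it as a difference of closed
  sets.
\<close>

lemma stratum_conditions:
  assumes "1 \<le> e" "e \<le> d"
  shows "stratum d e = {pt (hom_coords \<phi>) | \<phi>. \<phi> \<in> homs d \<and> \<phi> \<noteq> 0 \<and> (quad \<phi> = 0 \<and> has_parallel e \<phi>) \<and>
     \<not> (has_parallel (e - 1) \<phi> \<or> isotropic_span \<phi>)}" (is "_ = ?S")
proof (intro set_eqI iffI)
  fix p assume "p \<in> stratum d e"
  then obtain \<psi> \<xi> where *: "p = pt (hom_coords (\<xi> *s \<psi>))" "pt (hom_coords \<psi>) \<in> R e" "degree \<xi> \<le> d - e" "\<xi> \<noteq> 0"
    unfolding stratum_eq by (elim CollectE exE conjE)
  have \<psi>: "\<psi> \<in> homs e" "basefree e \<psi>" "quad \<psi> = 0" "\<not> isotropic_span \<psi>" using *(2) R_iff by blast+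
  have "\<xi> *s \<psi> \<in> homs d" using homs_mult[OF \<psi>(1) *(3)] assms(2) by simp
  moreover have "\<xi> *s \<psi> \<noteq> 0" using *(4) basefree_nonzero[OF \<psi>(2)] by (simp add: scalar_mult_eq_0_iff)
  moreover have "\<not> isotropic_span (\<xi> *s \<psi>)" using isotropic_span_cancel[OF *(4)] \<psi>(4) by blast
  ultimately show "p \<in> ?S"
    using *(1) quad_mult[OF \<psi>(3)] has_parallel_iff[OF \<psi>(2,1) *(4)] assms(1)
    by (intro CollectI exI[of _ "\<xi> *s \<psi>"]) auto
next
  fix p assume "p \<in> ?S"
  then obtain \<phi> where \<phi>: "p = pt (hom_coords \<phi>)" "\<phi> \<in> homs d" "\<phi> \<noteq> 0" "quad \<phi> = 0" "has_parallel e \<phi>"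
     "\<not> has_parallel (e - 1) \<phi>" "\<not> isotropic_span \<phi>" by (elim CollectE exE conjE) simp
  obtain e' \<xi> \<psi> where *: "e' \<le> d" "\<xi> \<noteq> 0" "degree \<xi> \<le> d - e'" "\<psi> \<in> homs e'" "basefree e' \<psi>" "\<phi> = \<xi> *s \<psi>"
    using factor_basefree[OF \<phi>(3,2)] by blast
  have "e' = e" using \<phi>(5,6) has_parallel_iff[OF *(5,4,2)] *(6) assms(1) by simp
  moreover have "quad \<psi> = 0" using \<phi>(4) *(2) unfolding *(6) quad_scale by simp
  moreover have "\<not> isotropic_span \<psi>" using \<phi>(7) isotropic_span_mult *(6) by blast
  ultimately have "pt (hom_coords \<psi>) \<in> R e" using * R_iff by simp
  then show "p \<in> stratum d e" unfolding stratum_eq \<phi>(1) *(6) using *(2,3) \<open>e' = e\<close> by blast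
qed

lemma quasi_projective_stratum:
  assumes "e \<le> d"
  shows "quasi_projective (stratum d e)"
proof (cases "e = 0")
  case True
  then have "stratum d e = {}" by (simp add: stratum_eq R_zero)
  then show ?thesis using quasi_projective_empty by simp
next
  case False
  let ?P = "\<lambda>u. \<exists>\<phi> :: complex poly ^ 6. u = hom_coords \<phi> \<and> quad \<phi> = 0 \<and> has_parallel e \<phi>"
  let ?Q = "\<lambda>u. \<exists>\<phi>. u = hom_coords \<phi> \<and> (has_parallel (e - 1) \<phi> \<or> isotropic_span \<phi>)"
  have P: "closed_cond (hom_index d) ?P"
    using closed_hom_conj[OF closed_hom_quad closed_hom_has_parallel] unfolding closed_hom_def .
  have Q: "closed_cond (hom_index d) ?Q"
    using closed_hom_disj[OF closed_hom_has_parallel closed_hom_isotropic] unfolding closed_hom_def .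
  show ?thesis
  proof (rule quasi_projectiveI[OF finite_hom_index P Q])
    fix c u assume c: "c \<noteq> 0" and "?Q (\<lambda>i. c * u i)"
    then obtain \<phi> where \<phi>: "(\<lambda>i. c * u i) = hom_coords \<phi>" "has_parallel (e - 1) \<phi> \<or> isotropic_span \<phi>"
      by (elim exE conjE)
    have "u = (\<lambda>i. (1 / c) * hom_coords \<phi> i)" unfolding \<phi>(1)[symmetric] using c by simp
    then have "u = hom_coords ([:1 / c:] *s \<phi>)" by (simp add: hom_coords_scale)
    moreover have "has_parallel (e - 1) ([:1 / c:] *s \<phi>) \<or> isotropic_span ([:1 / c:] *s \<phi>)"
      using \<phi>(2) c by (simp add: has_parallel_scale isotropic_span_scale)
    ultimately show "?Q u" by (intro exI conjI)
  next
    show "stratum d e = {pt u | u. u \<noteq> (\<lambda>_. 0) \<and> supported (hom_index d) u \<and> ?P u \<and> \<not> ?Q u}" (is "_ = ?S")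
    proof (intro set_eqI iffI)
      fix p assume "p \<in> stratum d e"
      then obtain \<phi> where \<phi>: "p = pt (hom_coords \<phi>)" "\<phi> \<in> homs d" "\<phi> \<noteq> 0" "quad \<phi> = 0 \<and> has_parallel e \<phi>"
        "\<not> (has_parallel (e - 1) \<phi> \<or> isotropic_span \<phi>)"
        using stratum_conditions[of e d] False assms by auto
      then show "p \<in> ?S"
        by (intro CollectI exI[of _ "hom_coords \<phi>"]) (auto simp: supported_hom_coords hom_coords_zero_iff hom_coords_inj)
    next
      fix p assume "p \<in> ?S"
      then obtain u \<phi> where \<phi>: "p = pt u" "u \<noteq> (\<lambda>_. 0)" "supported (hom_index d) u" "\<not> ?Q u" "u = hom_coords \<phi>"
          "quad \<phi> = 0" "has_parallel e \<phi>"
        by (elim CollectE exE conjE)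
      then have "\<phi> \<in> homs d" "\<phi> \<noteq> 0" "\<not> (has_parallel (e - 1) \<phi> \<or> isotropic_span \<phi>)"
        by (auto simp: supported_hom_coords hom_coords_zero_iff hom_coords_inj)
      then show "p \<in> stratum d e"
        using stratum_conditions[of e d] False assms \<phi> by auto
    qed
  qed
qed

lemma closed_cond_pullback:
  assumes "closed_cond J P" "\<And>x. supported I x \<Longrightarrow> supported J (L x)" "\<And>j. homog_poly 1 (\<lambda>x. L x j)"
  shows "closed_cond I (\<lambda>x. P (L x))"
  unfolding closed_cond_def
proof (intro allI impI, elim conjE)
  fix x assume x: "supported I x" "\<not> P (L x)"
  from assms(1)[unfolded closed_cond_def, rule_format, OF conjI[OF assms(2)[OF x(1)] x(2)]]
  obtain n f where f: "homog_poly n f" "f (L x) \<noteq> 0" "\<forall>w. supported J w \<and> P w \<longrightarrow> f w = 0" by (elim exE conjE)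
  have "homog_poly (n * 1) (\<lambda>x. f (L x))" by (rule homog_subst[OF f(1) assms(3)])
  then show "\<exists>n f. homog_poly n f \<and> f x \<noteq> 0 \<and> (\<forall>w. supported I w \<and> P (L w) \<longrightarrow> f w = 0)"
    using f(2,3) assms(2) by (intro exI[of _ "n * 1"] exI[of _ "\<lambda>x. f (L x)"]) simp
qed

lemma coeff_surj:
  fixes w :: "nat \<Rightarrow> complex"
  assumes "\<And>j. D < j \<Longrightarrow> w j = 0"
  shows "\<exists>\<xi>. degree \<xi> \<le> D \<and> w = coeff \<xi>"
proof (intro exI conjI)
  let ?\<xi> = "\<Sum>j\<le>D. monom (w j) j"
  show "w = coeff ?\<xi>" using assms by (auto simp: fun_eq_iff coeff_sum)
  then show "degree ?\<xi> \<le> D" using assms by (metis degree_le)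
qed

text \<open>
  The equations of the Segre variety.
\<close>

definition rank_one :: "('i \<times> 'j \<Rightarrow> complex) \<Rightarrow> bool" where
  "rank_one x \<longleftrightarrow> (\<forall>i i' j j'. x (i, j) * x (i', j') = x (i, j') * x (i', j))"

lemma closed_cond_rank_one: "closed_cond I rank_one"
proof -
  have "closed_cond I (\<lambda>x. x (i, j) * x (i', j') - x (i, j') * x (i', j) = 0)" for i i' :: 'a and j j' :: 'b
    by (intro closed_cond_homog[of "1 + 1"] homog_diff homog_poly.mult homog_poly.coord)
  then have "closed_cond I (\<lambda>x. \<forall>i i' j j'. x (i, j) * x (i', j') - x (i, j') * x (i', j) = 0)"
    by (intro closed_cond_all)
  then show ?thesis by (simp add: rank_one_def[abs_def])
qed

text \<open>
  The closed condition on isotropic tuples that is complementary to \<open>R e\<close>. It holds for the zero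
  tuple, which occurs as a column of a matrix of rank one.
\<close>

definition degenerate :: "nat \<Rightarrow> complex poly ^ 6 \<Rightarrow> bool" where
  "degenerate e \<phi> \<longleftrightarrow> \<not> basefree e \<phi> \<or> isotropic_span \<phi>"

lemma degenerate_scale: "degenerate e \<phi> \<Longrightarrow> degenerate e ([:c:] *s \<phi>)"
proof (cases "c = 0")
  case True
  then have zero: "[:c:] *s \<phi> = 0" by (simp add: vec_eq_iff)
  have "\<not> basefree e (0 :: complex poly ^ 6)" using basefree_nonzero by blast
  show ?thesis unfolding zero degenerate_def using \<open>\<not> basefree e (0 :: complex poly ^ 6)\<close> by simp
next
  case False
  assume "degenerate e \<phi>"
  then show ?thesis unfolding degenerate_def
    using basefree_scale[of "1 / c" e "[:c:] *s \<phi>"] scale_inverse[OF False, of \<phi>] isotropic_span_mult False by auto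
qed

text \<open>
  On a matrix of rank one \<open>v \<otimes> w\<close> the columns are the multiples \<open>w\<^sub>j v\<close>. A condition on \<open>v\<close> that is stable
  under scalars, including zero, is thus the same condition on all columns.
\<close>

lemma quasi_projective_product:
  "quasi_projective (variety_prod (R e) (proj_forms D))"
proof (cases "e = 0")
  case True
  have "variety_prod (R e) (proj_forms D) = {}" using variety_prod_eq[of 0 D] R_zero True by simp
  then show ?thesis by (simp add: quasi_projective_empty)
next
  case False
  define I where "I = (hom_index e :: (6 \<times> nat) set) \<times> {..D}"
  define col where "col j x = (\<lambda>i. x (i, j))" for j and x :: "(6 \<times> nat) \<times> nat \<Rightarrow> complex"
  define P where "P x \<longleftrightarrow> rank_one x \<and> (\<forall>j. \<exists>\<phi>. col j x = hom_coords \<phi> \<and> quad \<phi> = 0)" for x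
  define Q where "Q x \<longleftrightarrow> (\<forall>j. \<exists>\<phi>. col j x = hom_coords \<phi> \<and> degenerate e \<phi>)" for x
  have col_supp: "supported (hom_index e) (col j x)" if "supported I x" for j x
    using that by (auto simp: supported_def I_def col_def)
  have col_hom: "homog_poly 1 (\<lambda>x. col j x i)" for i j
    unfolding col_def by (rule homog_poly.coord)
  have "closed_hom e (degenerate e)"
    unfolding degenerate_def[abs_def] using closed_hom_disj[OF closed_hom_not_basefree closed_hom_isotropic] False by simp
  then have Q: "closed_cond I Q"
    unfolding Q_def[abs_def] closed_hom_def
    by (intro closed_cond_all closed_cond_pullback[OF _ col_supp col_hom])
  have P: "closed_cond I P"
    unfolding P_def[abs_def] using closed_hom_quad[of e, unfolded closed_hom_def]
    by (intro closed_cond_conj closed_cond_rank_one closed_cond_all closed_cond_pullback[OF _ col_supp col_hom])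
  have col_tensor: "col j (tensor \<psi> \<xi>) = hom_coords ([:coeff \<xi> j:] *s \<psi>)" for j \<psi> \<xi>
    by (simp add: col_def tensor_def hom_coords_scale mult.commute)
  show ?thesis
  proof (rule quasi_projectiveI[OF _ P Q])
    show "finite I" unfolding I_def using finite_hom_index by blast
  next
    fix c x assume c: "c \<noteq> (0 :: complex)" and q: "Q (\<lambda>i. c * x i)"
    show "Q x"
      unfolding Q_def
    proof
      fix j
      from q obtain \<phi> where \<phi>: "col j (\<lambda>i. c * x i) = hom_coords \<phi>" "degenerate e \<phi>"
        unfolding Q_def by (elim allE[of _ j] exE conjE)
      have "col j x = (\<lambda>i. (1 / c) * col j (\<lambda>i. c * x i) i)" using c by (simp add: col_def)
      then have "col j x = hom_coords ([:1 / c:] *s \<phi>)" unfolding \<phi>(1) hom_coords_scale .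
      then show "\<exists>\<phi>. col j x = hom_coords \<phi> \<and> degenerate e \<phi>" using degenerate_scale[OF \<phi>(2)] by (intro exI conjI)
    qed
  next
    show "variety_prod (R e) (proj_forms D) = {pt x | x. x \<noteq> (\<lambda>_. 0) \<and> supported I x \<and> P x \<and> \<not> Q x}" (is "_ = ?S")
    proof (intro set_eqI iffI)
      fix p assume "p \<in> variety_prod (R e) (proj_forms D)"
      then obtain \<psi> \<xi> where *: "p = pt (tensor \<psi> \<xi>)" "pt (hom_coords \<psi>) \<in> R e" "degree \<xi> \<le> D" "\<xi> \<noteq> 0"
        unfolding variety_prod_eq by (elim CollectE exE conjE)
      have \<psi>: "\<psi> \<in> homs e" "basefree e \<psi>" "quad \<psi> = 0" "\<not> isotropic_span \<psi>" using *(2) R_iff by blast+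
      have "P (tensor \<psi> \<xi>)" unfolding P_def col_tensor
        using quad_mult[OF \<psi>(3)] by (auto simp: rank_one_def tensor_def hom_coords_inj)
      moreover have "\<not> Q (tensor \<psi> \<xi>)"
      proof
        assume "Q (tensor \<psi> \<xi>)"
        then obtain \<phi> where "hom_coords ([:coeff \<xi> (degree \<xi>):] *s \<psi>) = hom_coords \<phi>" "degenerate e \<phi>"
          unfolding Q_def col_tensor by (elim allE[of _ "degree \<xi>"] exE conjE)
        then have b: "degenerate e ([:coeff \<xi> (degree \<xi>):] *s \<psi>)" by (simp add: hom_coords_inj)
        have c: "coeff \<xi> (degree \<xi>) \<noteq> 0" using *(4) by simp
        show False using degenerate_scale[OF b, of "1 / coeff \<xi> (degree \<xi>)"] \<psi>(2,4)
          unfolding scale_inverse[OF c] by (simp add: degenerate_def)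
      qed
      moreover have "tensor \<psi> \<xi> \<noteq> (\<lambda>_. 0)" using *(4) basefree_nonzero[OF \<psi>(2)] by (simp add: tensor_zero_iff)
      ultimately show "p \<in> ?S" using *(1) tensor_supported[OF \<psi>(1) *(3)] unfolding I_def
        by (intro CollectI exI[of _ "tensor \<psi> \<xi>"]) simp
    next
      fix p assume "p \<in> ?S"
      then obtain x where x: "p = pt x" "x \<noteq> (\<lambda>_. 0)" "supported I x" "P x" "\<not> Q x" by (elim CollectE exE conjE)
      from x(2) have "\<exists>t. x t \<noteq> 0" by (simp add: fun_eq_iff)
      then obtain i0 j0 where ij: "x (i0, j0) \<noteq> 0" by auto
      from x(4) obtain \<psi> where \<psi>: "col j0 x = hom_coords \<psi>" "quad \<psi> = 0"
        unfolding P_def by (elim conjE allE[of _ j0] exE)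
      have \<psi>h: "\<psi> \<in> homs e" using col_supp[OF x(3), of j0] \<psi>(1) by (simp add: supported_hom_coords)
      have "x (i0, j) / x (i0, j0) = 0" if "D < j" for j
        using x(3)[unfolded supported_def, rule_format, of "(i0, j)"] that by (simp add: I_def)
      then obtain \<xi> where \<xi>: "degree \<xi> \<le> D" "(\<lambda>j. x (i0, j) / x (i0, j0)) = coeff \<xi>"
        using coeff_surj[of D "\<lambda>j. x (i0, j) / x (i0, j0)"] by blast
      have t: "x = tensor \<psi> \<xi>"
      proof
        fix t :: "(6 \<times> nat) \<times> nat"
        obtain i j where "t = (i, j)" by (cases t)
        moreover have "x (i, j) * x (i0, j0) = x (i, j0) * x (i0, j)"
          using x(4) unfolding P_def rank_one_def by blast
        then have "x (i, j) = x (i, j0) * (x (i0, j) / x (i0, j0))" using ij by (simp add: field_simps)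
        moreover have "x (i0, j) / x (i0, j0) = coeff \<xi> j" using fun_cong[OF \<xi>(2), of j] .
        moreover have "x (i, j0) = hom_coords \<psi> i" using fun_cong[OF \<psi>(1), of i] by (simp add: col_def)
        ultimately show "x t = tensor \<psi> \<xi> t" by (simp add: tensor_def)
      qed
      have "\<not> degenerate e \<psi>"
      proof
        assume b: "degenerate e \<psi>"
        have "Q x" unfolding Q_def t col_tensor
        proof
          fix j
          show "\<exists>\<phi>. hom_coords ([:coeff \<xi> j:] *s \<psi>) = hom_coords \<phi> \<and> degenerate e \<phi>"
            by (rule exI[of _ "[:coeff \<xi> j:] *s \<psi>"]) (simp add: degenerate_scale[OF b])
        qed
        then show False using x(5) by simp
      qed
      then have "pt (hom_coords \<psi>) \<in> R e" using R_iff \<psi>h \<psi>(2) by (simp add: degenerate_def)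
      moreover have "\<xi> \<noteq> 0" using x(2) tensor_zero_iff unfolding t by blast
      ultimately show "p \<in> variety_prod (R e) (proj_forms D)"
        unfolding variety_prod_eq x(1) t using \<xi>(1) by blast
    qed
  qed
qed

subsection \<open>Regularity of the inverse\<close>

text \<open>
  Linear equations, with coefficients linear in \<open>u\<close>, for the Segre coordinates \<open>x\<close> of the factors of
  a tuple \<open>u\<close>: each column of \<open>x\<close> is proportional to \<open>u\<close> as a tuple of forms, and the
  product \<open>mult_map e D x\<close> is proportional to \<open>u\<close> as a coordinate vector.
\<close>

definition factor_system ::
  "(nat \<times> 'k \<times> 'k \<times> nat) + (('k \<times> nat) \<times> 'k \<times> nat) \<Rightarrow> ('k \<times> nat) \<times> nat \<Rightarrow> ('k \<times> nat \<Rightarrow> complex) \<Rightarrow> complex" where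
  "factor_system r = (case r of
     Inl (j, s) \<Rightarrow> (\<lambda>(t, j') u. if j' = j then parallel_system s t u else 0)
   | Inr ((k, n), (l, m)) \<Rightarrow> (\<lambda>((k', i), j) u.
       (if k' = k \<and> i + j = n then u (l, m) else 0) - (if k' = l \<and> i + j = m then u (k, n) else 0)))"

lemma homog_factor_system: "homog_poly 1 (factor_system r t)"
proof (cases r)
  case (Inl js)
  obtain j s where "js = (j, s)" by (cases js)
  moreover obtain v j' where "t = (v, j')" by (cases t)
  ultimately show ?thesis unfolding Inl factor_system_def sum.case case_prod_conv
    by (simp only: case_prod_conv) (intro homog_if homog_zero homog_parallel_system)
next
  case (Inr kl)
  obtain k n l m where "kl = ((k, n), (l, m))" by (metis surj_pair)
  moreover obtain k' i j where "t = ((k', i), j)" by (metis surj_pair)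
  ultimately show ?thesis unfolding Inr factor_system_def sum.case case_prod_conv
    by (simp only: case_prod_conv) (intro homog_diff homog_if homog_zero homog_poly.coord)
qed

lemma factor_system_sum_Inl:
  "(\<Sum>t\<in>hom_index e \<times> {..D}. factor_system (Inl (j, s)) t u * x t) =
    (if j \<le> D then \<Sum>v\<in>hom_index e. parallel_system s v u * x (v, j) else 0)"
proof -
  have "(\<Sum>t\<in>hom_index e \<times> {..D}. factor_system (Inl (j, s)) t u * x t) =
     (\<Sum>v\<in>hom_index e. \<Sum>j'\<le>D. if j' = j then parallel_system s v u * x (v, j) else 0)"
    unfolding sum.cartesian_product'
    by (intro sum.cong refl) (simp add: factor_system_def)
  also have "\<dots> = (\<Sum>v\<in>hom_index e. if j \<le> D then parallel_system s v u * x (v, j) else 0)"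
    by (simp add: sum.delta)
  finally show ?thesis by simp
qed

lemma factor_system_sum_Inr:
  fixes x :: "('k::finite \<times> nat) \<times> nat \<Rightarrow> complex"
  shows "(\<Sum>t\<in>hom_index e \<times> {..D}. factor_system (Inr ((k, n), (l, m))) t u * x t) =
    mult_map e D x (k, n) * u (l, m) - mult_map e D x (l, m) * u (k, n)"
proof -
  have one: "(\<Sum>k'\<in>UNIV. \<Sum>i\<le>e. \<Sum>j\<le>D. (if k' = a \<and> i + j = b then c else 0) * x ((k', i), j)) = mult_map e D x (a, b) * c"
    for a b c
  proof -
    have "(\<Sum>k'\<in>UNIV. \<Sum>i\<le>e. \<Sum>j\<le>D. (if k' = a \<and> i + j = b then c else 0) * x ((k', i), j)) =
      (\<Sum>k'\<in>UNIV. if k' = a then (\<Sum>i\<le>e. \<Sum>j\<le>D. (if i + j = b then c * x ((a, i), j) else 0)) else 0)"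
      by (intro sum.cong refl) (auto intro!: sum.cong sum.neutral)
    also have "\<dots> = (\<Sum>i\<le>e. \<Sum>j\<le>D. (if i + j = b then c * x ((a, i), j) else 0))" by (simp add: sum.delta)
    also have "\<dots> = mult_map e D x (a, b) * c"
      by (auto simp: mult_map_def sum_distrib_right intro!: sum.cong)
    finally show ?thesis .
  qed
  show ?thesis
    unfolding sum.cartesian_product' hom_index_def factor_system_def
    by (simp add: left_diff_distrib sum_subtractf one)
qed

lemma solves_factor_system:
  fixes x :: "('k::finite \<times> nat) \<times> nat \<Rightarrow> complex"
  shows "solves (hom_index e \<times> {..D}) factor_system u x \<longleftrightarrow>
    (\<forall>j\<le>D. solves (hom_index e) parallel_system u (\<lambda>v. x (v, j))) \<and>
    (\<forall>s t. mult_map e D x s * u t = mult_map e D x t * u s)" (is "?L \<longleftrightarrow> ?A \<and> ?B")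
proof -
  have "?L \<longleftrightarrow> (\<forall>j s. (\<Sum>t\<in>hom_index e \<times> {..D}. factor_system (Inl (j, s)) t u * x t) = 0) \<and>
       (\<forall>k n l m. (\<Sum>t\<in>hom_index e \<times> {..D}. factor_system (Inr ((k, n), (l, m))) t u * x t) = 0)"
    unfolding solves_def split_sum_all by (simp only: split_paired_All)
  also have "\<dots> \<longleftrightarrow> ?A \<and> ?B"
    unfolding factor_system_sum_Inl factor_system_sum_Inr solves_def by auto
  finally show ?thesis .
qed

text \<open>
  If \<open>\<psi>\<close> is free of base points of degree \<open>e\<close>, the columns of a solution are multiples of \<open>\<psi>\<close>, so the
  solution is \<open>\<psi> \<otimes> \<zeta>\<close>; the second group of equations makes \<open>\<zeta> \<psi>\<close> proportional to
  \<open>\<xi> \<psi>\<close>. The solution space is therefore spanned by \<open>\<psi> \<otimes> \<xi>\<close>.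
\<close>

lemma factor_kernel:
  fixes \<psi> :: "complex poly ^ 'k::finite"
  assumes "basefree e \<psi>" "\<psi> \<in> homs e" "\<xi> \<noteq> 0" "degree \<xi> \<le> D"
  shows "solves (hom_index e \<times> {..D}) factor_system (hom_coords (\<xi> *s \<psi>)) (tensor \<psi> \<xi>)"
    and "solves (hom_index e \<times> {..D}) factor_system (hom_coords (\<xi> *s \<psi>)) x \<Longrightarrow>
      \<exists>c. \<forall>t\<in>hom_index e \<times> {..D}. x t = c * tensor \<psi> \<xi> t"
proof -
  show "solves (hom_index e \<times> {..D}) factor_system (hom_coords (\<xi> *s \<psi>)) (tensor \<psi> \<xi>)"
    unfolding solves_factor_system mult_map_tensor[OF assms(2,4)]
  proof (intro conjI allI impI)
    fix j
    have "(\<lambda>v. tensor \<psi> \<xi> (v, j)) = hom_coords ([:coeff \<xi> j:] *s \<psi>)"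
      by (simp add: tensor_def hom_coords_scale mult.commute)
    moreover have "parallel ([:coeff \<xi> j:] *s \<psi>) (\<xi> *s \<psi>)" by (simp add: parallel_def ac_simps)
    ultimately show "solves (hom_index e) parallel_system (hom_coords (\<xi> *s \<psi>)) (\<lambda>v. tensor \<psi> \<xi> (v, j))"
      using solves_parallel_system[OF homs_scale[OF assms(2)]] by simp
  qed simp
next
  let ?I = "hom_index e \<times> {..D} :: (('k \<times> nat) \<times> nat) set"
  assume "solves ?I factor_system (hom_coords (\<xi> *s \<psi>)) x"
  moreover define x' where "x' t = (if t \<in> ?I then x t else 0)" for t
  ultimately have sol: "solves ?I factor_system (hom_coords (\<xi> *s \<psi>)) x'"
    unfolding x'_def solves_restrict by simp
  have col: "\<exists>c. (\<lambda>v. x' (v, j)) = (\<lambda>v. c * hom_coords \<psi> v)" for j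
  proof (cases "j \<le> D")
    case True
    have "supported (hom_index e) (\<lambda>v. x' (v, j))" by (auto simp: supported_def x'_def)
    from hom_coords_surj[OF this] obtain \<phi> where \<phi>: "\<phi> \<in> homs e" "(\<lambda>v. x' (v, j)) = hom_coords \<phi>" by (elim bexE)
    have "solves (hom_index e) parallel_system (hom_coords (\<xi> *s \<psi>)) (\<lambda>v. x' (v, j))"
      using sol True unfolding solves_factor_system by simp
    then have "parallel \<phi> (\<xi> *s \<psi>)" unfolding \<phi>(2) solves_parallel_system[OF \<phi>(1)] .
    then have par: "parallel \<phi> \<psi>" using assms(3) by (simp add: parallel_def mult.left_commute)
    have "\<exists>c. \<phi> = [:c:] *s \<psi>"
    proof (cases "\<phi> = 0")
      case True
      then have "\<phi> = [:0:] *s \<psi>" by (simp add: vec_eq_iff)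
      then show ?thesis by blast
    next
      case False
      then obtain a where "\<phi> = a *s \<psi>" "degree a + e \<le> e"
        using parallel_basefree[OF assms(1,2) par \<phi>(1)] by blast
      then show ?thesis by (metis add_le_same_cancel2 degree_eq_zeroE le_zero_eq)
    qed
    then obtain c where "\<phi> = [:c:] *s \<psi>" by blast
    then show ?thesis unfolding \<phi>(2) by (intro exI[of _ c]) (simp add: hom_coords_scale)
  next
    case False
    then have "(\<lambda>v. x' (v, j)) = (\<lambda>v. 0 * hom_coords \<psi> v)" by (auto simp: x'_def)
    then show ?thesis by (rule exI)
  qed
  then obtain w where w: "\<And>j. (\<lambda>v. x' (v, j)) = (\<lambda>v. w j * hom_coords \<psi> v)" by metis
  have w': "x' (v, j) = w j * hom_coords \<psi> v" for v j using fun_cong[OF w[of j], of v] by simp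
  obtain v0 where v0: "hom_coords \<psi> v0 \<noteq> 0"
    using hom_coords_zero_iff[of \<psi>] basefree_nonzero[OF assms(1)] by (auto simp: fun_eq_iff)
  have "w j = 0" if "D < j" for j
  proof -
    have "x' (v0, j) = 0" using that by (simp add: x'_def)
    then show ?thesis using w'[of v0 j] v0 by simp
  qed
  then obtain \<zeta> where \<zeta>: "degree \<zeta> \<le> D" "w = coeff \<zeta>" using coeff_surj[of D w] by blast
  have x': "x' = tensor \<psi> \<zeta>"
    using w' \<zeta>(2) by (auto simp: tensor_def fun_eq_iff mult.commute)
  have ratio: "hom_coords (\<zeta> *s \<psi>) s * hom_coords (\<xi> *s \<psi>) t = hom_coords (\<zeta> *s \<psi>) t * hom_coords (\<xi> *s \<psi>) s" for s t
    using sol unfolding solves_factor_system x' mult_map_tensor[OF assms(2) \<zeta>(1)] by blast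
  have "\<xi> *s \<psi> \<noteq> 0" using assms(3) basefree_nonzero[OF assms(1)] by (simp add: scalar_mult_eq_0_iff)
  then obtain t0 where t0: "hom_coords (\<xi> *s \<psi>) t0 \<noteq> 0"
    using hom_coords_zero_iff[of "\<xi> *s \<psi>"] by (auto simp: fun_eq_iff)
  define c where "c = hom_coords (\<zeta> *s \<psi>) t0 / hom_coords (\<xi> *s \<psi>) t0"
  have "hom_coords (\<zeta> *s \<psi>) s = c * hom_coords (\<xi> *s \<psi>) s" for s
    using ratio[of s t0] t0 by (simp add: c_def field_simps)
  then have "hom_coords (\<zeta> *s \<psi>) = hom_coords ([:c:] *s (\<xi> *s \<psi>))" unfolding hom_coords_scale by (rule ext)
  then have eq: "\<zeta> *s \<psi> = [:c:] *s (\<xi> *s \<psi>)" by (simp only: hom_coords_inj)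
  obtain k where k: "\<psi> $ k \<noteq> 0" using basefree_nonzero[OF assms(1)] by (auto simp: vec_eq_iff)
  have "\<zeta> * \<psi> $ k = smult c \<xi> * \<psi> $ k" using arg_cong[OF eq, of "\<lambda>v. v $ k"] by simp
  then have "\<zeta> = smult c \<xi>" using k by (metis mult_cancel_right)
  then have "x' t = c * tensor \<psi> \<xi> t" for t
    unfolding x' by (cases t) (simp add: tensor_def)
  then have "\<forall>t\<in>?I. x t = c * tensor \<psi> \<xi> t" unfolding x'_def by (metis (full_types))
  then show "\<exists>c. \<forall>t\<in>?I. x t = c * tensor \<psi> \<xi> t" by (rule exI)
qed

lemma stratum_point:
  assumes "pt v \<in> stratum d e"
  shows "\<exists>\<psi> \<xi>. v = hom_coords (\<xi> *s \<psi>) \<and> pt (hom_coords \<psi>) \<in> R e \<and> degree \<xi> \<le> d - e \<and> \<xi> \<noteq> 0"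
proof -
  from assms obtain \<psi> \<xi> where *: "pt v = pt (hom_coords (\<xi> *s \<psi>))" "pt (hom_coords \<psi>) \<in> R e" "degree \<xi> \<le> d - e" "\<xi> \<noteq> 0"
    unfolding stratum_eq by (elim CollectE exE conjE)
  from *(1)[symmetric] obtain c where c: "c \<noteq> 0" "v = (\<lambda>i. c * hom_coords (\<xi> *s \<psi>) i)"
    unfolding pt_eq_iff by (elim exE conjE)
  have "[:c:] *s (\<xi> *s \<psi>) = smult c \<xi> *s \<psi>" by (simp add: vec_eq_iff)
  then have "v = hom_coords (smult c \<xi> *s \<psi>)" using c(2) hom_coords_scale[of c "\<xi> *s \<psi>"] by simp
  moreover have "degree (smult c \<xi>) \<le> d - e" "smult c \<xi> \<noteq> 0" using c(1) *(3,4) by simp_all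
  ultimately show ?thesis using *(2) by (intro exI[of _ \<psi>] exI[of _ "smult c \<xi>"] conjI)
qed

text \<open>
  The factors of a point of the stratum span the solution space of a linear system, so by
  elimination they are locally given by homogeneous polynomials in its coordinates.
\<close>

lemma regular_inverse:
  "regular_map (stratum d e) (inv_into (variety_prod (R e) (proj_forms (d - e))) (mult_point e (d - e)))"
  unfolding regular_map_def
proof
  let ?X = "variety_prod (R e) (proj_forms (d - e))" and ?\<mu> = "mult_point e (d - e)"
  let ?I = "hom_index e \<times> {..d - e} :: ((6 \<times> nat) \<times> nat) set"
  fix p assume "p \<in> stratum d e"
  then obtain \<psi>0 \<xi>0 where p: "p = pt (hom_coords (\<xi>0 *s \<psi>0))" "pt (hom_coords \<psi>0) \<in> R e" "degree \<xi>0 \<le> d - e" "\<xi>0 \<noteq> 0"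
    unfolding stratum_eq by (elim CollectE exE conjE)
  let ?v0 = "hom_coords (\<xi>0 *s \<psi>0)"
  have nonzero: "\<exists>t\<in>?I. tensor \<psi> \<xi> t \<noteq> 0" if "pt (hom_coords \<psi>) \<in> R e" "degree \<xi> \<le> d - e" "\<xi> \<noteq> 0" for \<psi> \<xi>
  proof -
    have "\<psi> \<in> homs e" "\<psi> \<noteq> 0" using that(1) R_iff basefree_nonzero by blast+
    then have "supported ?I (tensor \<psi> \<xi>)" "tensor \<psi> \<xi> \<noteq> (\<lambda>_. 0)"
      using tensor_supported that(2,3) by (simp_all add: tensor_zero_iff)
    then show ?thesis unfolding supported_def fun_eq_iff by blast
  qed
  have \<psi>0: "basefree e \<psi>0" "\<psi>0 \<in> homs e" using p(2) R_iff by blast+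
  have "\<exists>m G. (\<forall>u. homog_poly m (G u)) \<and> (\<exists>u\<in>?I. G u ?v0 \<noteq> 0) \<and>
      (\<forall>v x. solves ?I factor_system v x \<and> (\<exists>u\<in>?I. x u \<noteq> 0) \<longrightarrow> solves ?I factor_system v (\<lambda>u. G u v))"
    by (rule elimination_kernel[OF _ homog_factor_system factor_kernel(1)[OF \<psi>0 p(4,3)] nonzero[OF p(2-4)]
          factor_kernel(2)[OF \<psi>0 p(4,3)]]) (auto simp: finite_hom_index)
  then obtain m G where G: "\<forall>u. homog_poly m (G u)" "\<exists>u\<in>?I. G u ?v0 \<noteq> 0"
      "\<forall>v x. solves ?I factor_system v x \<and> (\<exists>u\<in>?I. x u \<noteq> 0) \<longrightarrow> solves ?I factor_system v (\<lambda>u. G u v)"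
    by (elim exE conjE)
  define H where "H v t = (if t \<in> ?I then G t v else 0)" for v t
  have H1: "homog_poly m (\<lambda>v. H v t)" for t
    unfolding H_def by (intro homog_if homog_zero G(1)[rule_format])
  have H2: "H v \<noteq> (\<lambda>_. 0)" if "v \<in> p" for v
  proof
    assume z: "H v = (\<lambda>_. 0)"
    from that obtain c where c: "c \<noteq> 0" "v = (\<lambda>i. c * ?v0 i)" unfolding p(1) mem_pt by (elim exE conjE)
    from G(2) obtain u where u: "u \<in> ?I" "G u ?v0 \<noteq> 0" by (elim bexE)
    have "H v u = c ^ m * G u ?v0" using u(1) homog_scale[OF G(1)[rule_format], of u c ?v0] by (simp add: H_def c(2))
    then show False using fun_cong[OF z, of u] u(2) c(1) by simp
  qed
  have H3: "inv_into ?X ?\<mu> (pt v) = pt (H v)" if v: "pt v \<in> stratum d e" and nz: "H v \<noteq> (\<lambda>_. 0)" for v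
  proof -
    from stratum_point[OF v] obtain \<psi> \<xi> where *: "v = hom_coords (\<xi> *s \<psi>)" "pt (hom_coords \<psi>) \<in> R e" "degree \<xi> \<le> d - e" "\<xi> \<noteq> 0"
      by (elim exE conjE)
    have \<psi>: "basefree e \<psi>" "\<psi> \<in> homs e" using *(2) R_iff by blast+
    have "solves ?I factor_system v (tensor \<psi> \<xi>)" unfolding *(1) by (rule factor_kernel(1)[OF \<psi> *(4,3)])
    then have "solves ?I factor_system v (\<lambda>u. G u v)"
      using G(3)[rule_format, of v "tensor \<psi> \<xi>"] nonzero[OF *(2-4)] by simp
    then obtain c where c: "\<forall>t\<in>?I. G t v = c * tensor \<psi> \<xi> t"
      using factor_kernel(2)[OF \<psi> *(4,3)] unfolding *(1) by blast
    have s: "supported ?I (tensor \<psi> \<xi>)" by (rule tensor_supported[OF \<psi>(2) *(3)])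
    have H: "H v = (\<lambda>t. c * tensor \<psi> \<xi> t)"
    proof
      fix t
      show "H v t = c * tensor \<psi> \<xi> t"
      proof (cases "t \<in> ?I")
        case True
        then show ?thesis using c[rule_format, OF True] by (simp add: H_def)
      next
        case False
        then show ?thesis using s[unfolded supported_def, rule_format, OF False] by (simp add: H_def)
      qed
    qed
    have "c \<noteq> 0"
    proof
      assume "c = 0"
      then have "H v = (\<lambda>_. 0)" unfolding H by simp
      then show False using nz by simp
    qed
    then have e: "pt (H v) = pt (tensor \<psi> \<xi>)" unfolding H by (rule pt_scale)
    have mem: "pt (tensor \<psi> \<xi>) \<in> ?X" unfolding variety_prod_eq using *(2-4) by blast
    have "pt v = ?\<mu> (pt (tensor \<psi> \<xi>))" using mult_point_tensor[OF *(2,3)] *(1) by simp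
    then show ?thesis unfolding e using inv_into_f_f[OF bij_betw_imp_inj_on[OF bij_mult_point] mem] by simp
  qed
  show "\<exists>n G. (\<forall>j. homog_poly n (\<lambda>v. G v j)) \<and> (\<forall>v\<in>p. G v \<noteq> (\<lambda>_. 0)) \<and>
      (\<forall>v. pt v \<in> stratum d e \<and> G v \<noteq> (\<lambda>_. 0) \<longrightarrow> inv_into ?X ?\<mu> (pt v) = pt (G v))"
  proof (intro exI[of _ m] exI[of _ H] conjI allI ballI impI)
    show "homog_poly m (\<lambda>v. H v j)" for j by (rule H1)
    show "H v \<noteq> (\<lambda>_. 0)" if "v \<in> p" for v using that by (rule H2)
    show "inv_into ?X ?\<mu> (pt v) = pt (H v)" if "pt v \<in> stratum d e \<and> H v \<noteq> (\<lambda>_. 0)" for v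
      using that by (intro H3) simp_all
  qed
qed

theorem proposition10:
  fixes d :: nat
  assumes "3 \<le> d"
  shows "zariski_closure (hom_index d) (R d) - R d =
           (\<Union>d'\<in>{0..<d}. stratum d d') \<union>
           (zariski_closure (hom_index d) (R0 d) \<union> zariski_closure (hom_index d) (R0' d)) \<and>
         (\<forall>d'\<in>{0..<d}. \<exists>\<mu>.
            variety_iso \<mu> (variety_prod (R d') (proj_forms (d - d'))) (stratum d d') \<and>
            (\<forall>\<psi> \<xi>. pt (hom_coords \<psi>) \<in> R d' \<and> \<xi> \<in> forms (d - d') \<and> \<xi> \<noteq> 0 \<longrightarrow>
               \<mu> (segre (hom_coords \<psi>) (coeff \<xi>)) = pt (hom_coords (\<xi> *s \<psi>))))"
proof (intro conjI ballI)
  show "zariski_closure (hom_index d) (R d) - R d =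
           (\<Union>d'\<in>{0..<d}. stratum d d') \<union>
           (zariski_closure (hom_index d) (R0 d) \<union> zariski_closure (hom_index d) (R0' d))"
    using boundary_of_R[of d] assms by simp
next
  fix e assume "e \<in> {0..<d}"
  then have "e \<le> d" by simp
  have "variety_iso (mult_point e (d - e)) (variety_prod (R e) (proj_forms (d - e))) (stratum d e)"
    unfolding variety_iso_def
    by (intro conjI quasi_projective_product quasi_projective_stratum \<open>e \<le> d\<close> bij_mult_point
        regular_mult_point regular_inverse)
  moreover have "\<forall>\<psi> \<xi>. pt (hom_coords \<psi>) \<in> R e \<and> \<xi> \<in> forms (d - e) \<and> \<xi> \<noteq> 0 \<longrightarrow>
     mult_point e (d - e) (segre (hom_coords \<psi>) (coeff \<xi>)) = pt (hom_coords (\<xi> *s \<psi>))"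
    by (simp add: forms_def segre_eq_tensor mult_point_tensor)
  ultimately show "\<exists>\<mu>. variety_iso \<mu> (variety_prod (R e) (proj_forms (d - e))) (stratum d e) \<and>
            (\<forall>\<psi> \<xi>. pt (hom_coords \<psi>) \<in> R e \<and> \<xi> \<in> forms (d - e) \<and> \<xi> \<noteq> 0 \<longrightarrow>
               \<mu> (segre (hom_coords \<psi>) (coeff \<xi>)) = pt (hom_coords (\<xi> *s \<psi>)))"
    by (intro exI conjI)
qed

end
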